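(* Let $\mathcal{L}$ be a left $B$-Hopf algebroid, $N$ a $\overline B$-ring, and $(\sigma,\triangleright)$, $(\sigma',\triangleright')$ two 2-cocycles of $\mathcal{L}^{cop}$ over $N$ making $N$ a $\sigma$-twisted, respectively $\sigma'$-twisted, left $\mathcal{L}^{cop}$-module algebra. Then $(\sigma,\triangleright)$ and $(\sigma',\triangleright')$ are equivalent if and only if $\mathcal{L}\#_{\sigma}N\simeq\mathcal{L}\#_{\sigma'}N$ as left $\mathcal{L}$-comodule algebras.
   Context: $k$ is a field, $B$ a unital $k$-algebra, $\overline B$ its opposite algebra with canonical anti-isomorphism $B\to\overline B$, $b\mapsto\bar b$, and $B^e=B\otimes\overline B$. $M\diamond_B N:=M\otimes N/\langle \bar bm\otimes n-m\otimes bn\rangle$; $M\times_BN:=\{\sum m_i\otimes n_i\in M\diamond_BN:\ \sum m_i\bar a\otimes n_i=\sum m_i\otimes n_ia\ \forall a\in B\}$. A $B$-ring (resp. $\overline B$-ring) is an algebra with an algebra map from $B$ (resp. $\overline B$). A left bialgebroid over $B$ is an algebra $\mathcal{L}$ with algebra maps $s:B\to\mathcal{L}$, $t:\overline B\to\mathcal{L}$ with commuting images (one writes $b,\bar b$ for $s(b),t(\bar b)$), with left $B^e$-module maps $\Delta:\mathcal{L}\to\mathcal{L}\times_B\mathcal{L}$, $\Delta(X)=X_{(1)}\otimes X_{(2)}$ (so $\Delta(b\bar cX)=bX_{(1)}\otimes\bar cX_{(2)}$) and $\varepsilon:\mathcal{L}\to B$ (so $\varepsilon(b\bar cX)=b\varepsilon(X)c$),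 coassociative and counital ($\varepsilon(X_{(1)})X_{(2)}=\overline{\varepsilon(X_{(2)})}X_{(1)}=X$), such that $\Delta$ is an algebra map (componentwise product on $\mathcal{L}\times_B\mathcal{L}$), $\varepsilon(1)=1$ and $\varepsilon(X\varepsilon(Y))=\varepsilon(XY)=\varepsilon(X\overline{\varepsilon(Y)})$. Standing assumption: all $B$-module and $\overline B$-module structures are faithfully flat. $\mathcal{L}$ is a left $B$-Hopf algebroid (left Hopf algebroid over $B$) if $\lambda:\mathcal{L}\otimes_{\overline B}\mathcal{L}\to\mathcal{L}\diamond_B\mathcal{L}$, $\lambda(X\otimes Y)=X_{(1)}\otimes X_{(2)}Y$, is bijective; $X_+\otimes_{\overline B}X_-:=\lambda^{-1}(X\diamond1)$. A left $\mathcal{L}$-comodule algebra is a $B$-ring $P$ with a coassociative counital coaction $P\to\mathcal{L}\times_BP$, $p\mapsto p_{(-1)}\otimes p_{(0)}$, that is a $B$-ring map with $bpb'\mapsto bp_{(-1)}b'\otimes p_{(0)}$; morphisms are $B$-ring maps that are $\mathcal{L}$-colinear. $\mathcal{L}^{cop}$ is the algebra $\mathcal{L}$ viewed as a left bialgebroid over $\overline B$ with source $t$, target $s$ and the opposite coproduct. All Sweedler indices below refer to the coproduct of $\mathcal{L}$. A measuring of $\mathcal{L}^{cop}$ on $N$ is a linear map $\triangleright:\mathcal{L}\otimes_{\overline B}N\to N$ with $(b\bar b'X)\triangleright n=\bar b'(X\triangleright n)\bar b$, $X\triangleright\bar b=\overline{\varepsilon(X\bar b)}=\overline{\varepsilon(Xb)}$,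 $X\triangleright(mn)=(X_{(2)}\triangleright m)(X_{(1)}\triangleright n)$. A 2-cocycle $(\sigma,\triangleright)$ of $\mathcal{L}^{cop}$ over $N$ is a measuring $\triangleright$ together with a map $\sigma:\mathcal{L}\otimes_{B^e}\mathcal{L}\to N$, invertible for the convolution $(f*g)(X,Y)=f(X_{(2)},Y_{(2)})g(X_{(1)},Y_{(1)})$ with unit $\overline{\varepsilon(XY)}$, such that $\sigma(b\bar b'X,Y)=\bar b'\sigma(X,Y)\bar b$; $\sigma(X,1)=\sigma(1,X)=\overline{\varepsilon(X)}$; $\sigma(X,Y\bar b)=\sigma(X,Yb)$; and $\sigma(X_{(2)},Y_{(2)}Z_{(2)})(X_{(1)}\triangleright\sigma(Y_{(1)},Z_{(1)}))=\sigma(X_{(2)}Y_{(2)},Z)\,\sigma(X_{(1)},Y_{(1)})$. $N$ is a $\sigma$-twisted left $\mathcal{L}^{cop}$-module algebra if moreover $\sigma(X_{(2)},Y_{(2)})(X_{(1)}\triangleright(Y_{(1)}\triangleright n))=((X_{(2)}Y_{(2)})\triangleright n)\,\sigma(X_{(1)},Y_{(1)})$. Then the $\sigma$-twisted crossed product $\mathcal{L}\#_\sigma N$ is the algebra $\mathcal{L}\otimes_{\overline B}N$ with product $(X\otimes n)(Y\otimes m)=X_+Y_+\otimes\sigma(Y_{-(2)},X_-)(Y_{-(1)}\triangleright n)m$; it is a left $\mathcal{L}$-comodule algebra with coaction $X\otimes n\mapsto X_{(1)}\otimes(X_{(2)}\otimes n)$ and $B$-bimodule structure $b(X\otimes n)b'=bXb'\otimes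 n$. $C^1(\mathcal{L}^{cop},N)$ is the set of maps $u:\mathcal{L}\to N$ with $u(b\bar b'X)=\bar b'u(X)\bar b$ and $u(Xb)=u(X\bar b)$ that are invertible for the convolution $(u*v)(X)=u(X_{(2)})v(X_{(1)})$ with unit $\overline{\varepsilon(X)}$. $(\sigma,\triangleright)$ and $(\sigma',\triangleright')$ are equivalent if there is $u\in C^1(\mathcal{L}^{cop},N)$ with, for all $X,Y\in\mathcal{L}$, $n\in N$, $X\triangleright'n=u(X_{(3)})(X_{(2)}\triangleright n)u^{-1}(X_{(1)})$ and $\sigma'(X,Y)=u(X_{(4)}Y_{(3)})\,\sigma(X_{(3)},Y_{(2)})\,(X_{(2)}\triangleright u^{-1}(Y_{(1)}))\,u^{-1}(X_{(1)})$.
   Formalization: The isomorphism of crossed products is required to fix N, i.e. to send 1⊗n to 1⊗n (otherwise "if" fails, e.g. k[Z/2] acting on k³ by different swaps), and a twisted module algebra is required to satisfy 1▷n = n (otherwise the crossed product need not be unital). *)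

theory Defs
  imports Complex_Main "HOL-Library.Multiset" "HOL-Algebra.Ring"
begin

text \<open>
  Conventions.  The field k and the algebras B, L, N are types; the sort
  \<^verbatim>\<open>{ring, monoid_mult}\<close> is that of unital rings in which 0 = 1 is not excluded.  The opposite
  algebra of B is carried by B itself, so an algebra map from the opposite algebra is an
  anti-multiplicative map on B, and \<open>tgt b\<close>, \<open>bar b\<close> stand for the images of the
  element b-bar.  Objects that depend on parameters (tensor products, crossed products) are records
  of HOL-Algebra.
\<close>

section \<open>Algebras over a field\<close>

locale k_algebra = vector_space scale
  for scale :: "'k::field \<Rightarrow> 'a::{ring,monoid_mult} \<Rightarrow> 'a" +
  assumes scale_mult_left: "scale c (x * y) = scale c x * y"
    and scale_mult_right: "scale c (x * y) = x * scale c y"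

definition algebra_map ::
  "('k::field \<Rightarrow> 'a::{ring,monoid_mult} \<Rightarrow> 'a) \<Rightarrow> ('k \<Rightarrow> 'c::{ring,monoid_mult} \<Rightarrow> 'c) \<Rightarrow> ('a \<Rightarrow> 'c) \<Rightarrow> bool"
  where "algebra_map sA sC f \<longleftrightarrow>
    Vector_Spaces.linear sA sC f \<and> f 1 = 1 \<and> (\<forall>x y. f (x * y) = f x * f y)"

definition anti_algebra_map ::
  "('k::field \<Rightarrow> 'a::{ring,monoid_mult} \<Rightarrow> 'a) \<Rightarrow> ('k \<Rightarrow> 'c::{ring,monoid_mult} \<Rightarrow> 'c) \<Rightarrow> ('a \<Rightarrow> 'c) \<Rightarrow> bool"
  where "anti_algebra_map sA sC f \<longleftrightarrow>
    Vector_Spaces.linear sA sC f \<and> f 1 = 1 \<and> (\<forall>x y. f (x * y) = f y * f x)"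

definition type_ring :: "'a::{ring,monoid_mult} ring"
  where "type_ring = \<lparr>carrier = UNIV, mult = (*), one = 1, zero = 0, add = (+)\<rparr>"

section \<open>Balanced tensor products\<close>

text \<open>
  Elements of a tensor product of two abelian groups M and N are classes of finite formal sums
  (multisets of pairs).  The congruence is generated by biadditivity and by the relations
  \<^verbatim>\<open>ra x r (x) y = x (x) la r y\<close>.  All balancings below are over B or its opposite;
  since k acts through B, they contain the balancing over k.
\<close>

inductive tensor_eq ::
  "('a,'m) ring_scheme \<Rightarrow> ('a \<Rightarrow> 'r \<Rightarrow> 'a) \<Rightarrow> ('c,'n) ring_scheme \<Rightarrow> ('r \<Rightarrow> 'c \<Rightarrow> 'c) \<Rightarrow>
   ('a \<times> 'c) multiset \<Rightarrow> ('a \<times> 'c) multiset \<Rightarrow> bool"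
  for M ra N la
  where
    refl: "set_mset S \<subseteq> carrier M \<times> carrier N \<Longrightarrow> tensor_eq M ra N la S S"
  | sym: "tensor_eq M ra N la S T \<Longrightarrow> tensor_eq M ra N la T S"
  | trans: "tensor_eq M ra N la S T \<Longrightarrow> tensor_eq M ra N la T U \<Longrightarrow> tensor_eq M ra N la S U"
  | plus: "tensor_eq M ra N la S S' \<Longrightarrow> tensor_eq M ra N la T T' \<Longrightarrow>
      tensor_eq M ra N la (S + T) (S' + T')"
  | zero_left: "y \<in> carrier N \<Longrightarrow> tensor_eq M ra N la {#(\<zero>\<^bsub>M\<^esub>, y)#} {#}"
  | zero_right: "x \<in> carrier M \<Longrightarrow> tensor_eq M ra N la {#(x, \<zero>\<^bsub>N\<^esub>)#} {#}"
  | add_left: "x \<in> carrier M \<Longrightarrow> x' \<in> carrier M \<Longrightarrow> y \<in> carrier N \<Longrightarrow>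
      tensor_eq M ra N la {#(x \<oplus>\<^bsub>M\<^esub> x', y)#} {#(x, y), (x', y)#}"
  | add_right: "x \<in> carrier M \<Longrightarrow> y \<in> carrier N \<Longrightarrow> y' \<in> carrier N \<Longrightarrow>
      tensor_eq M ra N la {#(x, y \<oplus>\<^bsub>N\<^esub> y')#} {#(x, y), (x, y')#}"
  | balanced: "x \<in> carrier M \<Longrightarrow> y \<in> carrier N \<Longrightarrow> ra x r \<in> carrier M \<Longrightarrow> la r y \<in> carrier N \<Longrightarrow>
      tensor_eq M ra N la {#(ra x r, y)#} {#(x, la r y)#}"

definition tensor_class ::
  "('a,'m) ring_scheme \<Rightarrow> ('a \<Rightarrow> 'r \<Rightarrow> 'a) \<Rightarrow> ('c,'n) ring_scheme \<Rightarrow> ('r \<Rightarrow> 'c \<Rightarrow> 'c) \<Rightarrow>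
   ('a \<times> 'c) multiset \<Rightarrow> ('a \<times> 'c) multiset set"
  where "tensor_class M ra N la S = {T. tensor_eq M ra N la S T}"

definition rep :: "'a set \<Rightarrow> 'a"
  where "rep U = (SOME S. S \<in> U)"

text \<open>Only the additive structure of this record is meaningful.\<close>

definition tensor ::
  "('a,'m) ring_scheme \<Rightarrow> ('a \<Rightarrow> 'r \<Rightarrow> 'a) \<Rightarrow> ('c,'n) ring_scheme \<Rightarrow> ('r \<Rightarrow> 'c \<Rightarrow> 'c) \<Rightarrow>
   ('a \<times> 'c) multiset set ring"
  where "tensor M ra N la =
    \<lparr>carrier = tensor_class M ra N la ` {S. set_mset S \<subseteq> carrier M \<times> carrier N},
     mult = undefined, one = undefined,
     zero = tensor_class M ra N la {#},
     add = (\<lambda>U V. tensor_class M ra N la (rep U + rep V))\<rparr>"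

text \<open>
  For a tensor U, \<open>sweedler U f\<close> is the sum of the values \<open>f x y\<close> over the
  terms of a formal sum representing U.  It is applied to biadditive balanced f only (with values in
  an algebra, or in formal sums whose class is then taken), so the representative does not matter.
\<close>

definition sweedler :: "('a \<times> 'c) multiset set \<Rightarrow> ('a \<Rightarrow> 'c \<Rightarrow> 'd::comm_monoid_add) \<Rightarrow> 'd"
  where "sweedler U f = sum_mset (image_mset (\<lambda>(x, y). f x y) (rep U))"

section \<open>Faithful flatness\<close>

text \<open>
  Below, \<open>mul\<close> is the multiplication of B or of its opposite.
\<close>

definition left_module_over ::
  "('b \<Rightarrow> 'b \<Rightarrow> 'b) \<Rightarrow> ('v,'m) ring_scheme \<Rightarrow> ('b::{ring,monoid_mult} \<Rightarrow> 'v \<Rightarrow> 'v) \<Rightarrow> bool"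
  where "left_module_over mul V act \<longleftrightarrow>
    abelian_group V \<and>
    (\<forall>r. \<forall>v\<in>carrier V. act r v \<in> carrier V) \<and>
    (\<forall>r. \<forall>v\<in>carrier V. \<forall>w\<in>carrier V. act r (v \<oplus>\<^bsub>V\<^esub> w) = act r v \<oplus>\<^bsub>V\<^esub> act r w) \<and>
    (\<forall>r r'. \<forall>v\<in>carrier V. act (r + r') v = act r v \<oplus>\<^bsub>V\<^esub> act r' v) \<and>
    (\<forall>r r'. \<forall>v\<in>carrier V. act (mul r r') v = act r (act r' v)) \<and>
    (\<forall>v\<in>carrier V. act 1 v = v)"

definition module_map ::
  "('v,'m) ring_scheme \<Rightarrow> ('b \<Rightarrow> 'v \<Rightarrow> 'v) \<Rightarrow> ('w,'n) ring_scheme \<Rightarrow> ('b \<Rightarrow> 'w \<Rightarrow> 'w) \<Rightarrow> ('v \<Rightarrow> 'w) \<Rightarrow> bool"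
  where "module_map V aV W aW f \<longleftrightarrow>
    (\<forall>v\<in>carrier V. f v \<in> carrier W) \<and>
    (\<forall>v\<in>carrier V. \<forall>w\<in>carrier V. f (v \<oplus>\<^bsub>V\<^esub> w) = f v \<oplus>\<^bsub>W\<^esub> f w) \<and>
    (\<forall>r. \<forall>v\<in>carrier V. f (aV r v) = aW r (f v))"

definition exact_seq ::
  "('v,'m) ring_scheme \<Rightarrow> ('v \<Rightarrow> 'w) \<Rightarrow> ('w,'n) ring_scheme \<Rightarrow> ('w \<Rightarrow> 'x) \<Rightarrow> ('x,'o) ring_scheme \<Rightarrow> bool"
  where "exact_seq V f W g X \<longleftrightarrow> f ` carrier V = {w \<in> carrier W. g w = \<zero>\<^bsub>X\<^esub>}"

definition tensor_map_right ::
  "('a,'m) ring_scheme \<Rightarrow> ('a \<Rightarrow> 'r \<Rightarrow> 'a) \<Rightarrow> ('w,'n) ring_scheme \<Rightarrow> ('r \<Rightarrow> 'w \<Rightarrow> 'w) \<Rightarrow> ('v \<Rightarrow> 'w) \<Rightarrow>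
   ('a \<times> 'v) multiset set \<Rightarrow> ('a \<times> 'w) multiset set"
  where "tensor_map_right M ra W aW f U = tensor_class M ra W aW (sweedler U (\<lambda>x v. {#(x, f v)#}))"

text \<open>
  M is a right module by \<open>ra\<close>; a sequence V, W, X of left modules is exact iff its tensor
  product with M is.  The modules tested are those with elements in the type \<^verbatim>\<open>'b set\<close>.
  This is no restriction: up to isomorphism they include B, its left ideals I (as singletons) and
  the quotients B/I (as cosets), which suffice to test flatness (injectivity of M(x)I to M(x)B) and
  faithfulness (M(x)B/I nonzero for proper I).
\<close>

definition faithfully_flat ::
  "('b \<Rightarrow> 'b \<Rightarrow> 'b::{ring,monoid_mult}) \<Rightarrow> ('a,'m) ring_scheme \<Rightarrow> ('a \<Rightarrow> 'b \<Rightarrow> 'a) \<Rightarrow> bool"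
  where "faithfully_flat mul M ra \<longleftrightarrow>
    (\<forall>(V :: 'b set ring) (W :: 'b set ring) (X :: 'b set ring) aV aW aX f g.
      left_module_over mul V aV \<longrightarrow> left_module_over mul W aW \<longrightarrow> left_module_over mul X aX \<longrightarrow>
      module_map V aV W aW f \<longrightarrow> module_map W aW X aX g \<longrightarrow>
      (exact_seq V f W g X \<longleftrightarrow>
       exact_seq (tensor M ra V aV) (tensor_map_right M ra W aW f)
                 (tensor M ra W aW) (tensor_map_right M ra X aX g) (tensor M ra X aX)))"

section \<open>Left bialgebroids\<close>

record ('k, 'b, 'l) bialgebroid =
  bscale :: "'k \<Rightarrow> 'b \<Rightarrow> 'b"
  lscale :: "'k \<Rightarrow> 'l \<Rightarrow> 'l"
  src :: "'b \<Rightarrow> 'l"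
  tgt :: "'b \<Rightarrow> 'l"
  comult :: "'l \<Rightarrow> ('l \<times> 'l) multiset set"
  counit :: "'l \<Rightarrow> 'b"

text \<open>
  The diamond product of L with a left B-module P, and the class in it of a formal sum.
\<close>

definition diamond ::
  "('k::field, 'b::{ring,monoid_mult}, 'l::{ring,monoid_mult}, 'z) bialgebroid_scheme \<Rightarrow>
   ('p,'m) ring_scheme \<Rightarrow> ('b \<Rightarrow> 'p \<Rightarrow> 'p) \<Rightarrow> ('l \<times> 'p) multiset set ring"
  where "diamond H P la = tensor (type_ring :: 'l ring) (\<lambda>X b. tgt H b * X) P la"

definition dcls ::
  "('k::field, 'b::{ring,monoid_mult}, 'l::{ring,monoid_mult}, 'z) bialgebroid_scheme \<Rightarrow>
   ('p,'m) ring_scheme \<Rightarrow> ('b \<Rightarrow> 'p \<Rightarrow> 'p) \<Rightarrow> ('l \<times> 'p) multiset \<Rightarrow> ('l \<times> 'p) multiset set"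
  where "dcls H P la = tensor_class (type_ring :: 'l ring) (\<lambda>X b. tgt H b * X) P la"

definition takeuchi ::
  "('k::field, 'b::{ring,monoid_mult}, 'l::{ring,monoid_mult}, 'z) bialgebroid_scheme \<Rightarrow>
   ('p,'m) ring_scheme \<Rightarrow> ('b \<Rightarrow> 'p \<Rightarrow> 'p) \<Rightarrow> ('p \<Rightarrow> 'b \<Rightarrow> 'p) \<Rightarrow> ('l \<times> 'p) multiset set set"
  where "takeuchi H P la ra = {U \<in> carrier (diamond H P la).
    \<forall>a. dcls H P la (sweedler U (\<lambda>X p. {#(X * tgt H a, p)#})) =
        dcls H P la (sweedler U (\<lambda>X p. {#(X, ra p a)#}))}"

abbreviation src_left ::
  "('k::field, 'b::{ring,monoid_mult}, 'l::{ring,monoid_mult}, 'z) bialgebroid_scheme \<Rightarrow> 'b \<Rightarrow> 'l \<Rightarrow> 'l"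
  where "src_left H \<equiv> (\<lambda>b X. src H b * X)"

abbreviation LdL ::
  "('k::field, 'b::{ring,monoid_mult}, 'l::{ring,monoid_mult}, 'z) bialgebroid_scheme \<Rightarrow>
   ('l \<times> 'l) multiset set ring"
  where "LdL H \<equiv> diamond H type_ring (src_left H)"

abbreviation LdL_class ::
  "('k::field, 'b::{ring,monoid_mult}, 'l::{ring,monoid_mult}, 'z) bialgebroid_scheme \<Rightarrow>
   ('l \<times> 'l) multiset \<Rightarrow> ('l \<times> 'l) multiset set"
  where "LdL_class H \<equiv> dcls H type_ring (src_left H)"

text \<open>
  The left B-action on \<open>LdL H\<close> through the first factor, used for the triple product
  \<^verbatim>\<open>L (diamond) (L (diamond) L)\<close> in which coassociativity is stated.
\<close>

definition LdL_left ::
  "('k::field, 'b::{ring,monoid_mult}, 'l::{ring,monoid_mult}, 'z) bialgebroid_scheme \<Rightarrow>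
   'b \<Rightarrow> ('l \<times> 'l) multiset set \<Rightarrow> ('l \<times> 'l) multiset set"
  where "LdL_left H b U = LdL_class H (sweedler U (\<lambda>X Y. {#(src H b * X, Y)#}))"

locale left_bialgebroid =
  fixes H :: "('k::field, 'b::{ring,monoid_mult}, 'l::{ring,monoid_mult}, 'z) bialgebroid_scheme"
  assumes base_algebra: "k_algebra (bscale H)"
    and total_algebra: "k_algebra (lscale H)"
    and src_map: "algebra_map (bscale H) (lscale H) (src H)"
    and tgt_map: "anti_algebra_map (bscale H) (lscale H) (tgt H)"
    and src_tgt_commute: "src H b * tgt H c = tgt H c * src H b"
    and comult_takeuchi:
      "comult H X \<in> takeuchi H type_ring (src_left H) (\<lambda>Y a. Y * src H a)"
    and comult_add: "comult H (X + Y) = comult H X \<oplus>\<^bsub>LdL H\<^esub> comult H Y"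
    and comult_bimodule: "comult H (src H b * tgt H c * X) =
      LdL_class H (sweedler (comult H X) (\<lambda>X1 X2. {#(src H b * X1, tgt H c * X2)#}))"
    and counit_linear: "Vector_Spaces.linear (lscale H) (bscale H) (counit H)"
    and counit_bimodule: "counit H (src H b * tgt H c * X) = b * counit H X * c"
    and coassoc:
      "dcls H (LdL H) (LdL_left H)
         (sweedler (comult H X) (\<lambda>X1 X2. {#(X1, comult H X2)#})) =
       dcls H (LdL H) (LdL_left H)
         (sweedler (comult H X) (\<lambda>X1 X2. sweedler (comult H X1) (\<lambda>X11 X12.
            {#(X11, LdL_class H {#(X12, X2)#})#})))"
    and counit_left: "sweedler (comult H X) (\<lambda>X1 X2. src H (counit H X1) * X2) = X"
    and counit_right: "sweedler (comult H X) (\<lambda>X1 X2. tgt H (counit H X2) * X1) = X"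
    and comult_mult: "comult H (X * Y) =
      LdL_class H (sweedler (comult H X) (\<lambda>X1 X2. sweedler (comult H Y) (\<lambda>Y1 Y2.
        {#(X1 * Y1, X2 * Y2)#})))"
    and comult_one: "comult H 1 = LdL_class H {#(1, 1)#}"
    and counit_one: "counit H 1 = 1"
    and counit_mult_src: "counit H (X * src H (counit H Y)) = counit H (X * Y)"
    and counit_mult_tgt: "counit H (X * tgt H (counit H Y)) = counit H (X * Y)"

text \<open>
  The four module structures of L: right B (via \<open>src\<close>) and left opposite-B (via
  \<open>tgt\<close>), which are right B-modules; left B and right opposite-B, which are right modules
  over the opposite of B.
\<close>

definition faithfully_flat_bialgebroid ::
  "('k::field, 'b::{ring,monoid_mult}, 'l::{ring,monoid_mult}, 'z) bialgebroid_scheme \<Rightarrow> bool"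
  where "faithfully_flat_bialgebroid H \<longleftrightarrow>
    faithfully_flat (\<lambda>a b. a * b) (type_ring :: 'l ring) (\<lambda>X b. X * src H b) \<and>
    faithfully_flat (\<lambda>a b. a * b) (type_ring :: 'l ring) (\<lambda>X b. tgt H b * X) \<and>
    faithfully_flat (\<lambda>a b. b * a) (type_ring :: 'l ring) (\<lambda>X b. src H b * X) \<and>
    faithfully_flat (\<lambda>a b. b * a) (type_ring :: 'l ring) (\<lambda>X b. X * tgt H b)"

definition tensor_bar ::
  "('k::field, 'b::{ring,monoid_mult}, 'l::{ring,monoid_mult}, 'z) bialgebroid_scheme \<Rightarrow>
   ('b \<Rightarrow> 'n::{ring,monoid_mult}) \<Rightarrow> ('l \<times> 'n) multiset set ring"
  where "tensor_bar H bar = tensor type_ring (\<lambda>X b. X * tgt H b) type_ring (\<lambda>b n. bar b * n)"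

definition bcls ::
  "('k::field, 'b::{ring,monoid_mult}, 'l::{ring,monoid_mult}, 'z) bialgebroid_scheme \<Rightarrow>
   ('b \<Rightarrow> 'n::{ring,monoid_mult}) \<Rightarrow> ('l \<times> 'n) multiset \<Rightarrow> ('l \<times> 'n) multiset set"
  where "bcls H bar = tensor_class type_ring (\<lambda>X b. X * tgt H b) type_ring (\<lambda>b n. bar b * n)"

definition galois_map ::
  "('k::field, 'b::{ring,monoid_mult}, 'l::{ring,monoid_mult}, 'z) bialgebroid_scheme \<Rightarrow>
   ('l \<times> 'l) multiset set \<Rightarrow> ('l \<times> 'l) multiset set"
  where "galois_map H U = LdL_class H (sweedler U (\<lambda>X Y.
    sweedler (comult H X) (\<lambda>X1 X2. {#(X1, X2 * Y)#})))"

locale left_hopf_algebroid = left_bialgebroid +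
  assumes galois_bijective:
    "bij_betw (galois_map H) (carrier (tensor_bar H (tgt H))) (carrier (LdL H))"

definition plus_minus ::
  "('k::field, 'b::{ring,monoid_mult}, 'l::{ring,monoid_mult}, 'z) bialgebroid_scheme \<Rightarrow>
   'l \<Rightarrow> ('l \<times> 'l) multiset set"
  where "plus_minus H X =
    inv_into (carrier (tensor_bar H (tgt H))) (galois_map H) (LdL_class H {#(X, 1)#})"

definition sweedler3 ::
  "('k::field, 'b::{ring,monoid_mult}, 'l::{ring,monoid_mult}, 'z) bialgebroid_scheme \<Rightarrow> 'l \<Rightarrow>
   ('l \<Rightarrow> 'l \<Rightarrow> 'l \<Rightarrow> 'd::comm_monoid_add) \<Rightarrow> 'd"
  where "sweedler3 H X f =
    sweedler (comult H X) (\<lambda>X1 Z. sweedler (comult H Z) (\<lambda>X2 X3. f X1 X2 X3))"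

definition sweedler4 ::
  "('k::field, 'b::{ring,monoid_mult}, 'l::{ring,monoid_mult}, 'z) bialgebroid_scheme \<Rightarrow> 'l \<Rightarrow>
   ('l \<Rightarrow> 'l \<Rightarrow> 'l \<Rightarrow> 'l \<Rightarrow> 'd::comm_monoid_add) \<Rightarrow> 'd"
  where "sweedler4 H X f =
    sweedler (comult H X) (\<lambda>X1 Z. sweedler3 H Z (\<lambda>X2 X3 X4. f X1 X2 X3 X4))"

section \<open>Left comodule algebras\<close>

text \<open>
  \<open>unit_map\<close> is the algebra map from B; it determines the k-algebra and the B-bimodule
  structure, so that maps commuting with it are k-linear and B-bilinear.
\<close>

record ('b, 'l, 'p) comodule_algebra = "'p ring" +
  unit_map :: "'b \<Rightarrow> 'p"
  coaction :: "'p \<Rightarrow> ('l \<times> 'p) multiset set"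

definition comodule_algebra_hom ::
  "('k::field, 'b::{ring,monoid_mult}, 'l::{ring,monoid_mult}, 'z) bialgebroid_scheme \<Rightarrow>
   ('b,'l,'p) comodule_algebra \<Rightarrow> ('b,'l,'q) comodule_algebra \<Rightarrow> ('p \<Rightarrow> 'q) set"
  where "comodule_algebra_hom H P Q = {\<phi> \<in> ring_hom P Q.
    (\<forall>b. \<phi> (unit_map P b) = unit_map Q b) \<and>
    (\<forall>p\<in>carrier P. coaction Q (\<phi> p) =
      dcls H Q (\<lambda>b q. unit_map Q b \<otimes>\<^bsub>Q\<^esub> q)
        (sweedler (coaction P p) (\<lambda>X p0. {#(X, \<phi> p0)#})))}"

definition comodule_algebra_iso ::
  "('k::field, 'b::{ring,monoid_mult}, 'l::{ring,monoid_mult}, 'z) bialgebroid_scheme \<Rightarrow>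
   ('b,'l,'p) comodule_algebra \<Rightarrow> ('b,'l,'q) comodule_algebra \<Rightarrow> ('p \<Rightarrow> 'q) set"
  where "comodule_algebra_iso H P Q =
    {\<phi> \<in> comodule_algebra_hom H P Q. bij_betw \<phi> (carrier P) (carrier Q)}"

section \<open>Measurings, 2-cocycles and twisted module algebras\<close>

text \<open>
  N is an algebra with scalar multiplication \<open>sN\<close> and an algebra map \<open>bar\<close> from
  the opposite of B.  The coproduct is that of L throughout.
\<close>

definition bar_ring ::
  "('k::field, 'b::{ring,monoid_mult}, 'l::{ring,monoid_mult}, 'z) bialgebroid_scheme \<Rightarrow>
   ('k \<Rightarrow> 'n::{ring,monoid_mult} \<Rightarrow> 'n) \<Rightarrow> ('b \<Rightarrow> 'n) \<Rightarrow> bool"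
  where "bar_ring H sN bar \<longleftrightarrow> k_algebra sN \<and> anti_algebra_map (bscale H) sN bar"

definition measuring ::
  "('k::field, 'b::{ring,monoid_mult}, 'l::{ring,monoid_mult}, 'z) bialgebroid_scheme \<Rightarrow>
   ('k \<Rightarrow> 'n::{ring,monoid_mult} \<Rightarrow> 'n) \<Rightarrow> ('b \<Rightarrow> 'n) \<Rightarrow> ('l \<Rightarrow> 'n \<Rightarrow> 'n) \<Rightarrow> bool"
  where "measuring H sN bar act \<longleftrightarrow>
    (\<forall>X. Vector_Spaces.linear sN sN (act X)) \<and>
    (\<forall>n. Vector_Spaces.linear (lscale H) sN (\<lambda>X. act X n)) \<and>
    (\<forall>X b n. act (X * tgt H b) n = act X (bar b * n)) \<and>
    (\<forall>b b' X n. act (src H b * tgt H b' * X) n = bar b' * act X n * bar b) \<and>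
    (\<forall>X b. act X (bar b) = bar (counit H (X * tgt H b))) \<and>
    (\<forall>X b. act X (bar b) = bar (counit H (X * src H b))) \<and>
    (\<forall>X m n. act X (m * n) = sweedler (comult H X) (\<lambda>X1 X2. act X2 m * act X1 n))"

definition cochain2 ::
  "('k::field, 'b::{ring,monoid_mult}, 'l::{ring,monoid_mult}, 'z) bialgebroid_scheme \<Rightarrow>
   ('k \<Rightarrow> 'n::{ring,monoid_mult} \<Rightarrow> 'n) \<Rightarrow> ('b \<Rightarrow> 'n) \<Rightarrow> ('l \<Rightarrow> 'l \<Rightarrow> 'n) \<Rightarrow> bool"
  where "cochain2 H sN bar f \<longleftrightarrow>
    (\<forall>X. Vector_Spaces.linear (lscale H) sN (f X)) \<and>
    (\<forall>Y. Vector_Spaces.linear (lscale H) sN (\<lambda>X. f X Y)) \<and>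
    (\<forall>X Y b. f (X * src H b) Y = f X (src H b * Y)) \<and>
    (\<forall>X Y b. f (X * tgt H b) Y = f X (tgt H b * Y)) \<and>
    (\<forall>b b' X Y. f (src H b * tgt H b' * X) Y = bar b' * f X Y * bar b)"

definition conv2 ::
  "('k::field, 'b::{ring,monoid_mult}, 'l::{ring,monoid_mult}, 'z) bialgebroid_scheme \<Rightarrow>
   ('l \<Rightarrow> 'l \<Rightarrow> 'n::{ring,monoid_mult}) \<Rightarrow> ('l \<Rightarrow> 'l \<Rightarrow> 'n) \<Rightarrow> 'l \<Rightarrow> 'l \<Rightarrow> 'n"
  where "conv2 H f g X Y =
    sweedler (comult H X) (\<lambda>X1 X2. sweedler (comult H Y) (\<lambda>Y1 Y2. f X2 Y2 * g X1 Y1))"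

definition conv2_invertible ::
  "('k::field, 'b::{ring,monoid_mult}, 'l::{ring,monoid_mult}, 'z) bialgebroid_scheme \<Rightarrow>
   ('k \<Rightarrow> 'n::{ring,monoid_mult} \<Rightarrow> 'n) \<Rightarrow> ('b \<Rightarrow> 'n) \<Rightarrow> ('l \<Rightarrow> 'l \<Rightarrow> 'n) \<Rightarrow> bool"
  where "conv2_invertible H sN bar f \<longleftrightarrow>
    (\<exists>g. cochain2 H sN bar g \<and>
      (\<forall>X Y. conv2 H f g X Y = bar (counit H (X * Y))) \<and>
      (\<forall>X Y. conv2 H g f X Y = bar (counit H (X * Y))))"

definition two_cocycle ::
  "('k::field, 'b::{ring,monoid_mult}, 'l::{ring,monoid_mult}, 'z) bialgebroid_scheme \<Rightarrow>
   ('k \<Rightarrow> 'n::{ring,monoid_mult} \<Rightarrow> 'n) \<Rightarrow> ('b \<Rightarrow> 'n) \<Rightarrow>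
   ('l \<Rightarrow> 'l \<Rightarrow> 'n) \<Rightarrow> ('l \<Rightarrow> 'n \<Rightarrow> 'n) \<Rightarrow> bool"
  where "two_cocycle H sN bar \<sigma> act \<longleftrightarrow>
    measuring H sN bar act \<and> cochain2 H sN bar \<sigma> \<and> conv2_invertible H sN bar \<sigma> \<and>
    (\<forall>X. \<sigma> X 1 = bar (counit H X)) \<and>
    (\<forall>X. \<sigma> 1 X = bar (counit H X)) \<and>
    (\<forall>X Y b. \<sigma> X (Y * tgt H b) = \<sigma> X (Y * src H b)) \<and>
    (\<forall>X Y Z.
      sweedler (comult H X) (\<lambda>X1 X2. sweedler (comult H Y) (\<lambda>Y1 Y2.
        sweedler (comult H Z) (\<lambda>Z1 Z2. \<sigma> X2 (Y2 * Z2) * act X1 (\<sigma> Y1 Z1)))) =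
      sweedler (comult H X) (\<lambda>X1 X2. sweedler (comult H Y) (\<lambda>Y1 Y2.
        \<sigma> (X2 * Y2) Z * \<sigma> X1 Y1)))"

text \<open>
  The condition \<open>act 1 n = n\<close> is part of the usual definition and is what makes
  \<^verbatim>\<open>1 (x) 1\<close> a right unit of the crossed product; it does not follow from the others
  (for L = B = k, any idempotent algebra endomorphism of N satisfies those).
\<close>

definition twisted_module_algebra ::
  "('k::field, 'b::{ring,monoid_mult}, 'l::{ring,monoid_mult}, 'z) bialgebroid_scheme \<Rightarrow>
   ('k \<Rightarrow> 'n::{ring,monoid_mult} \<Rightarrow> 'n) \<Rightarrow> ('b \<Rightarrow> 'n) \<Rightarrow>
   ('l \<Rightarrow> 'l \<Rightarrow> 'n) \<Rightarrow> ('l \<Rightarrow> 'n \<Rightarrow> 'n) \<Rightarrow> bool"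
  where "twisted_module_algebra H sN bar \<sigma> act \<longleftrightarrow>
    two_cocycle H sN bar \<sigma> act \<and>
    (\<forall>n. act 1 n = n) \<and>
    (\<forall>X Y n.
      sweedler (comult H X) (\<lambda>X1 X2. sweedler (comult H Y) (\<lambda>Y1 Y2.
        \<sigma> X2 Y2 * act X1 (act Y1 n))) =
      sweedler (comult H X) (\<lambda>X1 X2. sweedler (comult H Y) (\<lambda>Y1 Y2.
        act (X2 * Y2) n * \<sigma> X1 Y1)))"

section \<open>Crossed products\<close>

text \<open>
  The B-ring structure \<^verbatim>\<open>b |-> b (x) 1\<close> is the one inducing the bimodule structure
  \<^verbatim>\<open>b (X (x) n) b' = b X b' (x) n\<close>.
\<close>

definition crossed_ring ::
  "('k::field, 'b::{ring,monoid_mult}, 'l::{ring,monoid_mult}, 'z) bialgebroid_scheme \<Rightarrow>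
   ('b \<Rightarrow> 'n::{ring,monoid_mult}) \<Rightarrow> ('l \<Rightarrow> 'l \<Rightarrow> 'n) \<Rightarrow> ('l \<Rightarrow> 'n \<Rightarrow> 'n) \<Rightarrow>
   ('l \<times> 'n) multiset set ring"
  where "crossed_ring H bar \<sigma> act = (tensor_bar H bar)
    \<lparr>mult := (\<lambda>U V. bcls H bar (sweedler U (\<lambda>X n. sweedler V (\<lambda>Y m.
        sweedler (plus_minus H X) (\<lambda>Xp Xm. sweedler (plus_minus H Y) (\<lambda>Yp Ym.
          sweedler (comult H Ym) (\<lambda>Ym1 Ym2.
            {#(Xp * Yp, \<sigma> Ym2 Xm * act Ym1 n * m)#}))))))),
     one := bcls H bar {#(1, 1)#}\<rparr>"

definition crossed_product ::
  "('k::field, 'b::{ring,monoid_mult}, 'l::{ring,monoid_mult}, 'z) bialgebroid_scheme \<Rightarrow>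
   ('b \<Rightarrow> 'n::{ring,monoid_mult}) \<Rightarrow> ('l \<Rightarrow> 'l \<Rightarrow> 'n) \<Rightarrow> ('l \<Rightarrow> 'n \<Rightarrow> 'n) \<Rightarrow>
   ('b, 'l, ('l \<times> 'n) multiset set) comodule_algebra"
  where "crossed_product H bar \<sigma> act =
    (let P = crossed_ring H bar \<sigma> act; \<eta> = (\<lambda>b. bcls H bar {#(src H b, 1)#})
     in ring.extend P
       \<lparr>unit_map = \<eta>,
        coaction = (\<lambda>U. dcls H P (\<lambda>b p. \<eta> b \<otimes>\<^bsub>P\<^esub> p)
          (sweedler U (\<lambda>X n. sweedler (comult H X) (\<lambda>X1 X2.
             {#(X1, bcls H bar {#(X2, n)#})#}))))\<rparr>)"

text \<open>
  Isomorphisms of crossed products as comodule algebras are taken under N, that is, they commute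
  with the inclusions \<^verbatim>\<open>n |-> 1 (x) n\<close>.  Without this a nontrivial automorphism of N
  may be involved: if B = k, L = k[Z/2], N = k^3 and the generator acts by exchanging two
  coordinates, different exchanges give isomorphic, but inequivalent, crossed products.
\<close>

definition isomorphic_crossed_products ::
  "('k::field, 'b::{ring,monoid_mult}, 'l::{ring,monoid_mult}, 'z) bialgebroid_scheme \<Rightarrow>
   ('b \<Rightarrow> 'n::{ring,monoid_mult}) \<Rightarrow>
   ('l \<Rightarrow> 'l \<Rightarrow> 'n) \<Rightarrow> ('l \<Rightarrow> 'n \<Rightarrow> 'n) \<Rightarrow> ('l \<Rightarrow> 'l \<Rightarrow> 'n) \<Rightarrow> ('l \<Rightarrow> 'n \<Rightarrow> 'n) \<Rightarrow> bool"
  where "isomorphic_crossed_products H bar \<sigma> act \<sigma>' act' \<longleftrightarrow>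
    (\<exists>\<phi> \<in> comodule_algebra_iso H (crossed_product H bar \<sigma> act) (crossed_product H bar \<sigma>' act').
      \<forall>n. \<phi> (bcls H bar {#(1, n)#}) = bcls H bar {#(1, n)#})"

section \<open>Equivalence of 2-cocycles\<close>

definition cochain1 ::
  "('k::field, 'b::{ring,monoid_mult}, 'l::{ring,monoid_mult}, 'z) bialgebroid_scheme \<Rightarrow>
   ('k \<Rightarrow> 'n::{ring,monoid_mult} \<Rightarrow> 'n) \<Rightarrow> ('b \<Rightarrow> 'n) \<Rightarrow> ('l \<Rightarrow> 'n) \<Rightarrow> bool"
  where "cochain1 H sN bar u \<longleftrightarrow>
    Vector_Spaces.linear (lscale H) sN u \<and>
    (\<forall>b b' X. u (src H b * tgt H b' * X) = bar b' * u X * bar b) \<and>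
    (\<forall>X b. u (X * src H b) = u (X * tgt H b))"

definition conv1 ::
  "('k::field, 'b::{ring,monoid_mult}, 'l::{ring,monoid_mult}, 'z) bialgebroid_scheme \<Rightarrow>
   ('l \<Rightarrow> 'n::{ring,monoid_mult}) \<Rightarrow> ('l \<Rightarrow> 'n) \<Rightarrow> 'l \<Rightarrow> 'n"
  where "conv1 H u v X = sweedler (comult H X) (\<lambda>X1 X2. u X2 * v X1)"

definition conv1_inverse ::
  "('k::field, 'b::{ring,monoid_mult}, 'l::{ring,monoid_mult}, 'z) bialgebroid_scheme \<Rightarrow>
   ('k \<Rightarrow> 'n::{ring,monoid_mult} \<Rightarrow> 'n) \<Rightarrow> ('b \<Rightarrow> 'n) \<Rightarrow> ('l \<Rightarrow> 'n) \<Rightarrow> ('l \<Rightarrow> 'n) \<Rightarrow> bool"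
  where "conv1_inverse H sN bar u v \<longleftrightarrow>
    cochain1 H sN bar v \<and>
    (\<forall>X. conv1 H u v X = bar (counit H X)) \<and> (\<forall>X. conv1 H v u X = bar (counit H X))"

definition C1 ::
  "('k::field, 'b::{ring,monoid_mult}, 'l::{ring,monoid_mult}, 'z) bialgebroid_scheme \<Rightarrow>
   ('k \<Rightarrow> 'n::{ring,monoid_mult} \<Rightarrow> 'n) \<Rightarrow> ('b \<Rightarrow> 'n) \<Rightarrow> ('l \<Rightarrow> 'n) set"
  where "C1 H sN bar = {u. cochain1 H sN bar u \<and> (\<exists>v. conv1_inverse H sN bar u v)}"

definition equivalent_cocycles ::
  "('k::field, 'b::{ring,monoid_mult}, 'l::{ring,monoid_mult}, 'z) bialgebroid_scheme \<Rightarrow>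
   ('k \<Rightarrow> 'n::{ring,monoid_mult} \<Rightarrow> 'n) \<Rightarrow> ('b \<Rightarrow> 'n) \<Rightarrow>
   ('l \<Rightarrow> 'l \<Rightarrow> 'n) \<Rightarrow> ('l \<Rightarrow> 'n \<Rightarrow> 'n) \<Rightarrow> ('l \<Rightarrow> 'l \<Rightarrow> 'n) \<Rightarrow> ('l \<Rightarrow> 'n \<Rightarrow> 'n) \<Rightarrow> bool"
  where "equivalent_cocycles H sN bar \<sigma> act \<sigma>' act' \<longleftrightarrow>
    (\<exists>u \<in> C1 H sN bar. \<exists>v. conv1_inverse H sN bar u v \<and>
      (\<forall>X n. act' X n = sweedler3 H X (\<lambda>X1 X2 X3. u X3 * act X2 n * v X1)) \<and>
      (\<forall>X Y. \<sigma>' X Y = sweedler4 H X (\<lambda>X1 X2 X3 X4. sweedler3 H Y (\<lambda>Y1 Y2 Y3.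
          u (X4 * Y3) * \<sigma> X3 Y2 * act X2 (v Y1) * v X1))))"

end

theory Submission
  imports Defs "HOL-Library.Function_Algebras"
begin

text \<open>
  Write \<^verbatim>\<open>X+ (x) X-\<close> for the inverse Galois map, and \<tau> for the convolution inverse of \<sigma>.
  The crossed product P is spanned by the elements \<^verbatim>\<open>j(X) n = X (x) n\<close>, and the Hopf structure enters its
  product.  The idea of the proof is that P has a second presentation in which it does not.  Put
  \<^verbatim>\<open>e(X) = X(1)+ (x) tau(X(1)-, X(2))\<close>.  Then e is colinear, P is freely spanned by the elements
  \<^verbatim>\<open>n e(X)\<close> (over the opposite of B), and
  \<^verbatim>\<open>e(X) n = (X(2) |> n) e(X(1))\<close>,  \<^verbatim>\<open>e(X) e(Y) = tau(X(2), Y(2)) e(X(1) Y(1))\<close>.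
  The coordinate functional of this presentation is
  \<^verbatim>\<open>theta(X (x) n) = sigma(X+(2), X-) (X+(1) |> n)\<close>: every p in P is \<^verbatim>\<open>theta(p(0)) e(p(-1))\<close>
  (\<open>tensor_expansion\<close>), \<^verbatim>\<open>theta(e(X))\<close> is the counit (\<open>\<theta>_unit\<close>), and
  \<open>product_sum_\<theta>\<close> evaluates \<theta> on products.

  A colinear map \<phi> under N from one crossed product to another is therefore the same as a cochain U with
  \<^verbatim>\<open>phi(e(X)) = U(X(2)) e'(X(1))\<close>, namely U is the composite of e, \<phi> and \<theta>'.  Comparing coordinates of
  \<^verbatim>\<open>phi(e(X) n)\<close> and of \<^verbatim>\<open>phi(e(X) e(Y))\<close> gives \<open>U_act\<close> and \<open>conv_U\<close>, which are the two
  equations of an equivalence of cocycles with v = U; and the cochain of the inverse of \<phi> is the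
  convolution inverse of U (\<open>inverse_cochains\<close>).  Starting from \<phi> on the elements j(X) alone would only
  yield the values \<^verbatim>\<open>u(X-)\<close> of the cochain u that is sought; this is why the elements e(X) are needed, as
  no antipode is available that could be inverted.

  Conversely an equivalence u defines \<^verbatim>\<open>X (x) n |-> X+ (x) u(X-) n\<close> (\<open>twist_map\<close>).  It is colinear because
  the coproduct of X passes to X+, its inverse is given by v, and it is multiplicative by one convolution
  identity, \<open>cocycle_exchange\<close>.

  Computations take place in sums over representing formal sums: a map that is balanced gives sums which
  do not depend on the representatives, and since all tensor products here are vector spaces, two tensors
  are equal as soon as all balanced maps to the field agree on them (\<open>teq_if_functionals_agree\<close>).  An
  identity of tensors thus becomes an identity of sums in a type class group.
\<close>

section \<open>Sums over formal sums\<close>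

definition msum :: "('a \<Rightarrow> 'c \<Rightarrow> 'd::comm_monoid_add) \<Rightarrow> ('a \<times> 'c) multiset \<Rightarrow> 'd"
  where "msum f S = (\<Sum>(x, y)\<in>#S. f x y)"

lemma sweedler_msum: "sweedler U f = msum f (rep U)"
  by (simp add: sweedler_def msum_def)

lemma msum_empty [simp]: "msum f {#} = 0"
  and msum_add_mset: "msum f (add_mset p S) = f (fst p) (snd p) + msum f S"
  and msum_single [simp]: "msum f {#(x, y)#} = f x y"
  and msum_plus [simp]: "msum f (S + T) = msum f S + msum f T"
  by (simp_all add: msum_def case_prod_beta)

lemma msum_msum: "msum g (msum h S) = msum (\<lambda>x y. msum g (h x y)) S"
  by (induction S) (simp_all add: msum_add_mset)

lemma msum_sweedler: "msum g (sweedler U h) = sweedler U (\<lambda>x y. msum g (h x y))"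
  by (simp add: sweedler_msum msum_msum)

lemma msum_additive:
  assumes "h 0 = 0" "\<And>a b. h (a + b) = h a + h b"
  shows "h (msum f S) = msum (\<lambda>x y. h (f x y)) S"
  by (induction S) (simp_all add: msum_add_mset assms)

lemma msum_swap:
  "msum (\<lambda>x y. msum (f x y) T) S = msum (\<lambda>u v. msum (\<lambda>x y. f x y u v) S) T"
  unfolding msum_def case_prod_beta by (rule sum_mset.swap)

lemma msum_cong: "(\<And>x y. (x, y) \<in># S \<Longrightarrow> f x y = g x y) \<Longrightarrow> msum f S = msum g S"
  unfolding msum_def by (rule arg_cong[where f = sum_mset], rule image_mset_cong) auto

lemma sweedler_swap:
  "sweedler U (\<lambda>x y. sweedler V (f x y)) = sweedler V (\<lambda>u v. sweedler U (\<lambda>x y. f x y u v))"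
  unfolding sweedler_msum by (rule msum_swap)

lemma msum_fun_plus: "msum (\<lambda>x y. f x y + g x y) S = msum f S + msum g S"
  by (induction S) (simp_all add: msum_add_mset ac_simps)

lemma sweedler_plus: "sweedler U (\<lambda>x y. f x y + g x y) = sweedler U f + sweedler U g"
  by (simp add: sweedler_msum msum_fun_plus)

lemma sweedler_additive:
  fixes f :: "'a \<Rightarrow> 'c \<Rightarrow> 'd::ab_group_add" and h :: "'d \<Rightarrow> 'e::ab_group_add"
  assumes "\<And>a b. h (a + b) = h a + h b"
  shows "h (sweedler U f) = sweedler U (\<lambda>x y. h (f x y))"
proof -
  have "h (0 + 0) = h 0 + h 0" by (rule assms)
  then show ?thesis by (simp add: sweedler_msum msum_additive[of h] assms)
qed

lemma sweedler_mult_left: "sweedler U (\<lambda>x y. c * f x y) = (c :: 'd::ring) * sweedler U f"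
  by (rule sweedler_additive[symmetric]) (rule distrib_left)

lemma sweedler_mult_right: "sweedler U (\<lambda>x y. f x y * c) = sweedler U f * (c :: 'd::ring)"
  by (rule sweedler_additive[symmetric, of "\<lambda>z. z * c"]) (rule distrib_right)

lemmas mult_sweedler = sweedler_mult_left[symmetric] sweedler_mult_right[symmetric]

lemmas ring_rules = distrib_left distrib_right mult.assoc

section \<open>Balanced maps separate tensors\<close>

definition balanced_map ::
  "('a,'m) ring_scheme \<Rightarrow> ('a \<Rightarrow> 'r \<Rightarrow> 'a) \<Rightarrow> ('c,'n) ring_scheme \<Rightarrow> ('r \<Rightarrow> 'c \<Rightarrow> 'c) \<Rightarrow>
   ('a \<Rightarrow> 'c \<Rightarrow> 'd::ab_group_add) \<Rightarrow> bool"
  where "balanced_map M ra N la f \<longleftrightarrow>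
    (\<forall>x\<in>carrier M. \<forall>x'\<in>carrier M. \<forall>y\<in>carrier N. f (x \<oplus>\<^bsub>M\<^esub> x') y = f x y + f x' y) \<and>
    (\<forall>x\<in>carrier M. \<forall>y\<in>carrier N. \<forall>y'\<in>carrier N. f x (y \<oplus>\<^bsub>N\<^esub> y') = f x y + f x y') \<and>
    (\<forall>x\<in>carrier M. \<forall>y\<in>carrier N. \<forall>r. ra x r \<in> carrier M \<longrightarrow> la r y \<in> carrier N \<longrightarrow>
       f (ra x r) y = f x (la r y))"

text \<open>
  Only commutative monoids are required, so that the tensor product itself can be used as a factor of
  another one, without constructing negatives of classes first.
\<close>

locale tensor_product =
  fixes M :: "('a,'m) ring_scheme" and ra :: "'a \<Rightarrow> 'r \<Rightarrow> 'a"
    and N :: "('c,'n) ring_scheme" and la :: "'r \<Rightarrow> 'c \<Rightarrow> 'c"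
  assumes M: "abelian_monoid M" and N: "abelian_monoid N"
begin

sublocale M: abelian_monoid M by (rule M)
sublocale N: abelian_monoid N by (rule N)

abbreviation teq where "teq \<equiv> tensor_eq M ra N la"
abbreviation cls where "cls \<equiv> tensor_class M ra N la"
abbreviation "C \<equiv> carrier M \<times> carrier N"

lemma teq_carrier: "teq S T \<Longrightarrow> set_mset S \<subseteq> C \<and> set_mset T \<subseteq> C"
  by (induction rule: tensor_eq.induct) auto

lemma cls_eq_iff:
  assumes "set_mset S \<subseteq> C"
  shows "cls S = cls T \<longleftrightarrow> teq S T"
proof
  assume "cls S = cls T"
  then show "teq S T"
    using tensor_eq.refl[OF assms, of ra la] unfolding tensor_class_def
    by (metis mem_Collect_eq tensor_eq.sym)
next
  assume "teq S T"
  then show "cls S = cls T"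
    unfolding tensor_class_def by (blast intro: tensor_eq.sym tensor_eq.trans)
qed

lemma rep_cls:
  assumes "set_mset S \<subseteq> C"
  shows "teq S (rep (cls S))"
proof -
  have "S \<in> cls S" using tensor_eq.refl[OF assms, of ra la] by (simp add: tensor_class_def)
  then have "rep (cls S) \<in> cls S" unfolding rep_def by (rule someI)
  then show ?thesis by (simp add: tensor_class_def)
qed

lemma cls_rep:
  assumes "U \<in> carrier (tensor M ra N la)"
  shows "set_mset (rep U) \<subseteq> C" "cls (rep U) = U"
proof -
  obtain S where S: "set_mset S \<subseteq> C" "U = cls S" using assms by (auto simp: tensor_def)
  then have "teq S (rep U)" using rep_cls by simp
  then show "set_mset (rep U) \<subseteq> C" "cls (rep U) = U"
    using S cls_eq_iff[OF S(1), of "rep U"] teq_carrier by blast+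
qed

text \<open>
  Additivity alone forces a map with values in a group to vanish at zero, which takes care of the two
  generating relations for zero.
\<close>

lemma msum_teq:
  assumes "teq S T" "balanced_map M ra N la f"
  shows "msum f S = msum f T"
proof -
  have zl: "f \<zero>\<^bsub>M\<^esub> y = 0" if "y \<in> carrier N" for y
  proof -
    have "f (\<zero>\<^bsub>M\<^esub> \<oplus>\<^bsub>M\<^esub> \<zero>\<^bsub>M\<^esub>) y = f \<zero>\<^bsub>M\<^esub> y + f \<zero>\<^bsub>M\<^esub> y"
      using assms(2) that unfolding balanced_map_def by blast
    then show ?thesis by simp
  qed
  have zr: "f x \<zero>\<^bsub>N\<^esub> = 0" if "x \<in> carrier M" for x
  proof -
    have "f x (\<zero>\<^bsub>N\<^esub> \<oplus>\<^bsub>N\<^esub> \<zero>\<^bsub>N\<^esub>) = f x \<zero>\<^bsub>N\<^esub> + f x \<zero>\<^bsub>N\<^esub>"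
      using assms(2) that unfolding balanced_map_def by blast
    then show ?thesis by simp
  qed
  show ?thesis using assms(1)
    by (induction rule: tensor_eq.induct)
      (use assms(2) in \<open>auto simp: zl zr balanced_map_def msum_add_mset\<close>)
qed

lemma sweedler_cls:
  assumes "set_mset S \<subseteq> C" "balanced_map M ra N la f"
  shows "sweedler (cls S) f = msum f S"
  using msum_teq[OF rep_cls[OF assms(1)] assms(2)] by (simp add: sweedler_msum)

lemma cls_plus:
  assumes "set_mset S \<subseteq> C" "set_mset T \<subseteq> C"
  shows "cls S \<oplus>\<^bsub>tensor M ra N la\<^esub> cls T = cls (S + T)"
proof -
  have "teq (S + T) (rep (cls S) + rep (cls T))"
    by (intro tensor_eq.plus rep_cls assms)
  moreover have "set_mset (S + T) \<subseteq> C" using assms by auto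
  ultimately show ?thesis by (simp add: tensor_def cls_eq_iff[symmetric])
qed

lemma abelian_monoid_tensor: "abelian_monoid (tensor M ra N la)"
proof (rule abelian_monoidI)
  let ?T = "tensor M ra N la"
  have c: "cls S \<in> carrier ?T" if "set_mset S \<subseteq> C" for S
    using that by (simp add: tensor_def)
  have z: "\<zero>\<^bsub>?T\<^esub> = cls {#}" by (simp add: tensor_def)
  show "\<zero>\<^bsub>?T\<^esub> \<in> carrier ?T" by (simp add: z c)
  fix U V W assume "U \<in> carrier ?T" "V \<in> carrier ?T" "W \<in> carrier ?T"
  then obtain R S T where *: "U = cls R" "V = cls S" "W = cls T"
    "set_mset R \<subseteq> C" "set_mset S \<subseteq> C" "set_mset T \<subseteq> C"
    by (metis cls_rep)
  then show "U \<oplus>\<^bsub>?T\<^esub> V \<in> carrier ?T" "U \<oplus>\<^bsub>?T\<^esub> V \<oplus>\<^bsub>?T\<^esub> W = U \<oplus>\<^bsub>?T\<^esub> (V \<oplus>\<^bsub>?T\<^esub> W)"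
    "U \<oplus>\<^bsub>?T\<^esub> V = V \<oplus>\<^bsub>?T\<^esub> U" "\<zero>\<^bsub>?T\<^esub> \<oplus>\<^bsub>?T\<^esub> U = U"
    by (simp_all add: z cls_plus c ac_simps)
qed

end

lemma linear_functional_separation:
  fixes w :: "'p \<Rightarrow> 'k::field"
  defines "sc \<equiv> \<lambda>(c::'k) (f :: 'p \<Rightarrow> 'k) p. c * f p"
  assumes "w \<notin> module.span sc W"
  obtains l where "Vector_Spaces.linear sc (*) l" "\<And>v. v \<in> W \<Longrightarrow> l v = 0" "l w = 1"
proof -
  interpret V: vector_space sc
    by unfold_locales (auto simp: sc_def algebra_simps)
  interpret P: vector_space_pair sc "(*) :: 'k \<Rightarrow> 'k \<Rightarrow> 'k"
    by unfold_locales (auto simp: algebra_simps)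
  obtain B where B: "B \<subseteq> W" "V.independent B" "W \<subseteq> V.span B"
    using V.maximal_independent_subset by blast
  have "V.span B = V.span W"
    using B by (meson V.span_mono V.span_minimal V.subspace_span subset_antisym)
  then have wB: "w \<notin> V.span B" using assms by simp
  then have ind: "V.independent (insert w B)" using B(2) by (rule V.independent_insertI)
  obtain l where l: "Vector_Spaces.linear sc (*) l" "\<forall>x\<in>insert w B. l x = (if x = w then 1 else 0)"
    using P.linear_independent_extend[OF ind, of "\<lambda>x. if x = w then 1 else 0"] by blast
  have 0: "l x = 0" if "x \<in> B" for x using l(2) wB that V.span_base by fastforce
  have "l v = 0" if "v \<in> W" for v
  proof (rule P.linear_eq_0_on_span[OF l(1) 0])
    show "v \<in> V.span B" using that B(3) by auto
  qed
  then show ?thesis using that l by auto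
qed

text \<open>
  A tensor product over a field-containing ring is a vector space, so its elements are separated by
  functionals.  Hence identities of tensors can be verified after applying an arbitrary balanced
  map with values in the field, where the calculus of sums in a type class group is available.
\<close>

locale vector_tensor_product = tensor_product M ra N la
  for M :: "('a::ab_group_add,'m) ring_scheme" and ra :: "'a \<Rightarrow> 'r \<Rightarrow> 'a"
    and N :: "('c,'n) ring_scheme" and la +
  fixes s :: "'k::field \<Rightarrow> 'a \<Rightarrow> 'a"
  assumes s: "vector_space s"
    and carrierM [simp]: "carrier M = UNIV" and addM [simp]: "add M = (+)" and zeroM [simp]: "zero M = 0"
    and s_ra: "s c (ra x r) = ra (s c x) r"
begin

sublocale s: vector_space s by (rule s)

definition vec :: "('a \<times> 'c) multiset \<Rightarrow> 'a \<times> 'c \<Rightarrow> 'k"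
  where "vec S = (\<lambda>p. of_nat (count S p))"

definition scl :: "'k \<Rightarrow> ('a \<times> 'c) multiset \<Rightarrow> ('a \<times> 'c) multiset"
  where "scl c S = image_mset (\<lambda>(x, y). (s c x, y)) S"

text \<open>
  A finitely supported function w on pairs stands for the formal sum with coefficients in k.  Moving the
  coefficients into the first factor turns it into a multiset again; the set F only has to contain the
  support, since pairs with first entry zero are null.
\<close>

definition realise :: "('a \<times> 'c) set \<Rightarrow> ('a \<times> 'c \<Rightarrow> 'k) \<Rightarrow> ('a \<times> 'c) multiset"
  where "realise F w = (\<Sum>p\<in>F. {#(s (w p) (fst p), snd p)#})"

lemma teq_scl: "teq S T \<Longrightarrow> teq (scl c S) (scl c T)"
proof (induction rule: tensor_eq.induct)
  case (refl S)
  then show ?case unfolding scl_def by (intro tensor_eq.refl) auto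
next
  case (sym S T)
  from sym.IH show ?case by (rule tensor_eq.sym)
next
  case (trans S T U)
  from trans.IH show ?case by (rule tensor_eq.trans)
next
  case (plus S S' T T')
  from tensor_eq.plus[OF plus.IH] show ?case by (simp add: scl_def)
next
  case (zero_left y)
  then show ?case using tensor_eq.zero_left[of y N M ra la] by (simp add: scl_def)
next
  case (zero_right x)
  then show ?case using tensor_eq.zero_right[of _ M ra N la] by (simp add: scl_def)
next
  case (add_left x x' y)
  then show ?case using tensor_eq.add_left[of "s c x" M "s c x'" y N ra la]
    by (simp add: scl_def s.scale_right_distrib)
next
  case (add_right x y y')
  then show ?case using tensor_eq.add_right[of "s c x" M y N y' ra la]
    by (simp add: scl_def)
next
  case (balanced x y r)
  then show ?case using tensor_eq.balanced[of "s c x" M y N ra r la]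
    by (simp add: scl_def s_ra)
qed

lemma teq_sum:
  assumes "finite F" "\<And>p. p \<in> F \<Longrightarrow> teq (f p) (g p)"
  shows "teq (sum f F) (sum g F)"
  using assms by (induction F) (auto intro: tensor_eq.plus tensor_eq.refl)

lemma realise_superset:
  assumes "finite F" "G \<subseteq> F" "F \<subseteq> C" "\<And>p. p \<in> F - G \<Longrightarrow> w p = 0"
  shows "teq (realise F w) (realise G w)"
proof -
  have "teq (\<Sum>p\<in>F - G. {#(s (w p) (fst p), snd p)#}) (\<Sum>p\<in>F - G. {#})"
    using assms tensor_eq.zero_left[of _ N M ra la]
    by (intro teq_sum) auto
  moreover have "teq (realise G w) (realise G w)"
    unfolding realise_def using assms finite_subset[of G F] by (intro teq_sum tensor_eq.refl) auto
  ultimately have "teq ((\<Sum>p\<in>F - G. {#(s (w p) (fst p), snd p)#}) + realise G w) ({#} + realise G w)"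
    by (intro tensor_eq.plus) auto
  then show ?thesis using assms by (simp add: realise_def sum.subset_diff[of G F])
qed

lemma realise_plus:
  assumes "finite F" "F \<subseteq> C"
  shows "teq (realise F (\<lambda>p. v p + w p)) (realise F v + realise F w)"
  unfolding realise_def sum.distrib[symmetric]
proof (rule teq_sum[OF assms(1)])
  fix p assume "p \<in> F"
  then have "snd p \<in> carrier N" using assms by auto
  then show "teq {#(s (v p + w p) (fst p), snd p)#}
    ({#(s (v p) (fst p), snd p)#} + {#(s (w p) (fst p), snd p)#})"
    using tensor_eq.add_left[of "s (v p) (fst p)" M "s (w p) (fst p)" "snd p" N ra la]
    by (simp add: s.scale_left_distrib add_mset_commute)
qed

lemma realise_vec:
  assumes "set_mset S \<subseteq> C"
  shows "teq (realise (set_mset S) (vec S)) S"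
  using assms
proof (induction S)
  case empty
  then show ?case by (simp add: realise_def tensor_eq.refl)
next
  case (add p S)
  let ?F = "insert p (set_mset S)" and ?d = "\<lambda>q. if q = p then 1 else (0::'k)"
  have F: "finite ?F" "?F \<subseteq> C" using add.prems by auto
  have "vec (add_mset p S) = (\<lambda>q. ?d q + vec S q)" by (auto simp: vec_def)
  then have 1: "teq (realise ?F (vec (add_mset p S))) (realise ?F ?d + realise ?F (vec S))"
    using realise_plus[OF F, of ?d "vec S"] by simp
  have 2: "teq (realise ?F ?d) (realise {p} ?d)" "teq (realise ?F (vec S)) (realise (set_mset S) (vec S))"
    using F by (auto intro!: realise_superset simp: vec_def not_in_iff split: if_splits)
  have 3: "realise {p} ?d = {#p#}" by (simp add: realise_def)
  have "teq (realise (set_mset S) (vec S)) S" using add by simp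
  from tensor_eq.trans[OF 1 tensor_eq.plus[OF 2(1) tensor_eq.trans[OF 2(2) this]]]
  have "teq (realise ?F (vec (add_mset p S))) ({#p#} + S)" by (simp only: 3)
  then show ?case by simp
qed

text \<open>
  The functions that represent zero.  This is a subspace (\<open>null_subspace\<close>) which detects the congruence
  (\<open>vec_diff_null_iff\<close>), so its complement can be reached by a functional.
\<close>

definition null :: "('a \<times> 'c \<Rightarrow> 'k) set"
  where "null = {w. \<exists>F. finite F \<and> F \<subseteq> C \<and> (\<forall>p. p \<notin> F \<longrightarrow> w p = 0) \<and> teq (realise F w) {#}}"

lemma null_subspace: "module.subspace (\<lambda>(c::'k) f p. c * f p) null"
proof -
  interpret V: vector_space "\<lambda>(c::'k) (f :: 'a \<times> 'c \<Rightarrow> 'k) p. c * f p"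
    by unfold_locales (auto simp: algebra_simps)
  show ?thesis
  proof (rule V.subspaceI)
    show "0 \<in> null"
      unfolding null_def by (intro CollectI exI[of _ "{}"]) (auto simp: realise_def tensor_eq.refl)
  next
    fix v w assume "v \<in> null" "w \<in> null"
    then obtain F G where *: "finite F" "F \<subseteq> C" "\<forall>p. p \<notin> F \<longrightarrow> v p = 0" "teq (realise F v) {#}"
      "finite G" "G \<subseteq> C" "\<forall>p. p \<notin> G \<longrightarrow> w p = 0" "teq (realise G w) {#}"
      unfolding null_def by blast
    let ?H = "F \<union> G"
    have H: "finite ?H" "?H \<subseteq> C" using * by auto
    have "teq (realise ?H v) (realise F v)" "teq (realise ?H w) (realise G w)"
      using * by (auto intro!: realise_superset)
    then have "teq (realise ?H (\<lambda>p. v p + w p)) ({#} + {#})"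
      by (rule tensor_eq.trans[OF realise_plus[OF H] tensor_eq.plus[OF
        tensor_eq.trans[OF _ *(4)] tensor_eq.trans[OF _ *(8)]]])
    then show "v + w \<in> null"
      unfolding null_def using H * by (intro CollectI exI[of _ ?H]) (auto simp: plus_fun_def)
  next
    fix c :: 'k and w assume "w \<in> null"
    then obtain F where *: "finite F" "F \<subseteq> C" "\<forall>p. p \<notin> F \<longrightarrow> w p = 0" "teq (realise F w) {#}"
      unfolding null_def by blast
    have "scl c (realise F w) = realise F (\<lambda>p. c * w p)"
      unfolding realise_def scl_def using *(1) by (induction F) auto
    moreover have "scl c {#} = {#}" by (simp add: scl_def)
    ultimately have "teq (realise F (\<lambda>p. c * w p)) {#}" using teq_scl[OF *(4), of c] by simp
    then show "(\<lambda>p. c * w p) \<in> null"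
      unfolding null_def using * by (intro CollectI exI[of _ F]) auto
  qed
qed

text \<open>
  Multiplication by -1 supplies negatives, hence cancellation in the monoid of classes.
\<close>

lemma scl_minus:
  assumes "set_mset S \<subseteq> C"
  shows "teq (S + scl (- 1) S) {#}"
  using assms
proof (induction S)
  case empty
  then show ?case by (simp add: scl_def tensor_eq.refl)
next
  case (add p S)
  obtain x y where p: "p = (x, y)" by force
  with add have y: "y \<in> carrier N" by auto
  have "teq {#(x, y), (s (-1) x, y)#} {#(x + s (-1) x, y)#}"
    using tensor_eq.sym[OF tensor_eq.add_left[of x M "s (-1) x" y N ra la]] y by simp
  moreover have "teq {#(x + s (-1) x, y)#} {#}"
    using tensor_eq.zero_left[OF y, of M ra la] by simp
  ultimately have "teq ({#(x, y), (s (-1) x, y)#} + (S + scl (- 1) S)) ({#} + {#})"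
    using add by (intro tensor_eq.plus) (erule (1) tensor_eq.trans, simp)
  then show ?case by (simp add: p scl_def add_mset_commute)
qed

lemma vec_diff_null_iff:
  assumes S: "set_mset S \<subseteq> C" and T: "set_mset T \<subseteq> C"
  shows "vec S - vec T \<in> null \<longleftrightarrow> teq S T"
proof -
  let ?F = "set_mset S \<union> set_mset T" and ?w = "vec S - vec T"
  have F: "finite ?F" "?F \<subseteq> C" using assms by auto
  have "teq (realise ?F (\<lambda>p. ?w p + vec T p)) (realise ?F ?w + realise ?F (vec T))"
    by (rule realise_plus[OF F])
  moreover have "(\<lambda>p. ?w p + vec T p) = vec S" by auto
  ultimately have a: "teq (realise ?F (vec S)) (realise ?F ?w + realise ?F (vec T))" by simp
  have b: "teq (realise ?F (vec S)) (realise (set_mset S) (vec S))"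
    "teq (realise ?F (vec T)) (realise (set_mset T) (vec T))"
    using F by (auto intro!: realise_superset simp: vec_def not_in_iff)
  have rF: "teq (realise ?F v) (realise ?F v)" for v
    using realise_superset[of ?F ?F v] F by auto
  note b' = tensor_eq.trans[OF b(1) realise_vec[OF S]] tensor_eq.trans[OF b(2) realise_vec[OF T]]
  have 1: "teq S (realise ?F ?w + T)"
    by (rule tensor_eq.trans[OF tensor_eq.sym[OF b'(1)] tensor_eq.trans[OF a tensor_eq.plus[OF rF b'(2)]]])
  show ?thesis
  proof
    assume "?w \<in> null"
    then obtain G where G: "finite G" "G \<subseteq> C" "\<forall>p. p \<notin> G \<longrightarrow> ?w p = 0" "teq (realise G ?w) {#}"
      unfolding null_def by blast
    have "?w p = 0" if "p \<notin> ?F" for p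
      using that by (simp add: vec_def not_in_iff)
    then have "teq (realise (?F \<union> G) ?w) (realise ?F ?w)" "teq (realise (?F \<union> G) ?w) (realise G ?w)"
      using F G by (auto intro!: realise_superset simp del: fun_diff_def minus_apply)
    then have "teq (realise ?F ?w) {#}" using G(4) tensor_eq.trans tensor_eq.sym by metis
    then have "teq (realise ?F ?w + T) ({#} + T)"
      using T by (intro tensor_eq.plus tensor_eq.refl)
    then show "teq S T" using tensor_eq.trans[OF 1] by simp
  next
    assume "teq S T"
    from tensor_eq.trans[OF tensor_eq.sym[OF 1] this] have 2: "teq (realise ?F ?w + T) T" .
    have nT: "teq (scl (-1) T) (scl (-1) T)" by (rule teq_scl[OF tensor_eq.refl[OF T]])
    have "teq (realise ?F ?w + (T + scl (-1) T)) (T + scl (-1) T)"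
      using tensor_eq.plus[OF 2 nT] by (simp add: add.assoc)
    from tensor_eq.trans[OF this scl_minus[OF T]]
    have "teq (realise ?F ?w + (T + scl (-1) T)) {#}" .
    moreover have "teq (realise ?F ?w + (T + scl (-1) T)) (realise ?F ?w + {#})"
      by (intro tensor_eq.plus rF scl_minus T)
    ultimately have "teq (realise ?F ?w + {#}) {#}"
      using tensor_eq.trans[OF tensor_eq.sym] by blast
    then have "teq (realise ?F ?w) {#}" by simp
    then show "?w \<in> null"
      unfolding null_def using F
      by (intro CollectI exI[of _ ?F]) (auto simp: vec_def not_in_iff)
  qed
qed

text \<open>
  If S and T are not congruent, some functional vanishes on null functions but not on their difference;
  its values at the basis vectors form a balanced map.
\<close>

lemma teq_if_functionals_agree:
  assumes S: "set_mset S \<subseteq> C" and T: "set_mset T \<subseteq> C"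
    and eq: "\<And>f :: 'a \<Rightarrow> 'c \<Rightarrow> 'k. balanced_map M ra N la f \<Longrightarrow> msum f S = msum f T"
  shows "teq S T"
proof (rule ccontr)
  interpret V: vector_space "\<lambda>(c::'k) (f :: 'a \<times> 'c \<Rightarrow> 'k) p. c * f p"
    by unfold_locales (auto simp: algebra_simps)
  assume "\<not> teq S T"
  then have "vec S - vec T \<notin> V.span null"
    using vec_diff_null_iff[OF S T] null_subspace by (metis V.span_eq_iff)
  then obtain l where l: "Vector_Spaces.linear (\<lambda>(c::'k) f p. c * f p) (*) l"
    and l0: "\<And>v. v \<in> null \<Longrightarrow> l v = 0" and l1: "l (vec S - vec T) = 1"
    by (rule linear_functional_separation) blast
  interpret l: Vector_Spaces.linear "\<lambda>(c::'k) (f :: 'a \<times> 'c \<Rightarrow> 'k) p. c * f p" "(*)" l by (rule l)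
  define f where "f x y = l (vec {#(x, y)#})" for x y
  have vec_plus: "vec (A + B) = vec A + vec B" for A B by (auto simp: vec_def)
  have msum: "msum f A = l (vec A)" for A
  proof (induction A)
    case empty
    have "vec {#} = 0" by (auto simp: vec_def)
    then show ?case by (simp only: msum_empty l.zero)
  next
    case (add p A)
    then show ?case
      using vec_plus[of "{#p#}" A] l.add[of "vec {#p#}" "vec A"]
      by (simp add: msum_add_mset f_def del: plus_fun_apply)
  qed
  have teq: "msum f A = msum f B" if "teq A B" for A B
    using l0[of "vec A - vec B"] vec_diff_null_iff[of A B] teq_carrier[OF that] that
    by (simp add: msum l.diff)
  have "balanced_map M ra N la f"
    unfolding balanced_map_def
    using teq[OF tensor_eq.add_left] teq[OF tensor_eq.add_right] teq[OF tensor_eq.balanced]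
    by (simp add: msum_add_mset)
  from eq[OF this] show False using l1 by (simp add: msum l.diff)
qed

end

section \<open>Left bialgebroids\<close>

lemma type_ring_simps [simp]:
  "carrier type_ring = UNIV" "add type_ring = (+)" "zero type_ring = 0"
  by (simp_all add: type_ring_def)

lemma abelian_monoid_type_ring: "abelian_monoid (type_ring :: 'a::{ring,monoid_mult} ring)"
  by (rule abelian_monoidI) (auto simp: ac_simps)

context left_bialgebroid
begin

abbreviation "sr \<equiv> src H"
abbreviation "tg \<equiv> tgt H"
abbreviation "ep \<equiv> counit H"
abbreviation coproduct_sum (\<open>\<Delta>\<close>) where "\<Delta> X \<equiv> sweedler (comult H X)"

lemma sr_one [simp]: "sr 1 = 1" and tg_one [simp]: "tg 1 = 1"
  and sr_mult: "sr (b * c) = sr b * sr c" and tg_mult: "tg (b * c) = tg c * tg b"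
  using src_map tgt_map by (auto simp: algebra_map_def anti_algebra_map_def)

lemma sr_add: "sr (b + c) = sr b + sr c" and tg_add: "tg (b + c) = tg b + tg c"
  and ep_add: "ep (X + Y) = ep X + ep Y"
proof -
  interpret s: Vector_Spaces.linear "bscale H" "lscale H" sr
    using src_map by (simp add: algebra_map_def)
  interpret t: Vector_Spaces.linear "bscale H" "lscale H" tg
    using tgt_map by (simp add: anti_algebra_map_def)
  interpret e: Vector_Spaces.linear "lscale H" "bscale H" ep by (rule counit_linear)
  show "sr (b + c) = sr b + sr c" "tg (b + c) = tg b + tg c" "ep (X + Y) = ep X + ep Y"
    by (rule s.add t.add e.add)+
qed

lemma tg_sr: "tg c * sr b = sr b * tg c"
  by (rule src_tgt_commute[symmetric])

lemma tg_sr_left: "tg c * (sr b * X) = sr b * (tg c * X)"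
  by (metis mult.assoc tg_sr)

lemma ep_sr_left: "ep (sr b * X) = b * ep X"
  using counit_bimodule[of b 1 X] by simp

lemma ep_tg_left: "ep (tg b * X) = ep X * b"
  using counit_bimodule[of 1 b X] by simp

lemma ep_sr [simp]: "ep (sr b) = b" and ep_tg [simp]: "ep (tg b) = b"
  using ep_sr_left[of b 1] ep_tg_left[of b 1] by (simp_all add: counit_one)

lemma ep_sr_tg: "ep (X * sr b) = ep (X * tg b)"
  using counit_mult_src[of X "sr b"] counit_mult_tgt[of X "sr b"] by simp

definition balanced_diamond :: "('l \<Rightarrow> 'l \<Rightarrow> 'a::ab_group_add) \<Rightarrow> bool"
  where "balanced_diamond f \<longleftrightarrow> (\<forall>x x' y. f (x + x') y = f x y + f x' y) \<and>
    (\<forall>x y y'. f x (y + y') = f x y + f x y') \<and> (\<forall>b x y. f (tg b * x) y = f x (sr b * y))"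

lemma diamondD:
  assumes "balanced_diamond f"
  shows "f (x + x') y = f x y + f x' y" "f x (y + y') = f x y + f x y'" "f (tg b * x) y = f x (sr b * y)"
  using assms unfolding balanced_diamond_def by blast+

lemma diamondI:
  assumes "\<And>x x' y. f (x + x') y = f x y + f x' y" "\<And>x y y'. f x (y + y') = f x y + f x y'"
    "\<And>b x y. f (tg b * x) y = f x (sr b * y)"
  shows "balanced_diamond f"
  using assms unfolding balanced_diamond_def by blast

definition balanced_bar :: "('b \<Rightarrow> 'n::{ring,monoid_mult}) \<Rightarrow> ('l \<Rightarrow> 'n \<Rightarrow> 'a::ab_group_add) \<Rightarrow> bool"
  where "balanced_bar bar f \<longleftrightarrow> (\<forall>x x' y. f (x + x') y = f x y + f x' y) \<and>
    (\<forall>x y y'. f x (y + y') = f x y + f x y') \<and> (\<forall>b x y. f (x * tg b) y = f x (bar b * y))"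

lemma barD:
  assumes "balanced_bar bar f"
  shows "f (x + x') y = f x y + f x' y" "f x (y + y') = f x y + f x y'" "f (x * tg b) y = f x (bar b * y)"
  using assms unfolding balanced_bar_def by blast+

lemma barI:
  assumes "\<And>x x' y. f (x + x') y = f x y + f x' y" "\<And>x y y'. f x (y + y') = f x y + f x y'"
    "\<And>b x y. f (x * tg b) y = f x (bar b * y)"
  shows "balanced_bar bar f"
  using assms unfolding balanced_bar_def by blast

lemma vector_space_lscale: "vector_space (lscale H)"
  using total_algebra by (simp add: k_algebra_def)

lemma lscale_left: "lscale H c (x * y) = lscale H c x * y"
  and lscale_right: "lscale H c (x * y) = x * lscale H c y"
  by (rule k_algebra.scale_mult_left[OF total_algebra] k_algebra.scale_mult_right[OF total_algebra])+

interpretation dt: vector_tensor_product type_ring "\<lambda>X b. tg b * X" type_ring "\<lambda>b X. sr b * X" "lscale H"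
  by (intro vector_tensor_product.intro tensor_product.intro vector_tensor_product_axioms.intro
      abelian_monoid_type_ring vector_space_lscale) (simp_all add: lscale_right)

interpretation bt: vector_tensor_product type_ring "\<lambda>X b. X * tg b" type_ring
    "\<lambda>b n. (bar b :: 'n::{ring,monoid_mult}) * n" "lscale H" for bar
  by (intro vector_tensor_product.intro tensor_product.intro vector_tensor_product_axioms.intro
      abelian_monoid_type_ring vector_space_lscale) (simp_all add: lscale_left)

lemma balanced_diamond_map:
  "balanced_map type_ring (\<lambda>X b. tg b * X) type_ring (\<lambda>b X. sr b * X) f \<longleftrightarrow> balanced_diamond f"
  unfolding balanced_map_def balanced_diamond_def type_ring_simps by auto

lemma balanced_bar_map:
  "balanced_map type_ring (\<lambda>X b. X * tg b) type_ring (\<lambda>b n. bar b * n) f \<longleftrightarrow> balanced_bar bar f"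
  unfolding balanced_map_def balanced_bar_def type_ring_simps by auto

lemma sweedler_LdL_class: "balanced_diamond f \<Longrightarrow> sweedler (LdL_class H S) f = msum f S"
  unfolding dcls_def by (rule dt.sweedler_cls) (simp_all add: balanced_diamond_map)

lemma LdL_class_eqI:
  assumes "\<And>f :: 'l \<Rightarrow> 'l \<Rightarrow> 'k. balanced_diamond f \<Longrightarrow> msum f S = msum f T"
  shows "LdL_class H S = LdL_class H T"
  unfolding dcls_def
  by (subst dt.cls_eq_iff, simp, rule dt.teq_if_functionals_agree)
    (simp_all add: balanced_diamond_map assms)

lemma sweedler_bcls: "balanced_bar bar f \<Longrightarrow> sweedler (bcls H bar S) f = msum f S"
  unfolding bcls_def by (rule bt.sweedler_cls) (simp_all add: balanced_bar_map)

lemma bcls_eqI: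
  assumes "\<And>f :: 'l \<Rightarrow> 'n::{ring,monoid_mult} \<Rightarrow> 'k. balanced_bar bar f \<Longrightarrow> msum f S = msum f T"
  shows "bcls H bar S = bcls H bar T"
  unfolding bcls_def
  by (subst bt.cls_eq_iff, simp, rule bt.teq_if_functionals_agree)
    (simp_all add: balanced_bar_map assms)

lemma bcls_rep: "U \<in> carrier (tensor_bar H bar) \<Longrightarrow> bcls H bar (rep U) = U"
  unfolding bcls_def tensor_bar_def by (rule bt.cls_rep)

lemma bcls_plus: "bcls H bar S \<oplus>\<^bsub>tensor_bar H bar\<^esub> bcls H bar T = bcls H bar (S + T)"
  unfolding bcls_def tensor_bar_def by (rule bt.cls_plus) simp_all

lemma bcls_carrier: "bcls H bar S \<in> carrier (tensor_bar H bar)"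
  by (simp add: bcls_def tensor_bar_def tensor_def)

lemma LdL_class_carrier: "LdL_class H S \<in> carrier (LdL H)"
  by (simp add: dcls_def diamond_def tensor_def)

lemma LdL_class_rep: "U \<in> carrier (LdL H) \<Longrightarrow> LdL_class H (rep U) = U"
  unfolding dcls_def diamond_def by (rule dt.cls_rep)

lemma LdL_class_plus: "LdL_class H S \<oplus>\<^bsub>LdL H\<^esub> LdL_class H T = LdL_class H (S + T)"
  unfolding dcls_def diamond_def by (rule dt.cls_plus) simp_all

lemma abelian_monoid_LdL: "abelian_monoid (LdL H)"
  unfolding diamond_def by (rule dt.abelian_monoid_tensor)

lemma abelian_monoid_tensor_bar: "abelian_monoid (tensor_bar H bar)"
  unfolding tensor_bar_def by (rule bt.abelian_monoid_tensor)

lemma comult_carrier: "comult H X \<in> carrier (LdL H)"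
  using comult_takeuchi[of X] by (simp add: takeuchi_def)

lemma coproduct_class:
  assumes "comult H X = LdL_class H S" "balanced_diamond f"
  shows "\<Delta> X f = msum f S"
  by (simp add: assms sweedler_LdL_class)

lemma coproduct_add:
  assumes "balanced_diamond f"
  shows "\<Delta> (X + Y) f = \<Delta> X f + \<Delta> Y f"
proof -
  have "comult H (X + Y) = LdL_class H (rep (comult H X) + rep (comult H Y))"
    by (simp add: comult_add LdL_class_plus[symmetric] LdL_class_rep comult_carrier)
  from coproduct_class[OF this assms] show ?thesis by (simp add: sweedler_msum)
qed

lemma coproduct_bimodule:
  "balanced_diamond f \<Longrightarrow> \<Delta> (sr b * tg c * X) f = \<Delta> X (\<lambda>x y. f (sr b * x) (tg c * y))"
  by (subst coproduct_class[OF comult_bimodule]) (simp_all add: msum_sweedler)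

lemma coproduct_sr_left: "balanced_diamond f \<Longrightarrow> \<Delta> (sr b * X) f = \<Delta> X (\<lambda>x y. f (sr b * x) y)"
  using coproduct_bimodule[of f b 1 X] by simp

lemma coproduct_tg_left: "balanced_diamond f \<Longrightarrow> \<Delta> (tg c * X) f = \<Delta> X (\<lambda>x y. f x (tg c * y))"
  using coproduct_bimodule[of f 1 c X] by simp

lemma coproduct_one: "balanced_diamond f \<Longrightarrow> \<Delta> 1 f = f 1 1"
  by (subst coproduct_class[OF comult_one]) simp_all

lemma coproduct_mult:
  "balanced_diamond f \<Longrightarrow> \<Delta> (X * Y) f = \<Delta> X (\<lambda>a b. \<Delta> Y (\<lambda>c d. f (a * c) (b * d)))"
  by (subst coproduct_class[OF comult_mult]) (simp_all add: msum_sweedler)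

text \<open>
  The coproduct takes its values in the Takeuchi product.  This is the only source of balancedness on the
  right of the two factors, and most of the proofs below that a sum is balanced in a further variable
  rest on it.
\<close>

lemma takeuchi:
  assumes "balanced_diamond f"
  shows "\<Delta> X (\<lambda>x y. f (x * tg a) y) = \<Delta> X (\<lambda>x y. f x (y * sr a))"
proof -
  have "LdL_class H (\<Delta> X (\<lambda>X p. {#(X * tg a, p)#})) = LdL_class H (\<Delta> X (\<lambda>X p. {#(X, p * sr a)#}))"
    using comult_takeuchi[of X] by (simp add: takeuchi_def)
  from arg_cong[OF this, of "\<lambda>U. sweedler U f"] show ?thesis
    by (simp add: sweedler_LdL_class[OF assms] msum_sweedler)
qed

text \<open>
  For fixed a and b the summand is not balanced in c and d; the sum over the coproduct of X is, by the
  Takeuchi condition.  Sums over two coproducts are therefore arranged with the one already known to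
  be balanced inside.
\<close>

lemma balanced_mult:
  assumes "balanced_diamond f"
  shows "balanced_diamond (\<lambda>c d. \<Delta> X (\<lambda>a b. f (a * c) (b * d)))"
proof (rule diamondI)
  fix \<beta> c d
  have "balanced_diamond (\<lambda>x y. f (x * c) (y * d))"
    by (rule diamondI) (simp_all add: distrib_right diamondD[OF assms] mult.assoc)
  from takeuchi[OF this] show "\<Delta> X (\<lambda>a b. f (a * (tg \<beta> * c)) (b * d)) = \<Delta> X (\<lambda>a b. f (a * c) (b * (sr \<beta> * d)))"
    by (simp add: mult.assoc)
qed (simp_all add: distrib_left diamondD[OF assms] sweedler_plus)

lemma coproduct_mult':
  "balanced_diamond f \<Longrightarrow> \<Delta> (X * Y) f = \<Delta> Y (\<lambda>c d. \<Delta> X (\<lambda>a b. f (a * c) (b * d)))"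
  by (subst coproduct_mult, assumption, rule sweedler_swap)

lemma coproduct_sr:
  assumes "balanced_diamond f"
  shows "\<Delta> (sr b) f = f (sr b) 1"
proof -
  have "balanced_diamond (\<lambda>x y. f (sr b * x) y)"
    by (rule diamondI) (simp_all add: diamondD[OF assms] distrib_left tg_sr_left[symmetric])
  from coproduct_one[OF this] show ?thesis using coproduct_sr_left[OF assms, of b 1] by simp
qed

lemma coproduct_tg:
  assumes "balanced_diamond f"
  shows "\<Delta> (tg b) f = f 1 (tg b)"
proof -
  have "balanced_diamond (\<lambda>x y. f x (tg b * y))"
    by (rule diamondI) (simp_all add: diamondD[OF assms] distrib_left tg_sr_left)
  from coproduct_one[OF this] show ?thesis using coproduct_tg_left[OF assms, of b 1] by simp
qed

lemma coproduct_sr_right: "balanced_diamond f \<Longrightarrow> \<Delta> (X * sr b) f = \<Delta> X (\<lambda>x y. f (x * sr b) y)"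
  by (simp add: coproduct_mult' coproduct_sr balanced_mult)

lemma coproduct_tg_right: "balanced_diamond f \<Longrightarrow> \<Delta> (X * tg b) f = \<Delta> X (\<lambda>x y. f x (y * tg b))"
  by (simp add: coproduct_mult' coproduct_tg balanced_mult)

definition balanced3 :: "('l \<Rightarrow> 'l \<Rightarrow> 'l \<Rightarrow> 'a::ab_group_add) \<Rightarrow> bool"
  where "balanced3 f \<longleftrightarrow> (\<forall>x x' y w. f (x + x') y w = f x y w + f x' y w) \<and>
    (\<forall>x y y' w. f x (y + y') w = f x y w + f x y' w) \<and>
    (\<forall>x y w w'. f x y (w + w') = f x y w + f x y w') \<and>
    (\<forall>b x y w. f (tg b * x) y w = f x (sr b * y) w) \<and>
    (\<forall>b x y w. f x (tg b * y) w = f x y (sr b * w))"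

lemma balanced3D:
  assumes "balanced3 f"
  shows "f (x + x') y w = f x y w + f x' y w" "f x (y + y') w = f x y w + f x y' w"
    "f x y (w + w') = f x y w + f x y w'" "f (tg b * x) y w = f x (sr b * y) w"
    "f x (tg b * y) w = f x y (sr b * w)"
  using assms unfolding balanced3_def by blast+

lemma balanced3I:
  assumes "\<And>x x' y w. f (x + x') y w = f x y w + f x' y w" "\<And>x y y' w. f x (y + y') w = f x y w + f x y' w"
    "\<And>x y w w'. f x y (w + w') = f x y w + f x y w'" "\<And>b x y w. f (tg b * x) y w = f x (sr b * y) w"
    "\<And>b x y w. f x (tg b * y) w = f x y (sr b * w)"
  shows "balanced3 f"
  using assms unfolding balanced3_def by blast

text \<open>
  The coassociativity axiom is an equation in the triple product of L with \<open>LdL H\<close>; a map f of three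
  variables induces a balanced map there by summing over a representative of the second factor.
\<close>

lemma coassociativity:
  fixes f :: "'l \<Rightarrow> 'l \<Rightarrow> 'l \<Rightarrow> 'a::ab_group_add"
  assumes "balanced3 f"
  shows "\<Delta> X (\<lambda>x z. \<Delta> z (\<lambda>y w. f x y w)) = \<Delta> X (\<lambda>z w. \<Delta> z (\<lambda>x y. f x y w))"
proof -
  define g where "g x U = sweedler U (f x)" for x U
  have fx: "balanced_diamond (f x)" for x by (rule diamondI) (simp_all add: balanced3D[OF assms])
  interpret T: tensor_product type_ring "\<lambda>X b. tg b * X" "LdL H" "LdL_left H"
    by (intro tensor_product.intro abelian_monoid_type_ring abelian_monoid_LdL)
  have g_class: "g x (LdL_class H S) = msum (f x) S" for x S
    by (simp add: g_def sweedler_LdL_class fx)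
  have "balanced_map type_ring (\<lambda>X b. tg b * X) (LdL H) (LdL_left H) g"
    unfolding balanced_map_def
  proof (intro conjI ballI allI impI)
    fix x U V assume "U \<in> carrier (LdL H)" "V \<in> carrier (LdL H)"
    then have "U \<oplus>\<^bsub>LdL H\<^esub> V = LdL_class H (rep U + rep V)"
      by (simp add: LdL_class_plus[symmetric] LdL_class_rep)
    then show "g x (U \<oplus>\<^bsub>LdL H\<^esub> V) = g x U + g x V" by (simp add: g_class) (simp add: g_def sweedler_msum)
  next
    fix x U b
    have "f (tg b * x) = (\<lambda>y w. f x (sr b * y) w)" by (intro ext) (rule balanced3D[OF assms])
    then show "g (tg b * x) U = g x (LdL_left H b U)"
      by (simp add: LdL_left_def g_class msum_sweedler) (simp add: g_def)
  next
    fix x x' U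
    have "f (x + x') = (\<lambda>y w. f x y w + f x' y w)" by (intro ext) (rule balanced3D[OF assms])
    then show "g (x \<oplus>\<^bsub>type_ring\<^esub> x') U = g x U + g x' U" by (simp add: g_def sweedler_plus)
  qed
  note g = this
  have sets: "set_mset (\<Delta> X (\<lambda>X1 X2. {#(X1, comult H X2)#})) \<subseteq> UNIV \<times> carrier (LdL H)"
    "set_mset (\<Delta> X (\<lambda>X1 X2. \<Delta> X1 (\<lambda>X11 X12. {#(X11, LdL_class H {#(X12, X2)#})#}))) \<subseteq> UNIV \<times> carrier (LdL H)"
    using comult_carrier LdL_class_carrier by (auto simp: sweedler_def)
  have "T.teq (\<Delta> X (\<lambda>X1 X2. {#(X1, comult H X2)#}))
      (\<Delta> X (\<lambda>X1 X2. \<Delta> X1 (\<lambda>X11 X12. {#(X11, LdL_class H {#(X12, X2)#})#})))"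
    by (subst T.cls_eq_iff[symmetric]) (use coassoc[of X] sets in \<open>simp_all add: dcls_def\<close>)
  from T.msum_teq[OF this g] have "msum g (\<Delta> X (\<lambda>X1 X2. {#(X1, comult H X2)#})) =
      msum g (\<Delta> X (\<lambda>X1 X2. \<Delta> X1 (\<lambda>X11 X12. {#(X11, LdL_class H {#(X12, X2)#})#})))"
    .
  then show ?thesis by (simp add: msum_sweedler g_class) (simp add: g_def)
qed

lemma counit_left_additive:
  assumes "\<And>x y. h (x + y) = h x + (h y :: 'a::ab_group_add)"
  shows "\<Delta> X (\<lambda>x y. h (sr (ep x) * y)) = h X"
  using sweedler_additive[of h "comult H X" "\<lambda>x y. sr (ep x) * y"] assms by (simp add: counit_left)

lemma counit_right_additive:
  assumes "\<And>x y. h (x + y) = h x + (h y :: 'a::ab_group_add)"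
  shows "\<Delta> X (\<lambda>x y. h (tg (ep y) * x)) = h X"
  using sweedler_additive[of h "comult H X" "\<lambda>x y. tg (ep y) * x"] assms by (simp add: counit_right)

lemma balanced_right_mult: "balanced_diamond f \<Longrightarrow> balanced_diamond (\<lambda>a b. f a (b * y))"
  by (rule diamondI) (simp_all add: diamondD[of f] distrib_right mult.assoc)

lemma balanced_galois:
  assumes "balanced_diamond f"
  shows "balanced_bar tg (\<lambda>x y. \<Delta> x (\<lambda>a b. f a (b * y)))"
  using balanced_right_mult[OF assms]
  by (intro barI) (simp_all add: coproduct_add coproduct_tg_right distrib_left diamondD[OF assms]
      sweedler_plus mult.assoc)

lemma galois_map_bcls:
  "galois_map H (bcls H tg S) = LdL_class H (msum (\<lambda>X Y. \<Delta> X (\<lambda>X1 X2. {#(X1, X2 * Y)#})) S)"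
  unfolding galois_map_def
  by (rule LdL_class_eqI) (simp add: msum_sweedler msum_msum sweedler_bcls balanced_galois)

end

section \<open>The inverse of the Galois map\<close>

locale hopf_algebroid = left_hopf_algebroid H
  for H :: "('k::field, 'b::{ring,monoid_mult}, 'l::{ring,monoid_mult}, 'z) bialgebroid_scheme"
begin

abbreviation translation_sum (\<open>\<Lambda>\<close>) where "\<Lambda> X \<equiv> sweedler (plus_minus H X)"

text \<open>
  Injectivity of the Galois map as a principle of proof: equality of two elements of its source may be
  tested on the sums of their images.
\<close>

lemma galois_injective:
  assumes "\<And>f :: 'l \<Rightarrow> 'l \<Rightarrow> 'k. balanced_diamond f \<Longrightarrow>
    msum (\<lambda>x y. \<Delta> x (\<lambda>a b. f a (b * y))) S = msum (\<lambda>x y. \<Delta> x (\<lambda>a b. f a (b * y))) T"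
    and "balanced_bar tg g"
  shows "msum g S = msum g T"
proof -
  have "galois_map H (bcls H tg S) = galois_map H (bcls H tg T)"
    unfolding galois_map_bcls by (rule LdL_class_eqI) (simp add: msum_msum msum_sweedler assms(1))
  then have "bcls H tg S = bcls H tg T"
    using galois_bijective bcls_carrier unfolding bij_betw_def by (metis inj_onD)
  then show ?thesis using sweedler_bcls[OF assms(2)] by metis
qed

lemma plus_minus_carrier: "plus_minus H X \<in> carrier (tensor_bar H tg)"
  and galois_plus_minus: "galois_map H (plus_minus H X) = LdL_class H {#(X, 1)#}"
proof -
  have "LdL_class H {#(X, 1)#} \<in> galois_map H ` carrier (tensor_bar H tg)"
    using galois_bijective LdL_class_carrier by (simp add: bij_betw_def)
  then show "plus_minus H X \<in> carrier (tensor_bar H tg)"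
    "galois_map H (plus_minus H X) = LdL_class H {#(X, 1)#}"
    unfolding plus_minus_def by (rule inv_into_into, rule f_inv_into_f)
qed

text \<open>
  The equation \<^verbatim>\<open>X+(1) (x) X+(2) X- = X (x) 1\<close>, which defines the translation map.
\<close>

lemma galois_translation:
  assumes "balanced_diamond f"
  shows "\<Lambda> X (\<lambda>p q. \<Delta> p (\<lambda>a b. f a (b * q))) = f X 1"
  using arg_cong[OF galois_plus_minus[of X], of "\<lambda>U. sweedler U f"]
  by (simp add: galois_map_def sweedler_LdL_class[OF assms] msum_sweedler)

text \<open>
  A formal sum that satisfies the defining equation represents \<^verbatim>\<open>X+ (x) X-\<close>.  The compatibility of the
  translation map with each of the four module structures and with products follows by exhibiting the
  formal sum.
\<close>

lemma translation_unique:
  assumes "\<And>f :: 'l \<Rightarrow> 'l \<Rightarrow> 'k. balanced_diamond f \<Longrightarrow> msum (\<lambda>x y. \<Delta> x (\<lambda>a b. f a (b * y))) S = f X 1"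
    and "balanced_bar tg g"
  shows "\<Lambda> X g = msum g S"
  unfolding sweedler_msum
  by (rule galois_injective[OF _ assms(2)])
    (simp add: assms(1), fold sweedler_msum, simp add: galois_translation)

lemma translation_add:
  assumes "balanced_bar tg g" shows "\<Lambda> (X + Y) g = \<Lambda> X g + \<Lambda> Y g"
proof -
  have "\<Lambda> (X + Y) g = msum g (rep (plus_minus H X) + rep (plus_minus H Y))"
    by (rule translation_unique[OF _ assms])
      (simp add: sweedler_msum[symmetric] galois_translation diamondD)
  then show ?thesis by (simp add: sweedler_msum)
qed

lemma translation_sr_left:
  assumes "balanced_bar tg g" shows "\<Lambda> (sr b * X) g = \<Lambda> X (\<lambda>p q. g (sr b * p) q)"
proof -
  have "\<Lambda> (sr b * X) g = msum g (\<Lambda> X (\<lambda>p q. {#(sr b * p, q)#}))"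
  proof (rule translation_unique[OF _ assms])
    fix f :: "'l \<Rightarrow> 'l \<Rightarrow> 'k" assume f: "balanced_diamond f"
    have "balanced_diamond (\<lambda>x y. f (sr b * x) y)"
      by (rule diamondI) (simp_all add: diamondD[OF f] distrib_left tg_sr_left[symmetric])
    from galois_translation[OF this]
    show "msum (\<lambda>x y. \<Delta> x (\<lambda>a b. f a (b * y))) (\<Lambda> X (\<lambda>p q. {#(sr b * p, q)#})) = f (sr b * X) 1"
      by (simp add: msum_sweedler coproduct_sr_left balanced_right_mult f)
  qed
  then show ?thesis by (simp add: msum_sweedler)
qed

lemma translation_tg_left:
  assumes "balanced_bar tg g" shows "\<Lambda> (tg b * X) g = \<Lambda> X (\<lambda>p q. g p (q * sr b))"
proof -
  have "\<Lambda> (tg b * X) g = msum g (\<Lambda> X (\<lambda>p q. {#(p, q * sr b)#}))"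
  proof (rule translation_unique[OF _ assms])
    fix f :: "'l \<Rightarrow> 'l \<Rightarrow> 'k" assume f: "balanced_diamond f"
    from galois_translation[OF balanced_right_mult[OF f, of "sr b"]]
    show "msum (\<lambda>x y. \<Delta> x (\<lambda>a b. f a (b * y))) (\<Lambda> X (\<lambda>p q. {#(p, q * sr b)#})) = f (tg b * X) 1"
      by (simp add: msum_sweedler mult.assoc diamondD(3)[OF f])
  qed
  then show ?thesis by (simp add: msum_sweedler)
qed

lemma translation_sr_right:
  assumes "balanced_bar tg g" shows "\<Lambda> (X * sr b) g = \<Lambda> X (\<lambda>p q. g (p * sr b) q)"
proof -
  have "\<Lambda> (X * sr b) g = msum g (\<Lambda> X (\<lambda>p q. {#(p * sr b, q)#}))"
  proof (rule translation_unique[OF _ assms])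
    fix f :: "'l \<Rightarrow> 'l \<Rightarrow> 'k" assume f: "balanced_diamond f"
    have "balanced_diamond (\<lambda>x y. f (x * sr b) y)"
      by (rule diamondI) (simp_all add: diamondD[OF f] distrib_right mult.assoc)
    from galois_translation[OF this]
    show "msum (\<lambda>x y. \<Delta> x (\<lambda>a b. f a (b * y))) (\<Lambda> X (\<lambda>p q. {#(p * sr b, q)#})) = f (X * sr b) 1"
      by (simp add: msum_sweedler coproduct_sr_right balanced_right_mult f)
  qed
  then show ?thesis by (simp add: msum_sweedler)
qed

lemma translation_tg_right:
  assumes "balanced_bar tg g" shows "\<Lambda> (X * tg b) g = \<Lambda> X (\<lambda>p q. g p (sr b * q))"
proof -
  have "\<Lambda> (X * tg b) g = msum g (\<Lambda> X (\<lambda>p q. {#(p, sr b * q)#}))"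
  proof (rule translation_unique[OF _ assms])
    fix f :: "'l \<Rightarrow> 'l \<Rightarrow> 'k" assume f: "balanced_diamond f"
    have "balanced_diamond (\<lambda>x y. f (x * tg b) y)"
      by (rule diamondI) (simp_all add: diamondD[OF f] distrib_right mult.assoc)
    from galois_translation[OF this] takeuchi[OF balanced_right_mult[OF f], of _ b]
    show "msum (\<lambda>x y. \<Delta> x (\<lambda>a b. f a (b * y))) (\<Lambda> X (\<lambda>p q. {#(p, sr b * q)#})) = f (X * tg b) 1"
      by (simp add: msum_sweedler mult.assoc)
  qed
  then show ?thesis by (simp add: msum_sweedler)
qed

text \<open>
  Both sides are mapped to \<^verbatim>\<open>X (x) tgt b\<close> by the Galois map.
\<close>

lemma translation_takeuchi:
  assumes "balanced_bar tg g"
  shows "\<Lambda> X (\<lambda>p q. g (tg b * p) q) = \<Lambda> X (\<lambda>p q. g p (q * tg b))"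
proof -
  have "msum g (\<Lambda> X (\<lambda>p q. {#(tg b * p, q)#})) = msum g (\<Lambda> X (\<lambda>p q. {#(p, q * tg b)#}))"
  proof (rule galois_injective[OF _ assms])
    fix f :: "'l \<Rightarrow> 'l \<Rightarrow> 'k" assume f: "balanced_diamond f"
    have 1: "balanced_diamond (\<lambda>x y. f x (tg b * y))"
      by (rule diamondI) (simp_all add: diamondD[OF f] distrib_left tg_sr_left)
    show "msum (\<lambda>x y. \<Delta> x (\<lambda>a b. f a (b * y))) (\<Lambda> X (\<lambda>p q. {#(tg b * p, q)#})) =
      msum (\<lambda>x y. \<Delta> x (\<lambda>a b. f a (b * y))) (\<Lambda> X (\<lambda>p q. {#(p, q * tg b)#}))"
      using galois_translation[OF balanced_right_mult[OF f, of "tg b"]] galois_translation[OF 1]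
      by (simp add: msum_sweedler coproduct_tg_left balanced_right_mult f mult.assoc)
  qed
  then show ?thesis by (simp add: msum_sweedler)
qed

text \<open>
  \<^verbatim>\<open>X(1)+ (x) X(1)- X(2) = X (x) 1\<close>: the translation map is a left inverse of the Galois map, too.
\<close>

lemma translation_coproduct:
  assumes g: "balanced_bar tg g"
  shows "\<Delta> X (\<lambda>x y. \<Lambda> x (\<lambda>p q. g p (q * y))) = g X 1"
proof -
  have "msum g (\<Delta> X (\<lambda>x y. \<Lambda> x (\<lambda>p q. {#(p, q * y)#}))) = msum g {#(X, 1)#}"
  proof (rule galois_injective[OF _ g])
    fix f :: "'l \<Rightarrow> 'l \<Rightarrow> 'k" assume f: "balanced_diamond f"
    show "msum (\<lambda>x y. \<Delta> x (\<lambda>a b. f a (b * y))) (\<Delta> X (\<lambda>x y. \<Lambda> x (\<lambda>p q. {#(p, q * y)#}))) =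
      msum (\<lambda>x y. \<Delta> x (\<lambda>a b. f a (b * y))) {#(X, 1)#}"
      using galois_translation[OF balanced_right_mult[OF f]]
      by (simp add: msum_sweedler mult.assoc)
  qed
  then show ?thesis by (simp add: msum_sweedler)
qed

lemma translation_one: "balanced_bar tg g \<Longrightarrow> \<Lambda> 1 g = g 1 1"
  using translation_unique[of "{#(1, 1)#}" 1 g] by (simp add: coproduct_one balanced_right_mult)

lemma translation_sr: "balanced_bar tg g \<Longrightarrow> \<Lambda> (sr b) g = g (sr b) 1"
  using translation_unique[of "{#(sr b, 1)#}" "sr b" g] by (simp add: coproduct_sr balanced_right_mult)

lemma translation_mult:
  assumes g: "balanced_bar tg g"
  shows "\<Lambda> (X * Y) g = \<Lambda> X (\<lambda>p q. \<Lambda> Y (\<lambda>r s. g (p * r) (s * q)))"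
proof -
  have "\<Lambda> (X * Y) g = msum g (\<Lambda> X (\<lambda>p q. \<Lambda> Y (\<lambda>r s. {#(p * r, s * q)#})))"
  proof (rule translation_unique[OF _ g])
    fix f :: "'l \<Rightarrow> 'l \<Rightarrow> 'k" assume f: "balanced_diamond f"
    have 1: "\<Lambda> Y (\<lambda>r s. \<Delta> (p * r) (\<lambda>a b. f a (b * (s * q)))) = \<Delta> p (\<lambda>x y. f (x * Y) (y * q))" for p q
    proof -
      have "balanced_diamond (\<lambda>c d. \<Delta> p (\<lambda>a b. f (a * c) (b * d * q)))"
        by (rule balanced_mult, rule balanced_right_mult, rule f)
      from galois_translation[OF this, of Y]
      show ?thesis
        by (simp add: coproduct_mult' balanced_right_mult f mult.assoc)
    qed
    have "balanced_diamond (\<lambda>x y. f (x * Y) y)"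
      by (rule diamondI) (simp_all add: diamondD[OF f] distrib_right mult.assoc)
    from galois_translation[OF this]
    show "msum (\<lambda>x y. \<Delta> x (\<lambda>a b. f a (b * y))) (\<Lambda> X (\<lambda>p q. \<Lambda> Y (\<lambda>r s. {#(p * r, s * q)#}))) = f (X * Y) 1"
      by (simp add: msum_sweedler 1)
  qed
  then show ?thesis by (simp add: msum_sweedler)
qed

lemma translation_counit:
  assumes h: "\<And>x y. h (x + y) = h x + (h y :: 'a::ab_group_add)"
  shows "\<Lambda> X (\<lambda>p q. h (p * tg (ep q))) = h X"
proof -
  have 1: "\<Delta> p (\<lambda>x y. h (tg (ep (y * q)) * x)) = h (p * tg (ep q))" for p q
  proof -
    have "balanced_diamond (\<lambda>x y. h (tg (ep y) * x))"
      by (rule diamondI) (simp_all add: h ep_add tg_add distrib_left distrib_right ep_sr_left tg_mult mult.assoc)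
    from coproduct_tg_right[OF this, of p "ep q"] counit_right_additive[of h, OF h]
    show ?thesis by (simp add: counit_mult_tgt)
  qed
  have "balanced_diamond (\<lambda>x y. h (tg (ep y) * x))"
    by (rule diamondI) (simp_all add: h ep_add tg_add distrib_left distrib_right ep_sr_left tg_mult mult.assoc)
  from galois_translation[OF this, of X] show ?thesis by (simp add: 1 counit_one)
qed

text \<open>
  \<^verbatim>\<open>X+(1) (x) X+(2) (x) X- = X(1) (x) X(2)+ (x) X(2)-\<close>.  The right-hand side extends to the balanced map
  \<^verbatim>\<open>Y (x) Z |-> Y(1) (x) Y(2)+ (x) Y(2)- Z\<close>, evaluated at \<^verbatim>\<open>X (x) 1 = X+(1) (x) X+(2) X-\<close>; there
  \<open>translation_coproduct\<close> cancels the inner pair.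
\<close>

lemma coproduct_plus_part:
  fixes f :: "'l \<Rightarrow> 'l \<Rightarrow> 'l \<Rightarrow> 'a::ab_group_add"
  assumes d: "\<And>q. balanced_diamond (\<lambda>a p. f a p q)" and b: "\<And>a. balanced_bar tg (f a)"
  shows "\<Lambda> X (\<lambda>p q. \<Delta> p (\<lambda>a c. f a c q)) = \<Delta> X (\<lambda>a c. \<Lambda> c (f a))"
proof -
  note f = diamondD[OF d] barD[OF b]
  have b': "balanced_bar tg (\<lambda>p q. f a p (q * z))" for a z
    by (rule barI) (simp_all add: f distrib_right mult.assoc)
  have d': "balanced_diamond (\<lambda>a c. \<Lambda> c (\<lambda>p q. f a p (q * z)))" for z
    by (rule diamondI) (simp_all add: f sweedler_plus translation_add b' translation_sr_left)
  have T: "balanced_diamond (\<lambda>y z. \<Delta> y (\<lambda>a c. \<Lambda> c (\<lambda>p q. f a p (q * z))))"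
    by (rule diamondI)
      (simp_all add: coproduct_add d' coproduct_tg_left translation_tg_left b' distrib_left f
        sweedler_plus mult.assoc)
  have c3: "balanced3 (\<lambda>a c y. \<Lambda> c (\<lambda>p' q'. f a p' (q' * (y * q))))" for q
    by (rule balanced3I) (simp_all add: f sweedler_plus translation_add b' translation_sr_left translation_tg_left
        ring_rules)
  have "\<Lambda> X (\<lambda>p q. \<Delta> p (\<lambda>x y. \<Delta> x (\<lambda>a c. \<Lambda> c (\<lambda>p' q'. f a p' (q' * (y * q)))))) = \<Delta> X (\<lambda>a c. \<Lambda> c (f a))"
    using galois_translation[OF T, of X] by simp
  moreover have "\<Delta> p (\<lambda>x y. \<Delta> x (\<lambda>a c. \<Lambda> c (\<lambda>p' q'. f a p' (q' * (y * q))))) = \<Delta> p (\<lambda>a z. f a z q)" for p q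
    using translation_coproduct[OF b'[of _ q]] coassociativity[OF c3, of p q]
    by (simp add: mult.assoc)
  ultimately show ?thesis by simp
qed

text \<open>
  \<^verbatim>\<open>X+ (x) X-(1) (x) X-(2) = X++ (x) X- (x) X+-\<close>.  Again the right-hand side extends to a balanced map,
  \<^verbatim>\<open>Y (x) Z |-> Y++ (x) Y- Z(1) (x) Y+- Z(2)\<close>, and at \<^verbatim>\<open>X+(1) (x) X+(2) X-\<close> two applications of
  \<open>translation_coproduct\<close> remove all factors but those of X- .
\<close>

lemma coproduct_minus_part:
  fixes f :: "'l \<Rightarrow> 'l \<Rightarrow> 'l \<Rightarrow> 'a::ab_group_add"
  assumes b: "\<And>z. balanced_bar tg (\<lambda>y w. f y z w)" and d: "\<And>y. balanced_diamond (f y)"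
  shows "\<Lambda> X (\<lambda>p q. \<Delta> q (f p)) = \<Lambda> X (\<lambda>p q. \<Lambda> p (\<lambda>p' q'. f p' q q'))"
proof -
  note f = diamondD[OF d] barD[OF b]
  have b1: "balanced_bar tg (\<lambda>p' q'. f p' z (q' * w))" for z w
    by (rule barI) (simp_all add: f distrib_right mult.assoc)
  have b2: "balanced_bar tg (\<lambda>p s. \<Lambda> p (\<lambda>p' q'. f p' (s * z) (q' * w)))" for z w
    by (rule barI) (simp_all add: f sweedler_plus translation_add b1 translation_tg_right
        distrib_right mult.assoc)
  define G where "G Y z w = \<Lambda> Y (\<lambda>p s. \<Lambda> p (\<lambda>p' q'. f p' (s * z) (q' * w)))" for Y z w
  have G_tg: "G Y (tg \<beta> * z) w = G Y z (sr \<beta> * w)" for Y z w \<beta>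
    using translation_takeuchi[OF b2[of z w], of Y \<beta>]
    by (simp add: G_def translation_tg_left b1 mult.assoc)
  have G_tgY: "G (tg \<beta> * Y) z w = G Y (sr \<beta> * z) w" for Y z w \<beta>
    by (simp add: G_def translation_tg_left b2 mult.assoc)
  have G_add: "G (Y + Y') z w = G Y z w + G Y' z w" "G Y (z + z') w = G Y z w + G Y z' w"
    "G Y z (w + w') = G Y z w + G Y z w'" for Y Y' z z' w w'
    by (simp_all add: G_def translation_add b2 distrib_left f sweedler_plus)
  have R: "balanced_diamond (\<lambda>Y Z. \<Delta> Z (G Y))"
  proof -
    have "balanced_diamond (G Y)" for Y by (rule diamondI) (simp_all add: G_add G_tg)
    moreover from this have "\<Delta> (sr \<beta> * Z) (G Y) = \<Delta> Z (G (tg \<beta> * Y))" for \<beta> Z Y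
      by (simp add: coproduct_sr_left G_tgY[symmetric])
    moreover have "\<Delta> Z (G (Y + Y')) = \<Delta> Z (G Y) + \<Delta> Z (G Y')" for Z Y Y'
      unfolding sweedler_plus[symmetric] G_add ..
    ultimately show ?thesis by (intro diamondI) (simp_all add: coproduct_add)
  qed
  have dG: "balanced_diamond (G Y)" for Y by (rule diamondI) (simp_all add: G_add G_tg)
  have "\<Delta> p (\<lambda>x y. \<Delta> (y * q) (G x)) = \<Delta> q (f p)" for p q
  proof -
    have "\<Delta> p (\<lambda>x y. \<Delta> (y * q) (G x)) =
        \<Delta> q (\<lambda>z w. \<Delta> p (\<lambda>x y. \<Delta> y (\<lambda>y1 y2. G x (y1 * z) (y2 * w))))"
      by (simp add: coproduct_mult' dG) (rule sweedler_swap)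
    also have "\<dots> = \<Delta> q (\<lambda>z w. \<Delta> p (\<lambda>x y2. \<Delta> x (\<lambda>x y1. G x (y1 * z) (y2 * w))))"
    proof -
      have "balanced3 (\<lambda>x y1 y2. G x (y1 * z) (y2 * w))" for z w
        by (rule balanced3I) (simp_all add: G_add G_tg G_tgY distrib_right mult.assoc)
      from coassociativity[OF this] show ?thesis by simp
    qed
    also have "\<dots> = \<Delta> q (\<lambda>z w. \<Delta> p (\<lambda>x y2. \<Lambda> x (\<lambda>p' q'. f p' z (q' * (y2 * w)))))"
      using translation_coproduct[OF b2] by (simp add: G_def mult.assoc)
    also have "\<dots> = \<Delta> q (f p)"
      using translation_coproduct[OF b1] by (simp add: mult.assoc)
    finally show ?thesis .
  qed
  moreover have "\<Delta> 1 (G X) = \<Lambda> X (\<lambda>p q. \<Lambda> p (\<lambda>p' q'. f p' q q'))"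
    by (simp add: coproduct_one dG) (simp add: G_def)
  ultimately show ?thesis using galois_translation[OF R, of X] by simp
qed

text \<open>
  \<^verbatim>\<open>X+(1) (x) X+(2) X-(2) (x) X-(1) = X+ (x) 1 (x) X-\<close>: adjacent factors of X+ and X- cancel, as
  for an antipode.
\<close>

lemma translation_collapse:
  fixes F :: "'l \<Rightarrow> 'l \<Rightarrow> 'l \<Rightarrow> 'a::ab_group_add"
  assumes d: "\<And>c. balanced_diamond (\<lambda>a w. F a w c)"
    and add: "\<And>a w c c'. F a w (c + c') = F a w c + F a w c'"
    and tg: "\<And>\<beta> a w c. F (a * tg \<beta>) w c = F a w (tg \<beta> * c)"
  shows "\<Lambda> X (\<lambda>p q. \<Delta> p (\<lambda>a b. \<Delta> q (\<lambda>c d. F a (b * d) c))) = \<Lambda> X (\<lambda>p q. F p 1 q)"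
proof -
  note f = diamondD[OF d] add tg
  have 1: "balanced_diamond (\<lambda>a b. F a (b * d) c)" for c d
    by (rule balanced_right_mult[OF d])
  have b: "balanced_bar tg (\<lambda>p d. \<Delta> p (\<lambda>a b. F a (b * d) c))" for c
    by (rule barI) (simp_all add: coproduct_add 1 distrib_left f sweedler_plus coproduct_tg_right mult.assoc)
  have "\<Lambda> X (\<lambda>p q. \<Delta> p (\<lambda>a b. \<Delta> q (\<lambda>c d. F a (b * d) c))) = \<Lambda> X (\<lambda>p q. \<Delta> q (\<lambda>c d. \<Delta> p (\<lambda>a b. F a (b * d) c)))"
    by (intro arg_cong[where f = "\<Lambda> X"] ext sweedler_swap)
  also have "\<dots> = \<Lambda> X (\<lambda>p q. \<Lambda> p (\<lambda>p' q'. \<Delta> p' (\<lambda>a b. F a (b * q') q)))"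
  proof (rule coproduct_minus_part[OF b])
    fix p
    show "balanced_diamond (\<lambda>c d. \<Delta> p (\<lambda>a b. F a (b * d) c))"
    proof (rule diamondI)
      fix \<beta> c d
      show "\<Delta> p (\<lambda>a b. F a (b * d) (tg \<beta> * c)) = \<Delta> p (\<lambda>a b. F a (b * (sr \<beta> * d)) c)"
        using takeuchi[OF 1[of d c], of p \<beta>] by (simp add: tg mult.assoc)
    qed (simp_all add: f distrib_left sweedler_plus)
  qed
  also have "\<dots> = \<Lambda> X (\<lambda>p q. F p 1 q)"
    by (simp add: galois_translation[OF d])
  finally show ?thesis .
qed

end

section \<open>Convolution of cochains\<close>

lemma linear_add: "Vector_Spaces.linear s1 s2 f \<Longrightarrow> f (x + y) = f x + f y"
proof -
  assume "Vector_Spaces.linear s1 s2 f"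
  then interpret f: Vector_Spaces.linear s1 s2 f .
  show ?thesis by (rule f.add)
qed

locale bar_hopf_algebroid = hopf_algebroid H
  for H :: "('k::field, 'b::{ring,monoid_mult}, 'l::{ring,monoid_mult}, 'z) bialgebroid_scheme" +
  fixes sN :: "'k \<Rightarrow> 'n::{ring,monoid_mult} \<Rightarrow> 'n" and bar :: "'b \<Rightarrow> 'n"
  assumes bar_ring: "bar_ring H sN bar"
begin

lemma bar_one [simp]: "bar 1 = 1" and bar_mult: "bar (b * c) = bar c * bar b"
  using bar_ring by (auto simp: bar_ring_def anti_algebra_map_def)

lemma bar_add: "bar (b + c) = bar b + bar c"
proof -
  interpret b: Vector_Spaces.linear "bscale H" sN bar
    using bar_ring by (simp add: bar_ring_def anti_algebra_map_def)
  show ?thesis by (rule b.add)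
qed

definition left_linear :: "('l \<Rightarrow> 'n) \<Rightarrow> bool"
  where "left_linear f \<longleftrightarrow> (\<forall>x y. f (x + y) = f x + f y) \<and>
    (\<forall>b x. f (sr b * x) = f x * bar b) \<and> (\<forall>b x. f (tg b * x) = bar b * f x)"

lemma left_linearD:
  assumes "left_linear f"
  shows "f (x + y) = f x + f y" "f (sr b * x) = f x * bar b" "f (tg b * x) = bar b * f x"
  using assms unfolding left_linear_def by blast+

lemma left_linearI:
  assumes "\<And>x y. f (x + y) = f x + f y" "\<And>b x. f (sr b * x) = f x * bar b"
    "\<And>b x. f (tg b * x) = bar b * f x"
  shows "left_linear f"
  using assms unfolding left_linear_def by blast

text \<open>
  B-bilinear cochains on the tensor square of L over B and its opposite.  Linearity over k
  follows from linearity over B.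
\<close>

definition balanced_cochain :: "('l \<Rightarrow> 'l \<Rightarrow> 'n) \<Rightarrow> bool"
  where "balanced_cochain f \<longleftrightarrow> (\<forall>Y. left_linear (\<lambda>X. f X Y)) \<and> (\<forall>X Y Y'. f X (Y + Y') = f X Y + f X Y') \<and>
    (\<forall>b X Y. f (X * sr b) Y = f X (sr b * Y)) \<and> (\<forall>b X Y. f (X * tg b) Y = f X (tg b * Y))"

lemma cochainD:
  assumes "balanced_cochain f"
  shows "f (X + X') Y = f X Y + f X' Y" "f X (Y + Y') = f X Y + f X Y'"
    "f (X * sr b) Y = f X (sr b * Y)" "f (X * tg b) Y = f X (tg b * Y)"
    "f (sr b * X) Y = f X Y * bar b" "f (tg b * X) Y = bar b * f X Y"
  using assms left_linearD[of "\<lambda>X. f X Y"] unfolding balanced_cochain_def by blast+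

lemma cochainI:
  assumes "\<And>X X' Y. f (X + X') Y = f X Y + f X' Y" "\<And>X Y Y'. f X (Y + Y') = f X Y + f X Y'"
    "\<And>b X Y. f (X * sr b) Y = f X (sr b * Y)" "\<And>b X Y. f (X * tg b) Y = f X (tg b * Y)"
    "\<And>b X Y. f (sr b * X) Y = f X Y * bar b" "\<And>b X Y. f (tg b * X) Y = bar b * f X Y"
  shows "balanced_cochain f"
  using assms unfolding balanced_cochain_def left_linear_def by blast

lemma balanced_product: "left_linear f \<Longrightarrow> left_linear g \<Longrightarrow> balanced_diamond (\<lambda>x y. f y * g x)"
  by (rule diamondI) (simp_all add: left_linearD[of f] left_linearD[of g] ring_rules)

lemma left_linear_first: "balanced_cochain f \<Longrightarrow> left_linear (\<lambda>X. f X Y)"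
  by (simp add: balanced_cochain_def)

lemma left_linear_counit: "left_linear (\<lambda>X. bar (ep X))"
  by (rule left_linearI) (simp_all add: ep_add bar_add ep_sr_left ep_tg_left bar_mult)

lemma counit_conv_left:
  assumes "left_linear f" shows "\<Delta> X (\<lambda>x y. bar (ep y) * f x) = f X"
  using counit_right_additive[of f X] by (simp add: left_linearD[OF assms])

lemma counit_conv_right:
  assumes "left_linear f" shows "\<Delta> X (\<lambda>x y. f y * bar (ep x)) = f X"
  using counit_left_additive[of f X] by (simp add: left_linearD[OF assms])

lemma counit_conv_left_tg:
  assumes "left_linear f" shows "\<Delta> X (\<lambda>x y. bar (ep (y * sr c)) * f x) = f (X * tg c)"
proof -
  have b: "balanced_diamond (\<lambda>x y. bar (ep y) * f x)"
    by (rule balanced_product[OF left_linear_counit assms])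
  show ?thesis
    using counit_conv_left[OF assms, of "X * tg c"] by (simp add: coproduct_tg_right b ep_sr_tg)
qed

lemma counit_conv_right_sr:
  assumes "left_linear f" shows "\<Delta> X (\<lambda>x y. f y * bar (ep (x * sr c))) = f (X * sr c)"
proof -
  have b: "balanced_diamond (\<lambda>x y. f y * bar (ep x))"
    by (rule balanced_product[OF assms left_linear_counit])
  show ?thesis
    using counit_conv_right[OF assms, of "X * sr c"] by (simp add: coproduct_sr_right b)
qed

abbreviation conv (infixr \<open>\<star>\<close> 70) where "f \<star> g \<equiv> conv2 H f g"

lemma conv_swap: "(f \<star> g) X Y = \<Delta> Y (\<lambda>y1 y2. \<Delta> X (\<lambda>x1 x2. f x2 y2 * g x1 y1))"
  unfolding conv2_def by (rule sweedler_swap)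

lemma conv_balanced_left:
  assumes "balanced_cochain f" "balanced_cochain g"
  shows "balanced_diamond (\<lambda>x1 x2. f x2 y2 * g x1 y1)"
  by (intro balanced_product left_linear_first assms)

text \<open>
  Only the sum over the coproduct of X is balanced in y1 and y2; hence \<open>conv_swap\<close> precedes every
  computation with a convolution.
\<close>

lemma conv_balanced_right:
  assumes "balanced_cochain f" "balanced_cochain g"
  shows "balanced_diamond (\<lambda>y1 y2. \<Delta> X (\<lambda>x1 x2. f x2 y2 * g x1 y1))"
proof (rule diamondI)
  fix b y1 y2
  show "\<Delta> X (\<lambda>x1 x2. f x2 y2 * g x1 (tg b * y1)) = \<Delta> X (\<lambda>x1 x2. f x2 (sr b * y2) * g x1 y1)"
    using takeuchi[OF conv_balanced_left[OF assms, of y2 y1], of X b]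
    by (simp add: cochainD(3)[OF assms(1)] cochainD(4)[OF assms(2)])
qed (simp_all add: cochainD[OF assms(1)] cochainD[OF assms(2)] distrib_left distrib_right sweedler_plus)

lemma balanced_cochain_conv:
  assumes f: "balanced_cochain f" and g: "balanced_cochain g"
  shows "balanced_cochain (f \<star> g)"
  unfolding conv_swap
  by (rule cochainI)
    (simp_all add: coproduct_add coproduct_sr_right coproduct_tg_right coproduct_sr_left coproduct_tg_left
      conv_balanced_left[OF f g] conv_balanced_right[OF f g] sweedler_plus cochainD[OF f] cochainD[OF g]
      mult_sweedler mult.assoc)

lemma conv_assoc:
  assumes f: "balanced_cochain f" and g: "balanced_cochain g" and h: "balanced_cochain h"
  shows "(f \<star> g) \<star> h = f \<star> g \<star> h"
proof (intro ext)
  fix X Y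
  define T where "T y1 y2 y3 = \<Delta> X (\<lambda>x1 z. \<Delta> z (\<lambda>x2 x3. f x3 y3 * (g x2 y2 * h x1 y1)))" for y1 y2 y3
  note fgh = cochainD[OF f] cochainD[OF g] cochainD[OF h]
  have d2: "balanced_diamond (\<lambda>x2 x3. f x3 y3 * (g x2 y2 * c))" for y2 y3 c
    by (rule diamondI) (simp_all add: fgh ring_rules)
  have d1: "balanced_diamond (\<lambda>x1 z. \<Delta> z (\<lambda>x2 x3. f x3 y3 * (g x2 y2 * h x1 y1)))" for y1 y2 y3
    by (rule diamondI) (simp_all add: fgh distrib_left distrib_right sweedler_plus coproduct_add d2
        coproduct_sr_left mult.assoc)
  have b3: "balanced3 (\<lambda>x1 x2 x3. f x3 y3 * (g x2 y2 * h x1 y1))" for y1 y2 y3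
    by (rule balanced3I) (simp_all add: fgh ring_rules)
  have T: "balanced3 T"
  proof (rule balanced3I)
    fix b y1 y2 y3
    show "T (tg b * y1) y2 y3 = T y1 (sr b * y2) y3"
      using takeuchi[OF d1[of y3 y2 y1], of X b]
      by (simp add: T_def coproduct_sr_right d2 fgh)
    have "\<Delta> z (\<lambda>x2 x3. f x3 y3 * (g x2 (tg b * y2) * c)) = \<Delta> z (\<lambda>x2 x3. f x3 (sr b * y3) * (g x2 y2 * c))" for z c
      using takeuchi[OF d2[of y3 y2 c], of z b] by (simp add: fgh)
    then show "T y1 (tg b * y2) y3 = T y1 y2 (sr b * y3)" by (simp add: T_def)
  qed (simp_all add: T_def fgh distrib_left distrib_right sweedler_plus)
  have "((f \<star> g) \<star> h) X Y = \<Delta> Y (\<lambda>y1 w. \<Delta> X (\<lambda>x1 z. \<Delta> w (\<lambda>y2 y3. \<Delta> z (\<lambda>x2 x3. f x3 y3 * (g x2 y2 * h x1 y1)))))"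
    by (simp add: conv_swap sweedler_mult_right[symmetric] mult.assoc)
  also have "\<dots> = \<Delta> Y (\<lambda>y1 w. \<Delta> w (\<lambda>y2 y3. T y1 y2 y3))"
    unfolding T_def by (intro arg_cong[where f = "\<Delta> Y"] ext sweedler_swap)
  also have "\<dots> = \<Delta> Y (\<lambda>w y3. \<Delta> w (\<lambda>y1 y2. T y1 y2 y3))"
    by (rule coassociativity[OF T])
  also have "\<dots> = \<Delta> Y (\<lambda>w y3. \<Delta> w (\<lambda>y1 y2. \<Delta> X (\<lambda>z x3. \<Delta> z (\<lambda>x1 x2. f x3 y3 * (g x2 y2 * h x1 y1)))))"
    unfolding T_def by (simp add: coassociativity[OF b3])
  also have "\<dots> = \<Delta> Y (\<lambda>w y3. \<Delta> X (\<lambda>z x3. \<Delta> w (\<lambda>y1 y2. \<Delta> z (\<lambda>x1 x2. f x3 y3 * (g x2 y2 * h x1 y1)))))"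
    by (intro arg_cong[where f = "\<Delta> Y"] ext sweedler_swap)
  also have "\<dots> = (f \<star> g \<star> h) X Y"
    by (simp add: conv_swap sweedler_mult_left[symmetric])
  finally show "((f \<star> g) \<star> h) X Y = (f \<star> g \<star> h) X Y" .
qed

definition conv_unit :: "'l \<Rightarrow> 'l \<Rightarrow> 'n"
  where "conv_unit X Y = bar (ep (X * Y))"

lemma ep_mult_sr: "ep (X * sr (ep Y)) = ep (X * Y)"
  by (rule counit_mult_src)

lemma conv_unit_left:
  assumes f: "balanced_cochain f" shows "conv_unit \<star> f = f"
proof (intro ext)
  fix X Y
  have "(conv_unit \<star> f) X Y = \<Delta> Y (\<lambda>y1 y2. \<Delta> X (\<lambda>x1 x2. bar (ep (x2 * sr (ep y2))) * f x1 y1))"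
    by (simp add: conv_swap conv_unit_def ep_mult_sr)
  also have "\<dots> = \<Delta> Y (\<lambda>y1 y2. f (X * tg (ep y2)) y1)"
    by (simp add: counit_conv_left_tg[OF left_linear_first[OF f]])
  also have "\<dots> = f X Y"
    using counit_right_additive[of "f X" Y] by (simp add: cochainD[OF f])
  finally show "(conv_unit \<star> f) X Y = f X Y" .
qed

lemma conv_unit_right:
  assumes f: "balanced_cochain f" shows "f \<star> conv_unit = f"
proof (intro ext)
  fix X Y
  have "(f \<star> conv_unit) X Y = \<Delta> Y (\<lambda>y1 y2. \<Delta> X (\<lambda>x1 x2. f x2 y2 * bar (ep (x1 * sr (ep y1)))))"
    by (simp add: conv_swap conv_unit_def ep_mult_sr)
  also have "\<dots> = \<Delta> Y (\<lambda>y1 y2. f (X * sr (ep y1)) y2)"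
    by (simp add: counit_conv_right_sr[OF left_linear_first[OF f]])
  also have "\<dots> = f X Y"
    using counit_left_additive[of "f X" Y] by (simp add: cochainD[OF f])
  finally show "(f \<star> conv_unit) X Y = f X Y" .
qed

lemma conv_tg_right:
  assumes "balanced_cochain f" "balanced_cochain g"
  shows "(f \<star> g) X (Y * tg b) = ((\<lambda>X Y. f X (Y * tg b)) \<star> g) X Y"
  unfolding conv_swap by (simp add: coproduct_tg_right conv_balanced_right assms)

lemma conv_takeuchi:
  assumes "balanced_cochain f" "balanced_cochain g"
  shows "((\<lambda>X Y. f X (Y * sr b)) \<star> g) X Y = (f \<star> (\<lambda>X Y. g X (Y * tg b))) X Y"
  unfolding conv_swap using takeuchi[OF conv_balanced_right[OF assms]] by simp

lemma conv_sweedler_left: "((\<lambda>X Y. sweedler U (\<lambda>u v. A u v X Y)) \<star> g) X Y = sweedler U (\<lambda>u v. (A u v \<star> g) X Y)"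
proof -
  have "\<Delta> X (\<lambda>x1 x2. \<Delta> Y (\<lambda>y1 y2. sweedler U (\<lambda>u v. A u v x2 y2 * g x1 y1))) =
    \<Delta> X (\<lambda>x1 x2. sweedler U (\<lambda>u v. \<Delta> Y (\<lambda>y1 y2. A u v x2 y2 * g x1 y1)))"
    by (intro arg_cong[where f = "\<Delta> X"] ext sweedler_swap)
  also have "\<dots> = sweedler U (\<lambda>u v. \<Delta> X (\<lambda>x1 x2. \<Delta> Y (\<lambda>y1 y2. A u v x2 y2 * g x1 y1)))"
    by (rule sweedler_swap)
  finally show ?thesis by (simp add: conv2_def sweedler_mult_right[symmetric])
qed

lemma conv_sweedler_right: "(f \<star> (\<lambda>X Y. sweedler U (\<lambda>u v. A u v X Y))) X Y = sweedler U (\<lambda>u v. (f \<star> A u v) X Y)"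
proof -
  have "\<Delta> X (\<lambda>x1 x2. \<Delta> Y (\<lambda>y1 y2. sweedler U (\<lambda>u v. f x2 y2 * A u v x1 y1))) =
    \<Delta> X (\<lambda>x1 x2. sweedler U (\<lambda>u v. \<Delta> Y (\<lambda>y1 y2. f x2 y2 * A u v x1 y1)))"
    by (intro arg_cong[where f = "\<Delta> X"] ext sweedler_swap)
  also have "\<dots> = sweedler U (\<lambda>u v. \<Delta> X (\<lambda>x1 x2. \<Delta> Y (\<lambda>y1 y2. f x2 y2 * A u v x1 y1)))"
    by (rule sweedler_swap)
  finally show ?thesis by (simp add: conv2_def sweedler_mult_left[symmetric])
qed

lemma conv_plus_left: "(\<lambda>X Y. A X Y + A' X Y) \<star> g = (\<lambda>X Y. (A \<star> g) X Y + (A' \<star> g) X Y)"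
  by (simp add: fun_eq_iff conv2_def distrib_right sweedler_plus)

lemma conv_plus_right: "f \<star> (\<lambda>X Y. A X Y + A' X Y) = (\<lambda>X Y. (f \<star> A) X Y + (f \<star> A') X Y)"
  by (simp add: fun_eq_iff conv2_def distrib_left sweedler_plus)

text \<open>
  The coproduct inside the convolution of A s and h is applied to Y+ .  By \<open>coproduct_plus_part\<close> it may be
  applied to Y instead, so that the sum over the translation map of Y(2) affects A only.  Identities for
  that inner sum can thus be used within a convolution.
\<close>

lemma conv_translation:
  assumes A: "\<And>s. balanced_cochain (A s)" and h: "balanced_cochain h"
    and add: "\<And>s s' X Y. A (s + s') X Y = A s X Y + A s' X Y"
    and tg: "\<And>b s X Y. A s X (Y * tg b) = A (tg b * s) X Y"
  shows "\<Lambda> Y (\<lambda>r s. (A s \<star> h) X r) = \<Delta> Y (\<lambda>y z. \<Delta> X (\<lambda>x1 x2. \<Lambda> z (\<lambda>r s. A s x2 r) * h x1 y))"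
proof -
  let ?f = "\<lambda>a c s. \<Delta> X (\<lambda>x1 x2. A s x2 c * h x1 a)"
  have "\<Lambda> Y (\<lambda>r s. \<Delta> r (\<lambda>a c. ?f a c s)) = \<Delta> Y (\<lambda>a c. \<Lambda> c (?f a))"
    by (rule coproduct_plus_part, rule conv_balanced_right[OF A h], rule barI)
      (simp_all add: cochainD[OF A] add tg distrib_right sweedler_plus)
  then show ?thesis
    unfolding conv_swap sweedler_mult_right[symmetric] sweedler_swap[of "comult H X" "plus_minus H _"] .
qed

abbreviation conv_one (infixr \<open>\<odot>\<close> 70) where "f \<odot> g \<equiv> conv1 H f g"

lemma left_linear_conv:
  assumes f: "left_linear f" and g: "left_linear g" shows "left_linear (f \<odot> g)"
  unfolding conv1_def
  by (rule left_linearI) (simp_all add: coproduct_add coproduct_sr_left coproduct_tg_left balanced_product[OF f g]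
      left_linearD[OF f] left_linearD[OF g] mult_sweedler mult.assoc)

lemma conv_one_assoc:
  assumes f: "left_linear f" and g: "left_linear g" and h: "left_linear h"
  shows "(f \<odot> g) \<odot> h = f \<odot> g \<odot> h"
proof
  fix X
  have "balanced3 (\<lambda>a b c. f c * (g b * h a))"
    by (rule balanced3I) (simp_all add: left_linearD[OF f] left_linearD[OF g] left_linearD[OF h] ring_rules)
  from coassociativity[OF this, of X] show "((f \<odot> g) \<odot> h) X = (f \<odot> g \<odot> h) X"
    by (simp add: conv1_def mult_sweedler mult.assoc)
qed

lemma conv_one_unit_left: "left_linear f \<Longrightarrow> (\<lambda>X. bar (ep X)) \<odot> f = f"
  and conv_one_unit_right: "left_linear f \<Longrightarrow> f \<odot> (\<lambda>X. bar (ep X)) = f"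
  by (simp_all add: fun_eq_iff conv1_def counit_conv_left counit_conv_right)

lemma conv_left_multiple:
  assumes u: "left_linear u" and f: "balanced_cochain f" and g: "balanced_cochain g"
  shows "((\<lambda>X Y. \<Delta> X (\<lambda>x1 x2. u x2 * f x1 Y)) \<star> g) X Y = \<Delta> X (\<lambda>a w. u w * (f \<star> g) a Y)"
proof -
  note fgu = cochainD[OF f] cochainD[OF g] left_linearD[OF u]
  have "balanced3 (\<lambda>a b c. u c * (f b y2 * g a y1))" for y1 y2
    by (rule balanced3I) (simp_all add: fgu ring_rules)
  from coassociativity[OF this, of X]
  have "((\<lambda>X Y. \<Delta> X (\<lambda>x1 x2. u x2 * f x1 Y)) \<star> g) X Y = \<Delta> Y (\<lambda>y1 y2. \<Delta> X (\<lambda>z c. \<Delta> z (\<lambda>a b. u c * (f b y2 * g a y1))))"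
    by (simp add: conv_swap sweedler_mult_right[symmetric] mult.assoc)
  also have "\<dots> = \<Delta> X (\<lambda>z c. u c * (f \<star> g) z Y)"
    unfolding conv_swap sweedler_mult_left[symmetric] by (rule sweedler_swap)
  finally show ?thesis .
qed

lemma conv_right_multiple:
  assumes u: "left_linear u" and f: "balanced_cochain f" and g: "balanced_cochain g"
  shows "(f \<star> (\<lambda>X Y. \<Delta> X (\<lambda>a b. g b Y * u a))) X Y = \<Delta> X (\<lambda>a b. (f \<star> g) b Y * u a)"
proof -
  note fgu = cochainD[OF f] cochainD[OF g] left_linearD[OF u]
  have "balanced3 (\<lambda>a b c. f c y2 * (g b y1 * u a))" for y1 y2
    by (rule balanced3I) (simp_all add: fgu ring_rules)
  from coassociativity[OF this, of X, symmetric]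
  have "(f \<star> (\<lambda>X Y. \<Delta> X (\<lambda>a b. g b Y * u a))) X Y = \<Delta> Y (\<lambda>y1 y2. \<Delta> X (\<lambda>a z. \<Delta> z (\<lambda>b c. f c y2 * (g b y1 * u a))))"
    by (simp add: conv_swap sweedler_mult_left[symmetric])
  also have "\<dots> = \<Delta> X (\<lambda>a z. (f \<star> g) z Y * u a)"
    unfolding conv_swap sweedler_mult_right[symmetric] mult.assoc by (rule sweedler_swap)
  finally show ?thesis .
qed

lemma cochain2_balanced:
  assumes "cochain2 H sN bar f" shows "balanced_cochain f"
proof -
  note c = assms[unfolded cochain2_def]
  have 1: "f (X + X') Y = f X Y + f X' Y" "f X (Y + Y') = f X Y + f X Y'" for X X' Y Y'
    using c linear_add[of "lscale H" sN "\<lambda>X. f X Y"] linear_add[of "lscale H" sN "f X"] by blast+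
  have 2: "f (sr b * tg b' * X) Y = bar b' * f X Y * bar b" for b b' X Y using c by blast
  show ?thesis
    using c 1 2[of _ 1] 2[of 1] by (intro cochainI) simp_all
qed

lemma balanced_compose_mult:
  "left_linear g \<Longrightarrow> balanced_cochain (\<lambda>X Y. g (X * Y))"
  by (rule cochainI) (simp_all add: left_linearD[of g] ring_rules)

end

section \<open>Twisted module algebras\<close>

text \<open>
  A twisted module algebra with a chosen convolution inverse \<tau> of its cocycle.
\<close>

locale twisted_system = bar_hopf_algebroid H sN bar
  for H :: "('k::field, 'b::{ring,monoid_mult}, 'l::{ring,monoid_mult}, 'z) bialgebroid_scheme"
    and sN :: "'k \<Rightarrow> 'n::{ring,monoid_mult} \<Rightarrow> 'n" and bar :: "'b \<Rightarrow> 'n" +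
  fixes \<sigma> \<tau> :: "'l \<Rightarrow> 'l \<Rightarrow> 'n" and act :: "'l \<Rightarrow> 'n \<Rightarrow> 'n"
  assumes twisted: "twisted_module_algebra H sN bar \<sigma> act"
    and \<tau>_cochain: "cochain2 H sN bar \<tau>"
    and \<sigma>\<tau>_unit: "\<And>X Y. conv2 H \<sigma> \<tau> X Y = bar (counit H (X * Y))"
    and \<tau>\<sigma>_unit: "\<And>X Y. conv2 H \<tau> \<sigma> X Y = bar (counit H (X * Y))"
begin

lemma two_cocycle: "two_cocycle H sN bar \<sigma> act"
  using twisted unfolding twisted_module_algebra_def by (rule conjunct1)

lemma measuring: "measuring H sN bar act"
  using two_cocycle unfolding two_cocycle_def by (rule conjunct1)

lemma act_one [simp]: "act 1 n = n"
  using twisted unfolding twisted_module_algebra_def by blast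

lemma act_add: "act (X + Y) n = act X n + act Y n" and act_plus: "act X (m + n) = act X m + act X n"
  using measuring linear_add[of "lscale H" sN "\<lambda>X. act X n"] linear_add[of sN sN "act X"]
  unfolding measuring_def by blast+

lemma act_sr_left: "act (sr b * X) n = act X n * bar b" and act_tg_left: "act (tg b * X) n = bar b * act X n"
proof -
  have "\<forall>b b' X n. act (sr b * tg b' * X) n = bar b' * act X n * bar b"
    using measuring unfolding measuring_def by blast
  from this[rule_format, of b 1] this[rule_format, of 1 b]
  show "act (sr b * X) n = act X n * bar b" "act (tg b * X) n = bar b * act X n" by simp_all
qed

lemma act_tg_right: "act (X * tg b) n = act X (bar b * n)"
  and act_bar: "act X (bar b) = bar (ep (X * sr b))"
  and act_mult: "act X (m * n) = \<Delta> X (\<lambda>x1 x2. act x2 m * act x1 n)"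
  using measuring unfolding measuring_def by blast+

lemma left_linear_act: "left_linear (\<lambda>X. act X n)"
  by (rule left_linearI) (simp_all add: act_add act_sr_left act_tg_left)

lemma act_sr_right: "act (X * sr b) n = act X (n * bar b)"
  using counit_conv_right_sr[OF left_linear_act] by (simp add: act_mult act_bar)

lemmas act_simps = act_add act_plus act_sr_left act_tg_left act_sr_right act_tg_right

lemma balanced_act: "left_linear g \<Longrightarrow> balanced_cochain (\<lambda>X Y. act X (g Y))"
  by (rule cochainI)
    (simp_all add: act_simps left_linearD[of g])

lemma \<sigma>_balanced: "balanced_cochain \<sigma>" and \<tau>_balanced: "balanced_cochain \<tau>"
  using two_cocycle \<tau>_cochain unfolding two_cocycle_def by (blast intro: cochain2_balanced)+

lemmas \<sigma> = cochainD[OF \<sigma>_balanced]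
lemmas \<tau> = cochainD[OF \<tau>_balanced]

lemma \<sigma>_linear: "left_linear (\<lambda>X. \<sigma> X Y)" and \<tau>_linear: "left_linear (\<lambda>X. \<tau> X Y)"
  by (rule left_linear_first \<sigma>_balanced \<tau>_balanced)+

lemma \<sigma>_one [simp]: "\<sigma> X 1 = bar (ep X)" "\<sigma> 1 X = bar (ep X)"
  and \<sigma>_tg_right: "\<sigma> X (Y * tg b) = \<sigma> X (Y * sr b)"
  using two_cocycle unfolding two_cocycle_def by blast+

lemma \<sigma>\<tau>: "\<sigma> \<star> \<tau> = conv_unit" and \<tau>\<sigma>: "\<tau> \<star> \<sigma> = conv_unit"
  by (simp_all add: fun_eq_iff conv_unit_def \<sigma>\<tau>_unit \<tau>\<sigma>_unit)

text \<open>
  For fixed elements in the third variable, all terms of the cocycle condition are convolutions of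
  balanced cochains in two variables; this avoids a separate calculus for three variables.
\<close>

lemma cocycle:
  "((\<lambda>X Y. \<sigma> (X * Y) Z) \<star> \<sigma>) X Y =
    \<Delta> Z (\<lambda>z1 z2. ((\<lambda>X Y. \<sigma> X (Y * z2)) \<star> (\<lambda>X Y. act X (\<sigma> Y z1))) X Y)"
proof -
  have "((\<lambda>X Y. \<sigma> (X * Y) Z) \<star> \<sigma>) X Y =
     \<Delta> X (\<lambda>X1 X2. \<Delta> Y (\<lambda>Y1 Y2. \<Delta> Z (\<lambda>Z1 Z2. \<sigma> X2 (Y2 * Z2) * act X1 (\<sigma> Y1 Z1))))"
    using two_cocycle unfolding two_cocycle_def conv2_def by simp
  also have "\<dots> = \<Delta> X (\<lambda>X1 X2. \<Delta> Z (\<lambda>Z1 Z2. \<Delta> Y (\<lambda>Y1 Y2. \<sigma> X2 (Y2 * Z2) * act X1 (\<sigma> Y1 Z1))))"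
    by (intro arg_cong[where f = "\<Delta> X"] ext sweedler_swap)
  also have "\<dots> = \<Delta> Z (\<lambda>Z1 Z2. \<Delta> X (\<lambda>X1 X2. \<Delta> Y (\<lambda>Y1 Y2. \<sigma> X2 (Y2 * Z2) * act X1 (\<sigma> Y1 Z1))))"
    by (rule sweedler_swap)
  finally show ?thesis by (simp add: conv2_def)
qed

lemma twisted_action: "\<sigma> \<star> (\<lambda>X Y. act X (act Y n)) = (\<lambda>X Y. act (X * Y) n) \<star> \<sigma>"
  using twisted unfolding twisted_module_algebra_def conv2_def by auto

lemma twisted_action': "(\<lambda>X Y. act X (act Y n)) \<star> \<tau> = \<tau> \<star> (\<lambda>X Y. act (X * Y) n)"
proof -
  let ?a = "\<lambda>X Y. act X (act Y n)" and ?b = "\<lambda>X Y. act (X * Y) n"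
  have a: "balanced_cochain ?a" and b: "balanced_cochain ?b"
    by (rule balanced_act balanced_compose_mult left_linear_act)+
  note bc = a b \<sigma>_balanced \<tau>_balanced balanced_cochain_conv
  have "?a \<star> \<tau> = \<tau> \<star> (\<sigma> \<star> ?a) \<star> \<tau>"
    by (simp add: conv_assoc[symmetric] bc \<tau>\<sigma> conv_unit_left)
  also have "\<dots> = \<tau> \<star> ?b"
    unfolding twisted_action by (simp add: conv_assoc bc \<sigma>\<tau> conv_unit_right)
  finally show ?thesis .
qed

text \<open>
  In terms of \<omega> the functional \<theta> is \<^verbatim>\<open>theta(X (x) n) = omega(X+, X-, n)\<close>; the variables are kept apart
  so that X+ may be multiplied by further factors.
\<close>

definition \<omega> :: "'l \<Rightarrow> 'l \<Rightarrow> 'n \<Rightarrow> 'n"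
  where "\<omega> W s n = \<Delta> W (\<lambda>a b. \<sigma> b s * act a n)"

lemma \<omega>_bal: "balanced_diamond (\<lambda>a b. \<sigma> b s * act a n)"
  by (rule balanced_product[OF \<sigma>_linear left_linear_act])

lemma \<omega>_simps:
  "\<omega> (W + W') s n = \<omega> W s n + \<omega> W' s n" "\<omega> W (s + s') n = \<omega> W s n + \<omega> W s' n"
  "\<omega> W s (n + n') = \<omega> W s n + \<omega> W s n'"
  "\<omega> (sr b * W) s n = \<omega> W s n * bar b" "\<omega> (tg b * W) s n = bar b * \<omega> W s n"
  "\<omega> (W * sr b) s n = \<omega> W s (n * bar b)" "\<omega> (W * tg b) s n = \<omega> W (tg b * s) n"
  "\<omega> W (sr b * s) n = \<omega> W s (bar b * n)"
  using takeuchi[OF \<omega>_bal[of s n], of W b]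
  by (simp_all add: \<omega>_def coproduct_add coproduct_sr_left coproduct_tg_left coproduct_sr_right
      coproduct_tg_right \<omega>_bal \<sigma> act_plus act_add act_sr_left act_tg_left act_sr_right act_tg_right
      distrib_left distrib_right sweedler_plus mult_sweedler mult.assoc)

lemma \<omega>_linear: "left_linear (\<lambda>W. \<omega> W s n)"
  by (rule left_linearI) (simp_all add: \<omega>_simps)

lemma \<omega>_one: "\<omega> 1 s n = bar (ep s) * n"
  by (simp add: \<omega>_def coproduct_one \<omega>_bal)

lemma \<omega>_right_one: "\<omega> W 1 n = act W n"
  by (simp add: \<omega>_def counit_conv_left left_linear_act)

lemma \<omega>_mult: "\<omega> W s (m * n) = \<Delta> W (\<lambda>w1 w2. \<omega> w2 s m * act w1 n)"
proof -
  have "balanced3 (\<lambda>c d b. \<sigma> b s * (act d m * act c n))"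
    by (rule balanced3I) (simp_all add: act_add act_sr_left act_tg_left \<sigma> ring_rules)
  from coassociativity[OF this, of W] show ?thesis
    by (simp add: \<omega>_def act_mult mult_sweedler mult.assoc)
qed

text \<open>
  The coordinate functional of the crossed product with respect to the elements \<^verbatim>\<open>n e(X)\<close>, evaluated
  at \<^verbatim>\<open>X (x) n\<close>.
\<close>

definition \<theta> :: "'l \<Rightarrow> 'n \<Rightarrow> 'n"
  where "\<theta> X n = \<Lambda> X (\<lambda>p q. \<omega> p q n)"

lemma \<omega>_bar: "balanced_bar tg (\<lambda>p q. \<omega> p q n)"
  by (rule barI) (simp_all add: \<omega>_simps)

lemma \<theta>_simps:
  "\<theta> (X + Y) n = \<theta> X n + \<theta> Y n" "\<theta> X (m + n) = \<theta> X m + \<theta> X n"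
  "\<theta> (sr b * X) n = \<theta> X n * bar b" "\<theta> (X * tg b) n = \<theta> X (bar b * n)"
  "\<theta> (X * sr b) n = \<theta> X (n * bar b)"
  by (simp_all add: \<theta>_def translation_add translation_sr_left translation_tg_right translation_sr_right \<omega>_bar
      \<omega>_simps sweedler_plus sweedler_mult_right[symmetric])

lemma \<theta>_bar: "balanced_bar bar \<theta>"
  by (rule barI) (simp_all add: \<theta>_simps)

lemma \<theta>_one: "\<theta> 1 n = n"
  by (simp add: \<theta>_def translation_one \<omega>_bar \<omega>_right_one)

text \<open>
  In the cocycle condition for \<^verbatim>\<open>sigma(Y, r s)\<close> with r = Z+ and s = Z-, the product r s collapses and
  \<^verbatim>\<open>Y |> sigma(Z+, Z-)\<close> is left alone on its side.
\<close>

lemma act_\<sigma>_collapse: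
  "\<Lambda> Z (\<lambda>r s. act Y (\<sigma> r s)) = \<Lambda> Z (\<lambda>r s. ((\<lambda>X Y. \<sigma> (X * Y) s) \<star> \<sigma>) Y r)"
proof -
  define F where "F a w c = \<Delta> Y (\<lambda>y1 y2. \<sigma> y2 w * act y1 (\<sigma> a c))" for a w c
  have b: "balanced_diamond (\<lambda>y1 y2. \<sigma> y2 w * act y1 n)" for w n by (rule \<omega>_bal)
  have "\<Lambda> Z (\<lambda>r s. ((\<lambda>X Y. \<sigma> (X * Y) s) \<star> \<sigma>) Y r) =
    \<Lambda> Z (\<lambda>r s. \<Delta> s (\<lambda>c d. \<Delta> r (\<lambda>a b. F a (b * d) c)))"
    unfolding cocycle unfolding conv_swap F_def ..
  also have "\<dots> = \<Lambda> Z (\<lambda>r s. \<Delta> r (\<lambda>a b. \<Delta> s (\<lambda>c d. F a (b * d) c)))"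
    by (intro arg_cong[where f = "\<Lambda> Z"] ext sweedler_swap)
  also have "\<dots> = \<Lambda> Z (\<lambda>r s. F r 1 s)"
  proof (rule translation_collapse)
    fix c show "balanced_diamond (\<lambda>a w. F a w c)"
    proof (rule diamondI)
      fix \<beta> a w
      show "F (tg \<beta> * a) w c = F a (sr \<beta> * w) c"
        using takeuchi[OF b[of w "\<sigma> a c"], of Y \<beta>] by (simp add: F_def \<sigma> act_tg_right)
    qed (simp_all add: F_def \<sigma> act_plus distrib_left distrib_right sweedler_plus)
  qed (simp_all add: F_def \<sigma> act_plus distrib_left sweedler_plus)
  also have "\<dots> = \<Lambda> Z (\<lambda>r s. act Y (\<sigma> r s))"
    by (simp add: F_def counit_conv_left left_linear_act)
  finally show ?thesis ..
qed

lemma conv_\<sigma>mult_act: "((\<lambda>X Y. \<sigma> (X * Y) s) \<star> (\<lambda>X Y. act (X * Y) m)) X r = \<omega> (X * r) s m"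
  by (simp add: \<omega>_def coproduct_mult \<omega>_bal conv2_def)

text \<open>
  The key computation.  Expand \<theta>, move \<tau> past the action by \<open>twisted_action'\<close>, replace
  \<^verbatim>\<open>X |> sigma(Y+, Y-)\<close> by \<open>act_\<sigma>_collapse\<close>, and cancel \<sigma> against \<tau>.
\<close>

lemma act_\<theta>_\<tau>:
  "((\<lambda>X Y. act X (\<theta> Y m)) \<star> \<tau>) X Y = \<Lambda> Y (\<lambda>r s. \<omega> (X * r) s m)"
proof -
  let ?a = "\<lambda>X Y. act X (act Y m)" and ?b = "\<lambda>X Y. act (X * Y) m"
  let ?\<alpha> = "\<lambda>s X Y. act X (\<sigma> Y s)" and ?\<beta> = "\<lambda>s X Y. \<sigma> (X * Y) s"
  let ?w = "\<lambda>s X Y. act X (\<omega> Y s m)"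
  have bc: "balanced_cochain (?\<alpha> s)" "balanced_cochain (?\<beta> s)" "balanced_cochain (?w s)"
    "balanced_cochain ?a" "balanced_cochain ?b" for s
    by (rule balanced_act balanced_compose_mult left_linear_act \<sigma>_linear \<omega>_linear)+
  note bc = bc \<sigma>_balanced \<tau>_balanced balanced_cochain_conv
  have w: "?w s = ?\<alpha> s \<star> ?a" for s
    by (simp add: fun_eq_iff conv_swap \<omega>_def act_mult sweedler_additive[of "act _"] act_plus)
  have "((\<lambda>X Y. act X (\<theta> Y m)) \<star> \<tau>) X Y = \<Delta> Y (\<lambda>y z. \<Delta> X (\<lambda>x1 x2. \<Lambda> z (\<lambda>r s. ?w s x2 r) * \<tau> x1 y))"
    by (simp add: conv_swap \<theta>_def sweedler_additive[of "act _"] act_plus)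
  also have "\<dots> = \<Lambda> Y (\<lambda>r s. (?w s \<star> \<tau>) X r)"
    by (rule conv_translation[symmetric]) (simp_all add: bc \<omega>_simps act_plus)
  also have "\<dots> = \<Lambda> Y (\<lambda>r s. (?\<alpha> s \<star> \<tau> \<star> ?b) X r)"
    by (simp add: w conv_assoc bc twisted_action')
  also have "\<dots> = \<Delta> Y (\<lambda>y z. \<Delta> X (\<lambda>x1 x2. \<Lambda> z (\<lambda>r s. ?\<alpha> s x2 r) * (\<tau> \<star> ?b) x1 y))"
    by (rule conv_translation) (simp_all add: bc \<sigma> act_plus)
  also have "\<dots> = \<Delta> Y (\<lambda>y z. \<Delta> X (\<lambda>x1 x2. \<Lambda> z (\<lambda>r s. (?\<beta> s \<star> \<sigma>) x2 r) * (\<tau> \<star> ?b) x1 y))"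
    by (simp add: act_\<sigma>_collapse)
  also have "\<dots> = \<Lambda> Y (\<lambda>r s. ((?\<beta> s \<star> \<sigma>) \<star> \<tau> \<star> ?b) X r)"
    by (rule conv_translation[symmetric])
      (simp_all add: bc \<sigma> conv_plus_left conv_tg_right mult.assoc[symmetric])
  also have "\<dots> = \<Lambda> Y (\<lambda>r s. (?\<beta> s \<star> (\<sigma> \<star> \<tau>) \<star> ?b) X r)"
    by (simp add: conv_assoc bc)
  also have "\<dots> = \<Lambda> Y (\<lambda>r s. \<omega> (X * r) s m)"
    by (simp add: \<sigma>\<tau> conv_unit_left bc conv_\<sigma>mult_act)
  finally show ?thesis .
qed

text \<open>
  The cocycle condition, solved for \<^verbatim>\<open>sigma(X, Y Z)\<close>: convolution with \<^verbatim>\<open>X |> tau(Y, Z)\<close> from the right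
  cancels \<^verbatim>\<open>X |> sigma(Y, Z)\<close>.
\<close>

lemma \<sigma>_from_cocycle:
  "\<Delta> Z (\<lambda>z1 z2. (((\<lambda>X Y. \<sigma> (X * Y) z2) \<star> \<sigma>) \<star> (\<lambda>X Y. act X (\<tau> Y z1))) X Y) = \<sigma> X (Y * Z)"
proof -
  let ?s = "\<lambda>z X Y. \<sigma> X (Y * z)" and ?t = "\<lambda>z X Y. act X (\<sigma> Y z)" and ?t' = "\<lambda>z X Y. act X (\<tau> Y z)"
  have bc: "balanced_cochain (?s z)" "balanced_cochain (?t z)" "balanced_cochain (?t' z)" for z
    by (rule cochainI, simp_all add: \<sigma> ring_rules)
      (rule balanced_act \<sigma>_linear \<tau>_linear)+
  note bc = bc balanced_cochain_conv
  have 1: "?t z2 \<star> (\<lambda>X Y. ?t' z1 X (Y * tg \<beta>)) = (\<lambda>X Y. ?t (sr \<beta> * z2) X Y) \<star> ?t' z1" for z1 z2 \<beta>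
    using conv_takeuchi[OF bc(2)[of z2] bc(3)[of z1]] by (simp add: fun_eq_iff \<sigma>)
  have 2: "?s z3 \<star> ?t (tg \<beta> * z2) \<star> ?t' z1 = ?s (sr \<beta> * z3) \<star> ?t z2 \<star> ?t' z1" for z1 z2 z3 \<beta>
  proof -
    have e: "?t (tg \<beta> * z2) \<star> ?t' z1 = (\<lambda>X Y. (?t z2 \<star> ?t' z1) X (Y * tg \<beta>))"
      using conv_tg_right[OF bc(2)[of z2] bc(3)[of z1]] by (simp add: fun_eq_iff \<sigma>)
    show ?thesis
      unfolding e using conv_takeuchi[OF bc(1)[of z3] bc(4)[OF bc(2)[of z2] bc(3)[of z1]]] by (simp add: fun_eq_iff mult.assoc)
  qed
  have b3: "balanced3 (\<lambda>z1 z2 z3. (?s z3 \<star> ?t z2 \<star> ?t' z1) X Y)"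
  proof (rule balanced3I)
    fix \<beta> z1 z2 z3
    have "?t' (tg \<beta> * z1) = (\<lambda>X Y. ?t' z1 X (Y * tg \<beta>))" by (simp add: \<tau>)
    then show "(?s z3 \<star> ?t z2 \<star> ?t' (tg \<beta> * z1)) X Y = (?s z3 \<star> ?t (sr \<beta> * z2) \<star> ?t' z1) X Y"
      by (simp add: 1)
    show "(?s z3 \<star> ?t (tg \<beta> * z2) \<star> ?t' z1) X Y = (?s (sr \<beta> * z3) \<star> ?t z2 \<star> ?t' z1) X Y"
      by (simp only: 2)
  qed (simp_all add: \<sigma> \<tau> act_plus distrib_left conv_plus_left conv_plus_right)
  have e: "(\<lambda>X Y. \<sigma> (X * Y) w) \<star> \<sigma> = (\<lambda>X Y. \<Delta> w (\<lambda>z2 z3. (?s z3 \<star> ?t z2) X Y))" for w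
    by (simp only: fun_eq_iff cocycle simp_thms)
  have "\<Delta> Z (\<lambda>z1 w. (((\<lambda>X Y. \<sigma> (X * Y) w) \<star> \<sigma>) \<star> ?t' z1) X Y) =
      \<Delta> Z (\<lambda>z1 w. \<Delta> w (\<lambda>z2 z3. (?s z3 \<star> ?t z2 \<star> ?t' z1) X Y))"
    unfolding e by (simp only: conv_sweedler_left conv_assoc bc)
  also have "\<dots> = \<Delta> Z (\<lambda>\<zeta> z3. \<Delta> \<zeta> (\<lambda>z1 z2. (?s z3 \<star> ?t z2 \<star> ?t' z1) X Y))"
    by (rule coassociativity[OF b3])
  also have "\<dots> = \<Delta> Z (\<lambda>\<zeta> z3. (?s z3 \<star> (\<lambda>X Y. act X (bar (ep (Y * \<zeta>))))) X Y)"
  proof -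
    have "\<Delta> \<zeta> (\<lambda>z1 z2. (?t z2 \<star> ?t' z1) X Y) = act X (bar (ep (Y * \<zeta>)))" for \<zeta> X Y
    proof -
      have "act X (bar (ep (Y * \<zeta>))) = act X ((\<sigma> \<star> \<tau>) Y \<zeta>)" by (simp add: \<sigma>\<tau>_unit)
      then show ?thesis
        by (simp add: conv_swap sweedler_additive[of "act _"] act_plus act_mult)
    qed
    then show ?thesis by (simp add: conv_sweedler_right[symmetric])
  qed
  also have "\<dots> = \<Delta> X (\<lambda>x1 x2. \<Delta> (Y * Z) (\<lambda>w1 w2. \<sigma> x2 w2 * bar (ep (x1 * sr (ep w1)))))"
  proof -
    have "balanced_diamond (\<lambda>w1 w2. \<Delta> X (\<lambda>x1 x2. \<sigma> x2 w2 * bar (ep (x1 * sr (ep w1)))))"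
      using conv_balanced_right[OF \<sigma>_balanced balanced_compose_mult[OF left_linear_counit]]
      by (simp add: ep_mult_sr)
    then show ?thesis
      unfolding sweedler_swap[of "comult H X" "comult H (Y * Z)"]
      by (simp add: conv_swap coproduct_mult' act_bar)
  qed
  also have "\<dots> = \<sigma> X (Y * Z)"
    using fun_cong[OF fun_cong[OF conv_unit_right[OF \<sigma>_balanced]], of X "Y * Z"]
    by (simp add: conv2_def conv_unit_def ep_mult_sr)
  finally show ?thesis .
qed

text \<open>
  This is \<^verbatim>\<open>theta(e(X)) = bar (counit X)\<close>.  The counit of X is \<^verbatim>\<open>sigma(X(1)+, X(1)- X(2))\<close> by
  \<open>translation_coproduct\<close>; \<open>\<sigma>_from_cocycle\<close> expands it, and a factor \<^verbatim>\<open>X(1)+ X(1)-\<close> collapses.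
\<close>

lemma \<theta>_unit: "\<Delta> X (\<lambda>x y. \<Lambda> x (\<lambda>p q. \<theta> p (\<tau> q y))) = bar (ep X)"
proof -
  let ?t = "\<lambda>z X Y. act X (\<tau> Y z)" and ?\<beta> = "\<lambda>z X Y. \<sigma> (X * Y) z"
  have bc: "balanced_cochain (?t z)" "balanced_cochain (?\<beta> z)" for z
    by (rule balanced_act balanced_compose_mult \<sigma>_linear \<tau>_linear)+
  note bc = bc \<sigma>_balanced balanced_cochain_conv
  note st = cochainD[OF bc(4)[OF \<sigma>_balanced bc(1)]]
  have 1: "\<Lambda> x (\<lambda>p q. \<theta> p (\<tau> q y)) = \<Lambda> x (\<lambda>p q. (\<sigma> \<star> ?t y) p q)" for x y
  proof -
    have "\<Lambda> x (\<lambda>p q. \<Delta> q (\<lambda>z w. \<omega> p w (\<tau> z y))) = \<Lambda> x (\<lambda>p q. \<Lambda> p (\<lambda>p' q'. \<omega> p' q' (\<tau> q y)))"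
      by (rule coproduct_minus_part) (simp_all add: barI diamondI \<omega>_simps \<tau>)
    then show ?thesis by (simp add: \<theta>_def conv_swap \<omega>_def)
  qed
  have 2: "\<Lambda> x (\<lambda>p q. bar c * (\<sigma> \<star> ?t z) p q) = \<Lambda> x (\<lambda>p q. (\<sigma> \<star> ?t (tg c * z)) p q)" for c x z
  proof -
    have "balanced_bar tg (\<sigma> \<star> ?t z)" by (rule barI) (simp_all add: st)
    from translation_takeuchi[OF this, of x c]
    have "\<Lambda> x (\<lambda>p q. bar c * (\<sigma> \<star> ?t z) p q) = \<Lambda> x (\<lambda>p q. (\<sigma> \<star> ?t z) p (q * tg c))"
      by (simp add: st)
    then show ?thesis
      using conv_takeuchi[OF \<sigma>_balanced bc(1)[of z], of c]
      by (simp add: conv_tg_right bc \<sigma>_tg_right \<tau>)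
  qed
  have 3: "\<Lambda> x (\<lambda>p q. ((?\<beta> z2 \<star> \<sigma>) \<star> ?t z1) p q) = \<Lambda> x (\<lambda>p q. (\<sigma> \<star> ?t (tg (ep z2) * z1)) p q)" for x z1 z2
  proof -
    have "\<Lambda> x (\<lambda>p q. ((?\<beta> z2 \<star> \<sigma>) \<star> ?t z1) p q) =
      \<Lambda> x (\<lambda>p q. \<Delta> p (\<lambda>a b. \<Delta> q (\<lambda>c d. \<sigma> (b * d) z2 * (\<sigma> \<star> ?t z1) a c)))"
      by (simp add: conv_assoc bc) (simp add: conv2_def)
    also have "\<dots> = \<Lambda> x (\<lambda>p q. \<sigma> 1 z2 * (\<sigma> \<star> ?t z1) p q)"
      by (rule translation_collapse)
        (simp_all add: diamondI st \<sigma> ring_rules)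
    finally show ?thesis by (simp add: 2)
  qed
  have "bar (ep X) = \<Delta> X (\<lambda>x y. \<Lambda> x (\<lambda>p q. \<sigma> p (q * y)))"
  proof -
    have "balanced_bar tg \<sigma>" by (rule barI) (simp_all add: \<sigma>)
    from translation_coproduct[OF this] show ?thesis by simp
  qed
  also have "\<dots> = \<Delta> X (\<lambda>x y. \<Lambda> x (\<lambda>p q. \<Delta> y (\<lambda>z1 z2. ((?\<beta> z2 \<star> \<sigma>) \<star> ?t z1) p q)))"
    by (simp add: \<sigma>_from_cocycle)
  also have "\<dots> = \<Delta> X (\<lambda>x y. \<Delta> y (\<lambda>z1 z2. \<Lambda> x (\<lambda>p q. ((?\<beta> z2 \<star> \<sigma>) \<star> ?t z1) p q)))"
    by (intro arg_cong[where f = "\<Delta> X"] ext sweedler_swap)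
  also have "\<dots> = \<Delta> X (\<lambda>x y. \<Delta> y (\<lambda>z1 z2. \<Lambda> x (\<lambda>p q. (\<sigma> \<star> ?t (tg (ep z2) * z1)) p q)))"
    by (simp only: 3)
  also have "\<dots> = \<Delta> X (\<lambda>x y. \<Lambda> x (\<lambda>p q. \<Delta> y (\<lambda>z1 z2. (\<sigma> \<star> ?t (tg (ep z2) * z1)) p q)))"
    by (intro arg_cong[where f = "\<Delta> X"] ext sweedler_swap)
  also have "\<dots> = \<Delta> X (\<lambda>x y. \<Lambda> x (\<lambda>p q. \<theta> p (\<tau> q y)))"
  proof -
    have "\<Delta> y (\<lambda>z1 z2. (\<sigma> \<star> ?t (tg (ep z2) * z1)) p q) = (\<sigma> \<star> ?t y) p q" for y p q
      by (rule counit_right_additive[of "\<lambda>z. (\<sigma> \<star> ?t z) p q"])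
        (simp add: \<tau> act_plus conv_plus_right)
    then show ?thesis by (simp add: 1)
  qed
  finally show ?thesis ..
qed

text \<open>
  The identity \<^verbatim>\<open>X (x) n = theta(X(2) (x) n) e(X(1))\<close> in the crossed product, after application of a
  balanced map f.  By \<open>act_\<theta>_\<tau>\<close> the second factor becomes \<^verbatim>\<open>omega(q r, s, n)\<close> with
  \<^verbatim>\<open>q r = X(1)- X(2)+\<close>, which collapses.
\<close>

lemma tensor_expansion:
  fixes f :: "'l \<Rightarrow> 'n \<Rightarrow> 'a::ab_group_add"
  assumes f: "balanced_bar bar f"
  shows "\<Delta> X (\<lambda>x z. \<Delta> x (\<lambda>x' y. \<Lambda> x' (\<lambda>p q. \<Lambda> p (\<lambda>p' q'. f p' (act q' (\<theta> z n) * \<tau> q y))))) = f X n"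
proof -
  note f' = barD[OF f]
  have minus: "balanced_diamond (\<lambda>z w. f p (act w m * \<tau> z y))" for p m y
    by (rule diamondI) (simp_all add: f' act_simps \<tau> ring_rules)
  have 1: "\<Lambda> x' (\<lambda>p q. \<Lambda> p (\<lambda>p' q'. f p' (act q' m * \<tau> q y))) =
     \<Lambda> x' (\<lambda>p q. \<Delta> q (\<lambda>q1 q2. f p (act q2 m * \<tau> q1 y)))" for x' m y
    by (rule coproduct_minus_part[symmetric, OF _ minus])
      (simp add: barI f' act_simps \<tau> ring_rules)
  have bar: "balanced_bar tg (\<lambda>p q. \<Delta> q (\<lambda>q1 q2. f p (act q2 m * \<tau> q1 y)))" for m y
    by (rule barI) (simp_all add: f' coproduct_add coproduct_tg_left minus sweedler_plus act_simps mult.assoc)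
  have b3: "balanced3 (\<lambda>x' y z. \<Lambda> x' (\<lambda>p q. \<Delta> q (\<lambda>q1 q2. f p (act q2 (\<theta> z n) * \<tau> q1 y))))"
  proof (rule balanced3I)
    fix b x' y z
    have "\<Delta> q (\<lambda>q1 q2. f p (act q2 (\<theta> z n) * \<tau> q1 (tg b * y))) =
      \<Delta> q (\<lambda>q1 q2. f p (act q2 (\<theta> (sr b * z) n) * \<tau> q1 y))" for p q
      using takeuchi[OF minus[of p "\<theta> z n" y], of q b] by (simp add: \<tau> \<theta>_simps act_simps)
    then show "\<Lambda> x' (\<lambda>p q. \<Delta> q (\<lambda>q1 q2. f p (act q2 (\<theta> z n) * \<tau> q1 (tg b * y)))) =
      \<Lambda> x' (\<lambda>p q. \<Delta> q (\<lambda>q1 q2. f p (act q2 (\<theta> (sr b * z) n) * \<tau> q1 y)))" by simp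
  qed (simp_all add: f' act_simps \<tau> \<theta>_simps translation_add translation_tg_left bar coproduct_sr_right minus
      sweedler_plus distrib_left distrib_right)
  let ?g = "\<lambda>a r s. \<Lambda> a (\<lambda>p q. f p (\<omega> (q * r) s n))"
  have b\<omega>: "balanced_bar tg (\<lambda>p q. f p (\<omega> (q * r) s n))" for r s
    by (rule barI) (simp_all add: f' \<omega>_simps distrib_right mult.assoc)
  have "\<Delta> X (\<lambda>x z. \<Delta> x (\<lambda>x' y. \<Lambda> x' (\<lambda>p q. \<Lambda> p (\<lambda>p' q'. f p' (act q' (\<theta> z n) * \<tau> q y))))) =
    \<Delta> X (\<lambda>x' w. \<Delta> w (\<lambda>y z. \<Lambda> x' (\<lambda>p q. \<Delta> q (\<lambda>q1 q2. f p (act q2 (\<theta> z n) * \<tau> q1 y)))))"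
    unfolding 1 by (rule coassociativity[OF b3, symmetric])
  also have "\<dots> = \<Delta> X (\<lambda>x' w. \<Lambda> x' (\<lambda>p q. \<Delta> w (\<lambda>y z. \<Delta> q (\<lambda>q1 q2. f p (act q2 (\<theta> z n) * \<tau> q1 y)))))"
    by (intro arg_cong[where f = "\<Delta> X"] ext sweedler_swap)
  also have "\<dots> = \<Delta> X (\<lambda>x' w. \<Lambda> x' (\<lambda>p q. f p (((\<lambda>X Y. act X (\<theta> Y n)) \<star> \<tau>) q w)))"
    by (simp add: conv_swap sweedler_additive[of "f _"] f')
  also have "\<dots> = \<Delta> X (\<lambda>x' w. \<Lambda> x' (\<lambda>p q. \<Lambda> w (\<lambda>r s. f p (\<omega> (q * r) s n))))"
    by (simp add: act_\<theta>_\<tau> sweedler_additive[of "f _"] f')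
  also have "\<dots> = \<Delta> X (\<lambda>x' w. \<Lambda> w (?g x'))"
    by (intro arg_cong[where f = "\<Delta> X"] ext sweedler_swap)
  also have "\<dots> = \<Lambda> X (\<lambda>r s. \<Delta> r (\<lambda>a c. ?g a c s))"
  proof (rule coproduct_plus_part[symmetric])
    show "balanced_diamond (\<lambda>a r. ?g a r s)" for s
      by (rule diamondI) (simp_all add: f' \<omega>_simps translation_add translation_tg_left b\<omega> distrib_left
          sweedler_plus mult.assoc)
    show "balanced_bar tg (?g a)" for a
      by (rule barI) (simp_all add: f' \<omega>_simps distrib_left sweedler_plus mult.assoc[symmetric])
  qed
  also have "\<dots> = \<Lambda> X (\<lambda>r s. f (r * tg (ep s)) n)"
  proof -
    have "balanced_bar tg (\<lambda>p q. f p (\<omega> q s n))" for s using b\<omega>[of 1 s] by simp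
    from translation_coproduct[OF this] show ?thesis by (simp add: \<omega>_one f')
  qed
  also have "\<dots> = f X n" by (rule translation_counit) (simp add: f')
  finally show ?thesis .
qed

text \<open>
  The cocycle condition and the twisted action, combined as they occur in a product of crossed product
  elements.
\<close>

lemma \<omega>_cocycle:
  "\<Delta> q (\<lambda>q1 q2. \<Delta> s (\<lambda>t u. \<Delta> t (\<lambda>s1 s2. \<omega> W (u * q2) (\<sigma> s2 q1 * act s1 n * m)))) =
   \<Delta> W (\<lambda>w w'. \<Delta> s (\<lambda>s1 s2. \<omega> (w' * s2) q n * \<omega> w s1 m))"
proof -
  let ?a = "\<lambda>X Y. act X (act Y n)" and ?b = "\<lambda>X Y. act (X * Y) n" and ?\<beta> = "\<lambda>X Y. \<sigma> (X * Y) q"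
  have bc: "balanced_cochain ?a" "balanced_cochain ?b" "balanced_cochain ?\<beta>"
    by (rule balanced_act balanced_compose_mult left_linear_act \<sigma>_linear)+
  note bc = bc \<sigma>_balanced balanced_cochain_conv
  have 1: "\<Delta> q (\<lambda>q1 q2. \<Delta> s (\<lambda>t u. \<Delta> t (\<lambda>s1 s2. \<omega> W (u * q2) (\<sigma> s2 q1 * act s1 n)))) =
    \<Delta> s (\<lambda>s1 s2. \<Delta> W (\<lambda>w w'. \<omega> (w' * s2) q n * \<sigma> w s1))" for W
  proof -
    have 2: "\<omega> W (u * q2) (\<sigma> s2 q1 * act s1 n) = \<Delta> W (\<lambda>w1 w2. \<omega> w2 (u * q2) (\<sigma> s2 q1) * act w1 (act s1 n))" for u q2 s2 q1 s1
      by (rule \<omega>_mult)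
    have d: "balanced_diamond (\<lambda>w1 w2. \<omega> w2 c m * act w1 m')" for c m m'
      by (rule balanced_product[OF \<omega>_linear left_linear_act])
    have b3: "balanced3 (\<lambda>s1 s2 u. \<Delta> W (\<lambda>w1 w2. \<omega> w2 (u * q2) (\<sigma> s2 q1) * act w1 (act s1 n)))" for q1 q2
    proof (rule balanced3I)
      fix b s1 s2 u
      show "\<Delta> W (\<lambda>w1 w2. \<omega> w2 (u * q2) (\<sigma> s2 q1) * act w1 (act (tg b * s1) n)) =
        \<Delta> W (\<lambda>w1 w2. \<omega> w2 (u * q2) (\<sigma> (sr b * s2) q1) * act w1 (act s1 n))"
        using takeuchi[OF d[of "u * q2" "\<sigma> s2 q1" "act s1 n"], of W b] by (simp add: act_simps \<sigma> \<omega>_simps)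
    qed (simp_all add: act_simps \<sigma> \<omega>_simps distrib_left distrib_right sweedler_plus mult.assoc)
    have "\<Delta> q (\<lambda>q1 q2. \<Delta> s (\<lambda>t u. \<Delta> t (\<lambda>s1 s2. \<omega> W (u * q2) (\<sigma> s2 q1 * act s1 n)))) =
      \<Delta> q (\<lambda>q1 q2. \<Delta> s (\<lambda>s1 v. \<Delta> v (\<lambda>s2 u. \<Delta> W (\<lambda>w1 w2. \<omega> w2 (u * q2) (\<sigma> s2 q1) * act w1 (act s1 n)))))"
      unfolding 2 coassociativity[OF b3] ..
    also have "\<dots> = \<Delta> s (\<lambda>s1 v. \<Delta> W (\<lambda>w1 w2. \<Delta> q (\<lambda>q1 q2. \<Delta> v (\<lambda>s2 u. \<omega> w2 (u * q2) (\<sigma> s2 q1))) * act w1 (act s1 n)))"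
      unfolding sweedler_mult_right[symmetric]
        sweedler_swap[of "comult H W" "comult H q"] sweedler_swap[of "comult H W"]
        sweedler_swap[of "comult H s" "comult H q"] ..
    also have "\<dots> = ((?\<beta> \<star> \<sigma>) \<star> ?a) W s"
    proof -
      have "\<Delta> q (\<lambda>q1 q2. \<Delta> v (\<lambda>s2 u. \<omega> w (u * q2) (\<sigma> s2 q1))) = (?\<beta> \<star> \<sigma>) w v" for w v
        unfolding cocycle by (simp add: conv_swap \<omega>_def)
      then show ?thesis by (simp add: conv_swap[of "?\<beta> \<star> \<sigma>"])
    qed
    also have "\<dots> = ((?\<beta> \<star> ?b) \<star> \<sigma>) W s"
      by (simp only: conv_assoc bc twisted_action)
    also have "\<dots> = \<Delta> s (\<lambda>s1 s2. \<Delta> W (\<lambda>w w'. \<omega> (w' * s2) q n * \<sigma> w s1))"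
      by (simp add: conv_swap[of "?\<beta> \<star> ?b"] conv_\<sigma>mult_act)
    finally show ?thesis .
  qed
  have b3: "balanced3 (\<lambda>w1 w w'. \<omega> (w' * s2) q n * (\<sigma> w s1 * act w1 m))" for s1 s2
    by (rule balanced3I) (simp_all add: act_simps \<sigma> \<omega>_simps ring_rules)
  have "\<Delta> q (\<lambda>q1 q2. \<Delta> s (\<lambda>t u. \<Delta> t (\<lambda>s1 s2. \<omega> W (u * q2) (\<sigma> s2 q1 * act s1 n * m)))) =
    \<Delta> W (\<lambda>w1 v. \<Delta> q (\<lambda>q1 q2. \<Delta> s (\<lambda>t u. \<Delta> t (\<lambda>s1 s2. \<omega> v (u * q2) (\<sigma> s2 q1 * act s1 n)))) * act w1 m)"
    unfolding \<omega>_mult[of _ _ _ m] sweedler_mult_right[symmetric] sweedler_swap[of "comult H W"] ..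
  also have "\<dots> = \<Delta> s (\<lambda>s1 s2. \<Delta> W (\<lambda>w1 v. \<Delta> v (\<lambda>w w'. \<omega> (w' * s2) q n * (\<sigma> w s1 * act w1 m))))"
    unfolding 1 sweedler_mult_right[symmetric] mult.assoc sweedler_swap[of "comult H W" "comult H s"] ..
  also have "\<dots> = \<Delta> s (\<lambda>s1 s2. \<Delta> W (\<lambda>w w'. \<omega> (w' * s2) q n * \<omega> w s1 m))"
    by (simp add: coassociativity[OF b3]) (simp add: \<omega>_def sweedler_mult_left[symmetric])
  also have "\<dots> = \<Delta> W (\<lambda>w w'. \<Delta> s (\<lambda>s1 s2. \<omega> (w' * s2) q n * \<omega> w s1 m))"
    by (rule sweedler_swap)
  finally show ?thesis .
qed

text \<open>
  The value of f on the product of \<^verbatim>\<open>X (x) n\<close> and \<^verbatim>\<open>Y (x) m\<close> in the crossed product.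
\<close>

definition product_sum :: "('l \<Rightarrow> 'n \<Rightarrow> 'a::comm_monoid_add) \<Rightarrow> 'l \<Rightarrow> 'n \<Rightarrow> 'l \<Rightarrow> 'n \<Rightarrow> 'a"
  where "product_sum f X n Y m =
    \<Lambda> X (\<lambda>xp xm. \<Lambda> Y (\<lambda>yp ym. \<Delta> ym (\<lambda>y1 y2. f (xp * yp) (\<sigma> y2 xm * act y1 n * m))))"

text \<open>
  If f is itself a sum over the translation map, as \<theta> and the twist by a cochain are, then X+ Y+ is
  split once more; \<open>coproduct_minus_part\<close> turns the iterated translations into coproducts of X- and Y- .
\<close>

lemma product_sum_split:
  fixes \<Omega> :: "'l \<Rightarrow> 'l \<Rightarrow> 'n \<Rightarrow> 'a::ab_group_add"
  assumes add: "\<And>W W' s k. \<Omega> (W + W') s k = \<Omega> W s k + \<Omega> W' s k"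
      "\<And>W s s' k. \<Omega> W (s + s') k = \<Omega> W s k + \<Omega> W s' k"
      "\<And>W s k k'. \<Omega> W s (k + k') = \<Omega> W s k + \<Omega> W s k'"
    and tg: "\<And>b W s k. \<Omega> (W * tg b) s k = \<Omega> W (tg b * s) k"
    and sr: "\<And>b W s k. \<Omega> W (sr b * s) k = \<Omega> W s (bar b * k)"
  shows "product_sum (\<lambda>W k. \<Lambda> W (\<lambda>p q. \<Omega> p q k)) X n Y m =
    \<Lambda> X (\<lambda>p q. \<Lambda> Y (\<lambda>r s. \<Delta> q (\<lambda>q1 q2. \<Delta> s (\<lambda>t u. \<Delta> t (\<lambda>s1 s2.
      \<Omega> (p * r) (u * q2) (\<sigma> s2 q1 * act s1 n * m))))))"
proof -
  let ?G = "\<lambda>p xm q. \<Lambda> Y (\<lambda>r s. \<Delta> s (\<lambda>t u. \<Delta> t (\<lambda>s1 s2. \<Omega> (p * r) (u * q) (\<sigma> s2 xm * act s1 n * m))))"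
  have \<Omega>_tg: "\<Omega> (p * (r * tg b)) v k = \<Omega> (p * r) (tg b * v) k" for p r b v k
    using tg[of "p * r"] by (simp add: mult.assoc)
  have \<Omega>_bar: "balanced_bar tg (\<lambda>p q. \<Omega> p q k)" for k
    by (rule barI) (simp_all add: add tg)
  have d1: "balanced_diamond (\<lambda>s1 s2. \<Omega> W v (\<sigma> s2 xm * act s1 n * m))" for W v xm
    by (rule diamondI) (simp_all add: act_simps \<sigma> add ring_rules)
  have d2: "balanced_diamond (\<lambda>t u. \<Delta> t (\<lambda>s1 s2. \<Omega> W (u * q) (\<sigma> s2 xm * act s1 n * m)))" for W q xm
  proof (rule diamondI)
    fix b t u
    have "\<Omega> W (sr b * u * q) k = \<Omega> W (u * q) (bar b * k)" for k by (simp add: sr mult.assoc)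
    then show "\<Delta> (tg b * t) (\<lambda>s1 s2. \<Omega> W (u * q) (\<sigma> s2 xm * act s1 n * m)) =
      \<Delta> t (\<lambda>s1 s2. \<Omega> W (sr b * u * q) (\<sigma> s2 xm * act s1 n * m))"
      unfolding coproduct_tg_left[OF d1] by (simp add: \<sigma> mult.assoc)
  qed (simp_all add: coproduct_add d1[unfolded mult.assoc] add ring_rules sweedler_plus)
  have b1: "balanced_bar tg (\<lambda>r s. \<Delta> s (\<lambda>t u. \<Delta> t (\<lambda>s1 s2. \<Omega> (p * r) (u * q) (\<sigma> s2 xm * act s1 n * m))))" for p q xm
  proof (rule barI)
    fix b r s
    show "\<Delta> s (\<lambda>t u. \<Delta> t (\<lambda>s1 s2. \<Omega> (p * (r * tg b)) (u * q) (\<sigma> s2 xm * act s1 n * m))) =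
      \<Delta> (tg b * s) (\<lambda>t u. \<Delta> t (\<lambda>s1 s2. \<Omega> (p * r) (u * q) (\<sigma> s2 xm * act s1 n * m)))"
      by (simp add: coproduct_tg_left d2 \<Omega>_tg mult.assoc[of "tg b"])
  qed (simp_all add: coproduct_add d2[unfolded mult.assoc] add ring_rules sweedler_plus)
  have 1: "\<Lambda> Y (\<lambda>yp ym. \<Lambda> yp (\<lambda>r s. \<Delta> ym (\<lambda>y1 y2. \<Omega> (p * r) (s * q) (\<sigma> y2 xm * act y1 n * m)))) = ?G p xm q" for p q xm
  proof (rule coproduct_minus_part[symmetric, OF _ d2])
    fix z
    show "balanced_bar tg (\<lambda>r s. \<Delta> z (\<lambda>y1 y2. \<Omega> (p * r) (s * q) (\<sigma> y2 xm * act y1 n * m)))"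
      by (rule barI) (simp_all add: \<Omega>_tg add ring_rules sweedler_plus)
  qed
  have "product_sum (\<lambda>W k. \<Lambda> W (\<lambda>p q. \<Omega> p q k)) X n Y m = \<Lambda> X (\<lambda>xp xm. \<Lambda> xp (\<lambda>p q. ?G p xm q))"
    unfolding product_sum_def 1[symmetric] translation_mult[OF \<Omega>_bar]
      sweedler_swap[of "comult H _" "plus_minus H _"]
      sweedler_swap[of "plus_minus H Y" "plus_minus H _"] ..
  also have "\<dots> = \<Lambda> X (\<lambda>p q. \<Delta> q (\<lambda>q1 q2. ?G p q1 q2))"
  proof (rule coproduct_minus_part[symmetric])
    fix xm
    show "balanced_bar tg (\<lambda>p q. ?G p xm q)"
    proof (rule barI)
      fix b p q
      have "?G (p * tg b) xm q = \<Lambda> Y (\<lambda>r s. \<Delta> (s * tg b) (\<lambda>t u. \<Delta> t (\<lambda>s1 s2. \<Omega> (p * r) (u * q) (\<sigma> s2 xm * act s1 n * m))))"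
        using translation_takeuchi[OF b1[of p q xm], of Y b] by (simp add: mult.assoc)
      then show "?G (p * tg b) xm q = ?G p xm (tg b * q)"
        unfolding coproduct_tg_right[OF d2] by (simp only: mult.assoc)
    qed (simp_all add: add ring_rules sweedler_plus)
  next
    fix p
    show "balanced_diamond (\<lambda>xm q. ?G p xm q)"
    proof (rule diamondI)
      fix b xm q
      have "\<Delta> s (\<lambda>t u. \<Delta> t (\<lambda>s1 s2. \<Omega> W (u * q) (\<sigma> s2 (tg b * xm) * act s1 n * m))) =
        \<Delta> s (\<lambda>t u. \<Delta> (t * tg b) (\<lambda>s1 s2. \<Omega> W (u * q) (\<sigma> s2 xm * act s1 n * m)))" for s W
        by (simp add: coproduct_tg_right d1 \<sigma>)
      then show "?G p (tg b * xm) q = ?G p xm (sr b * q)"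
        using takeuchi[OF d2] by (simp add: mult.assoc)
    qed (simp_all add: \<sigma> add ring_rules sweedler_plus)
  qed
  finally show ?thesis unfolding sweedler_swap[of "comult H _" "plus_minus H Y"] .
qed

text \<open>
  Coordinates of a product: \<^verbatim>\<open>theta(p q) = theta(p(0)) (p(-1) |> theta(q(0))) tau(p(-2), q(-1))\<close>.
\<close>

lemma product_sum_\<theta>:
  "product_sum \<theta> X n Y m = \<Delta> X (\<lambda>a z. \<theta> z n * ((\<lambda>X Y. act X (\<theta> Y m)) \<star> \<tau>) a Y)"
proof -
  have "product_sum \<theta> X n Y m =
      \<Lambda> X (\<lambda>p q. \<Lambda> Y (\<lambda>r s. \<Delta> q (\<lambda>q1 q2. \<Delta> s (\<lambda>t u. \<Delta> t (\<lambda>s1 s2.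
        \<omega> (p * r) (u * q2) (\<sigma> s2 q1 * act s1 n * m))))))"
    using product_sum_split[of \<omega>] by (simp add: \<omega>_simps \<theta>_def[abs_def])
  also have "\<dots> = \<Lambda> X (\<lambda>p q. \<Lambda> Y (\<lambda>r s. \<Delta> (p * r) (\<lambda>w w'. \<Delta> s (\<lambda>s1 s2. \<omega> (w' * s2) q n * \<omega> w s1 m))))"
    unfolding \<omega>_cocycle ..
  also have "\<dots> = \<Lambda> X (\<lambda>p q. \<Delta> p (\<lambda>a b. \<omega> b q n * \<Lambda> Y (\<lambda>r s. \<omega> (a * r) s m)))"
  proof (intro arg_cong[where f = "\<Lambda> X"] ext)
    fix p q
    define F where "F c w s1 = \<Delta> p (\<lambda>a b. \<omega> (b * w) q n * \<omega> (a * c) s1 m)" for c w s1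
    have d: "balanced_diamond (\<lambda>a b. \<omega> (b * w) q n * \<omega> (a * c) s1 m)" for w c s1
      by (rule diamondI) (simp_all add: \<omega>_simps ring_rules)
    have d': "balanced_diamond (\<lambda>w w'. \<Delta> s (\<lambda>s1 s2. \<omega> (w' * s2) q n * \<omega> w s1 m))" for s
      by (rule diamondI) (simp_all add: \<omega>_simps ring_rules sweedler_plus)
    have "\<Lambda> Y (\<lambda>r s. \<Delta> (p * r) (\<lambda>w w'. \<Delta> s (\<lambda>s1 s2. \<omega> (w' * s2) q n * \<omega> w s1 m))) =
      \<Lambda> Y (\<lambda>r s. \<Delta> r (\<lambda>c d. \<Delta> s (\<lambda>s1 s2. F c (d * s2) s1)))"
      unfolding coproduct_mult'[OF d'] F_def sweedler_swap[of "comult H p" "comult H _"] mult.assoc ..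
    also have "\<dots> = \<Lambda> Y (\<lambda>r s. F r 1 s)"
    proof (rule translation_collapse)
      fix c
      show "balanced_diamond (\<lambda>a w. F a w c)"
      proof (rule diamondI)
        fix b a w
        show "F (tg b * a) w c = F a (sr b * w) c"
          using takeuchi[OF d[of w a c], of p b] by (simp add: F_def mult.assoc)
      qed (simp_all add: F_def \<omega>_simps ring_rules sweedler_plus)
    next
      fix b a w c
      show "F (a * tg b) w c = F a w (tg b * c)"
        by (simp add: F_def mult.assoc[symmetric] \<omega>_simps)
    qed (simp_all add: F_def \<omega>_simps ring_rules sweedler_plus)
    also have "\<dots> = \<Delta> p (\<lambda>a b. \<omega> b q n * \<Lambda> Y (\<lambda>r s. \<omega> (a * r) s m))"
      unfolding F_def sweedler_mult_left[symmetric] sweedler_swap[of "comult H p" "plus_minus H Y"] by simp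
    finally show "\<Lambda> Y (\<lambda>r s. \<Delta> (p * r) (\<lambda>w w'. \<Delta> s (\<lambda>s1 s2. \<omega> (w' * s2) q n * \<omega> w s1 m))) =
      \<Delta> p (\<lambda>a b. \<omega> b q n * \<Lambda> Y (\<lambda>r s. \<omega> (a * r) s m))" .
  qed
  also have "\<dots> = \<Delta> X (\<lambda>a z. \<Lambda> z (\<lambda>b q. \<omega> b q n * \<Lambda> Y (\<lambda>r s. \<omega> (a * r) s m)))"
  proof (rule coproduct_plus_part)
    show "balanced_diamond (\<lambda>a b. \<omega> b q n * \<Lambda> Y (\<lambda>r s. \<omega> (a * r) s m))" for q
      by (rule diamondI) (simp_all add: \<omega>_simps ring_rules sweedler_plus sweedler_mult_left)
  qed (rule barI, simp_all add: \<omega>_simps ring_rules)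
  also have "\<dots> = \<Delta> X (\<lambda>a z. \<theta> z n * \<Lambda> Y (\<lambda>r s. \<omega> (a * r) s m))"
    by (simp add: \<theta>_def sweedler_mult_right)
  finally show ?thesis by (simp only: act_\<theta>_\<tau>)
qed

lemma product_term_balanced:
  assumes f: "balanced_bar bar f"
  shows "balanced_diamond (\<lambda>y1 y2. f W (\<sigma> y2 xm * (act y1 n * m)))"
  by (rule diamondI) (simp_all add: barD[OF f] act_simps \<sigma> ring_rules)

lemma product_sum_minus_balanced:
  assumes f: "balanced_bar bar f"
  shows "balanced_bar tg (\<lambda>yp ym. \<Delta> ym (\<lambda>y1 y2. f (xp * yp) (\<sigma> y2 xm * act y1 n * m)))"
proof (rule barI)
  note d = product_term_balanced[OF f]
  fix b y z
  have "f (xp * (y * tg b)) k = f (xp * y) (bar b * k)" for k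
    using barD(3)[OF f, of "xp * y"] by (simp add: mult.assoc)
  then show "\<Delta> z (\<lambda>y1 y2. f (xp * (y * tg b)) (\<sigma> y2 xm * act y1 n * m)) =
    \<Delta> (tg b * z) (\<lambda>y1 y2. f (xp * y) (\<sigma> y2 xm * act y1 n * m))"
    by (simp add: coproduct_tg_left d \<sigma> mult.assoc)
  show "\<Delta> (z + z') (\<lambda>y1 y2. f (xp * y) (\<sigma> y2 xm * act y1 n * m)) =
    \<Delta> z (\<lambda>y1 y2. f (xp * y) (\<sigma> y2 xm * act y1 n * m)) +
    \<Delta> z' (\<lambda>y1 y2. f (xp * y) (\<sigma> y2 xm * act y1 n * m))" for z'
    by (simp add: coproduct_add d mult.assoc)
qed (simp add: barD[OF f] distrib_left sweedler_plus)

lemma product_sum_plus_balanced: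
  assumes f: "balanced_bar bar f"
  shows "balanced_bar tg (\<lambda>xp xm. \<Lambda> Y (\<lambda>yp ym. \<Delta> ym (\<lambda>y1 y2. f (xp * yp) (\<sigma> y2 xm * act y1 n * m))))"
proof (rule barI)
  fix b xp xm
  note d = product_term_balanced[OF f]
  show "\<Lambda> Y (\<lambda>yp ym. \<Delta> ym (\<lambda>y1 y2. f (xp * tg b * yp) (\<sigma> y2 xm * act y1 n * m))) =
    \<Lambda> Y (\<lambda>yp ym. \<Delta> ym (\<lambda>y1 y2. f (xp * yp) (\<sigma> y2 (tg b * xm) * act y1 n * m)))"
    using translation_takeuchi[OF product_sum_minus_balanced[OF f, of xp xm n m], of Y b]
    by (simp add: mult.assoc coproduct_tg_right d \<sigma>)
qed (simp_all add: barD[OF f] \<sigma> distrib_left distrib_right sweedler_plus)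

lemma product_sum_balanced_right:
  assumes f: "balanced_bar bar f"
  shows "balanced_bar bar (product_sum f X n)"
proof (rule barI)
  note b = product_sum_minus_balanced[OF f]
  fix Y Y' b m m'
  show "product_sum f X n (Y + Y') m = product_sum f X n Y m + product_sum f X n Y' m"
    by (simp add: product_sum_def translation_add b sweedler_plus)
  show "product_sum f X n Y (m + m') = product_sum f X n Y m + product_sum f X n Y m'"
    by (simp add: product_sum_def barD[OF f] distrib_left sweedler_plus)
  note d = product_term_balanced[OF f]
  show "product_sum f X n (Y * tg b) m = product_sum f X n Y (bar b * m)"
    unfolding product_sum_def translation_tg_right[OF b]
    by (simp add: mult.assoc coproduct_sr_left d act_sr_left)
qed

lemma product_sum_balanced_left:
  assumes f: "balanced_bar bar f"
  shows "balanced_bar bar (\<lambda>X n. product_sum f X n Y m)"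
proof (rule barI)
  note b = product_sum_plus_balanced[OF f]
  fix X X' b n n'
  show "product_sum f (X + X') n Y m = product_sum f X n Y m + product_sum f X' n Y m"
    by (simp add: product_sum_def translation_add b)
  show "product_sum f X (n + n') Y m = product_sum f X n Y m + product_sum f X n' Y m"
    by (simp add: product_sum_def barD[OF f] act_plus distrib_left distrib_right sweedler_plus)
  note d = product_term_balanced[OF f]
  show "product_sum f (X * tg b) n Y m = product_sum f X (bar b * n) Y m"
    unfolding product_sum_def translation_tg_right[OF b] \<sigma>(3)[symmetric]
    using takeuchi[OF d] by (simp add: mult.assoc act_tg_right)
qed

lemma product_sum_one_left:
  assumes f: "balanced_bar bar f"
  shows "product_sum f 1 n Y m = \<Lambda> Y (\<lambda>p q. f p (act q n * m))"
proof -
  have "\<Delta> ym (\<lambda>y1 y2. f W (bar (ep y2) * (act y1 n * m))) = f W (act ym n * m)" for W ym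
    using counit_right_additive[of "\<lambda>y. f W (act y n * m)" ym]
    by (simp add: barD[OF f] act_add act_tg_left distrib_right mult.assoc)
  then show ?thesis
    unfolding product_sum_def translation_one[OF product_sum_plus_balanced[OF f]]
    by (simp add: mult.assoc)
qed

lemma product_sum_sr_left:
  assumes f: "balanced_bar bar f"
  shows "product_sum f (sr b) 1 Y m = f (sr b * Y) m"
proof -
  have a: "act y 1 = bar (ep y)" for y using act_bar[of y 1] by simp
  have "\<Delta> ym (\<lambda>y1 y2. f W (bar (ep y2) * (bar (ep y1) * m))) = f (W * tg (ep ym)) m" for W ym
    using counit_right_additive[of "\<lambda>y. f W (bar (ep y) * m)" ym]
    by (simp add: barD[OF f] bar_add ep_add ep_tg_left bar_mult distrib_right mult.assoc)
  then have "product_sum f (sr b) 1 Y m = \<Lambda> Y (\<lambda>p q. f (sr b * (p * tg (ep q))) m)"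
    unfolding product_sum_def translation_sr[OF product_sum_plus_balanced[OF f]]
    by (simp add: mult.assoc a)
  also have "\<dots> = f (sr b * Y) m"
    by (rule translation_counit) (simp add: barD[OF f] distrib_left)
  finally show ?thesis .
qed

lemma product_sum_one_right:
  assumes f: "balanced_bar bar f"
  shows "product_sum f X n 1 m = f X (n * m)"
proof -
  have d: "balanced_diamond (\<lambda>y1 y2. f W (\<sigma> y2 xm * act y1 n * m))" for W xm
    by (rule diamondI) (simp_all add: barD[OF f] act_simps \<sigma> ring_rules)
  have "product_sum f X n 1 m = \<Lambda> X (\<lambda>p q. f (p * tg (ep q)) (n * m))"
    unfolding product_sum_def translation_one[OF product_sum_minus_balanced[OF f]] coproduct_one[OF d]
    by (simp add: barD[OF f] mult.assoc)
  also have "\<dots> = f X (n * m)"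
    by (rule translation_counit) (simp add: barD[OF f])
  finally show ?thesis .
qed

lemma product_sum_sr_right:
  assumes f: "balanced_bar bar f"
  shows "product_sum f X n (sr b) 1 = f (X * sr b) n"
proof -
  have d: "balanced_diamond (\<lambda>y1 y2. f W (\<sigma> y2 xm * act y1 n))" for W xm
    by (rule diamondI) (simp_all add: barD[OF f] act_simps \<sigma> ring_rules)
  have "f (p * sr b) (bar (ep q) * n) = f (p * tg (ep q) * sr b) n" for p q
    using barD(3)[OF f, of "p * sr b"] by (simp add: mult.assoc tg_sr)
  then have "product_sum f X n (sr b) 1 = \<Lambda> X (\<lambda>p q. f (p * tg (ep q) * sr b) n)"
    using product_sum_minus_balanced[OF f, of _ _ n 1]
    by (simp add: product_sum_def translation_sr coproduct_one d)
  also have "\<dots> = f (X * sr b) n"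
    by (rule translation_counit) (simp add: barD[OF f] distrib_right)
  finally show ?thesis .
qed

end

lemma tensor_eq_cong:
  assumes "tensor_eq M ra N la S T"
    and "carrier N = carrier N'" "add N = add N'" "zero N = zero N'"
  shows "tensor_eq M ra N' la S T"
  using assms(1)
proof (induction rule: tensor_eq.induct)
  case (trans S T U)
  from trans.IH show ?case by (rule tensor_eq.trans)
qed (use assms(2-) in \<open>auto intro: tensor_eq.refl tensor_eq.sym tensor_eq.plus
  tensor_eq.zero_left[of _ N', simplified] tensor_eq.zero_right[of _ M ra N', simplified]
  tensor_eq.add_left tensor_eq.add_right[of _ M _ N', simplified] tensor_eq.balanced\<close>)

text \<open>
  The coaction is formed over the ring underlying the crossed product, morphisms refer to the comodule
  algebra; the two records differ, but not in the components that matter for the tensor product.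
\<close>

lemma tensor_class_cong:
  assumes "carrier N = carrier N'" "add N = add N'" "zero N = zero N'"
  shows "tensor_class M ra N la = tensor_class M ra N' la"
  unfolding tensor_class_def fun_eq_iff
  using tensor_eq_cong[OF _ assms] tensor_eq_cong[OF _ assms[symmetric]] by blast

section \<open>Crossed products\<close>

context twisted_system
begin

abbreviation "cp \<equiv> crossed_product H bar \<sigma> act"
abbreviation "pure X n \<equiv> bcls H bar {#(X, n)#}"

lemma crossed_product_simps:
  "carrier cp = carrier (tensor_bar H bar)" "add cp = add (tensor_bar H bar)" "zero cp = zero (tensor_bar H bar)"
  "one cp = pure 1 1" "unit_map cp b = pure (sr b) 1"
  "mult cp U V = bcls H bar (sweedler U (\<lambda>X n. sweedler V (\<lambda>Y m. product_sum (\<lambda>x k. {#(x, k)#}) X n Y m)))"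
  by (simp_all add: crossed_product_def crossed_ring_def Let_def ring.defs product_sum_def monoid.defs)

lemma pure_carrier [simp]: "pure X n \<in> carrier cp"
  by (simp add: crossed_product_simps bcls_carrier)

lemma mult_carrier [simp]: "U \<otimes>\<^bsub>cp\<^esub> V \<in> carrier cp"
  by (simp add: crossed_product_simps bcls_carrier)

lemma abelian_monoid_cp: "abelian_monoid cp"
proof -
  interpret T: abelian_monoid "tensor_bar H bar" by (rule abelian_monoid_tensor_bar)
  show ?thesis
    by (rule abelian_monoidI) (simp_all add: crossed_product_simps T.a_ac)
qed

lemma sweedler_pure: "balanced_bar bar f \<Longrightarrow> sweedler (pure X n) f = f X n"
  by (simp add: sweedler_bcls)

lemma sweedler_cp_mult:
  "balanced_bar bar f \<Longrightarrow> sweedler (U \<otimes>\<^bsub>cp\<^esub> V) f = sweedler U (\<lambda>X n. sweedler V (product_sum f X n))"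
  by (simp add: crossed_product_simps sweedler_bcls msum_sweedler product_sum_def[abs_def])

lemma sweedler_cp_add:
  assumes "balanced_bar bar f" "U \<in> carrier cp" "V \<in> carrier cp"
  shows "sweedler (U \<oplus>\<^bsub>cp\<^esub> V) f = sweedler U f + sweedler V f"
proof -
  have "U \<oplus>\<^bsub>cp\<^esub> V = bcls H bar (rep U + rep V)"
    using assms(2,3) by (simp add: crossed_product_simps bcls_plus[symmetric] bcls_rep)
  then show ?thesis by (simp add: sweedler_bcls assms(1)) (simp add: sweedler_msum)
qed

lemma cp_add_carrier: "U \<in> carrier cp \<Longrightarrow> V \<in> carrier cp \<Longrightarrow> U \<oplus>\<^bsub>cp\<^esub> V \<in> carrier cp"
  by (rule abelian_monoid.a_closed[OF abelian_monoid_cp])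

lemma cp_eqI:
  assumes "U \<in> carrier cp" "V \<in> carrier cp"
    "\<And>f :: 'l \<Rightarrow> 'n \<Rightarrow> 'k. balanced_bar bar f \<Longrightarrow> sweedler U f = sweedler V f"
  shows "U = V"
proof -
  have "bcls H bar (rep U) = bcls H bar (rep V)"
    by (rule bcls_eqI) (simp add: assms(3) sweedler_msum[symmetric])
  then show ?thesis using assms(1,2) by (simp add: crossed_product_simps bcls_rep)
qed

lemma pure_add: "pure (X + X') n = pure X n \<oplus>\<^bsub>cp\<^esub> pure X' n" "pure X (n + n') = pure X n \<oplus>\<^bsub>cp\<^esub> pure X n'"
  and pure_tg: "pure (X * tg b) n = pure X (bar b * n)"
proof -
  have *: "sweedler (pure (X + X') n) f = sweedler (pure X n \<oplus>\<^bsub>cp\<^esub> pure X' n) f"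
    "sweedler (pure X (n + n')) f = sweedler (pure X n \<oplus>\<^bsub>cp\<^esub> pure X n') f"
    "sweedler (pure (X * tg b) n) f = sweedler (pure X (bar b * n)) f"
    if f: "balanced_bar bar f" for f :: "'l \<Rightarrow> 'n \<Rightarrow> 'k"
    by (simp_all add: sweedler_cp_add[OF f] sweedler_pure[OF f] barD[OF f])
  show "pure (X + X') n = pure X n \<oplus>\<^bsub>cp\<^esub> pure X' n" "pure X (n + n') = pure X n \<oplus>\<^bsub>cp\<^esub> pure X n'"
    "pure (X * tg b) n = pure X (bar b * n)"
    by (rule cp_eqI; simp add: cp_add_carrier *)+
qed

lemma sweedler_pure_mult:
  "balanced_bar bar f \<Longrightarrow> sweedler (pure X n \<otimes>\<^bsub>cp\<^esub> pure Y m) f = product_sum f X n Y m"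
  by (simp add: sweedler_cp_mult sweedler_pure[OF product_sum_balanced_right]
      sweedler_pure[OF product_sum_balanced_left])

lemma sr_mult_pure: "pure (sr b) 1 \<otimes>\<^bsub>cp\<^esub> pure X n = pure (sr b * X) n"
  by (rule cp_eqI) (simp_all add: sweedler_pure_mult sweedler_pure product_sum_sr_left)

text \<open>
  Balanced maps on the diamond product of L with the crossed product, on which coactions are evaluated.
\<close>

definition bilinear_on_cp :: "('l \<Rightarrow> ('l \<times> 'n) multiset set \<Rightarrow> 'a::ab_group_add) \<Rightarrow> bool"
  where "bilinear_on_cp g \<longleftrightarrow>
    balanced_map type_ring (\<lambda>X b. tg b * X) cp (\<lambda>b p. unit_map cp b \<otimes>\<^bsub>cp\<^esub> p) g"

abbreviation cp_class where "cp_class \<equiv> dcls H cp (\<lambda>b p. unit_map cp b \<otimes>\<^bsub>cp\<^esub> p)"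

interpretation ct: vector_tensor_product type_ring "\<lambda>X b. tg b * X" cp "\<lambda>b p. unit_map cp b \<otimes>\<^bsub>cp\<^esub> p" "lscale H"
  by (intro vector_tensor_product.intro tensor_product.intro vector_tensor_product_axioms.intro
      abelian_monoid_type_ring abelian_monoid_cp vector_space_lscale) (simp_all add: lscale_right)

lemma sweedler_cp_class:
  "set_mset S \<subseteq> UNIV \<times> carrier cp \<Longrightarrow> bilinear_on_cp g \<Longrightarrow> sweedler (cp_class S) g = msum g S"
  unfolding dcls_def bilinear_on_cp_def by (rule ct.sweedler_cls) simp_all

lemma cp_class_eqI:
  assumes "set_mset S \<subseteq> UNIV \<times> carrier cp" "set_mset T \<subseteq> UNIV \<times> carrier cp"
    "\<And>g :: 'l \<Rightarrow> ('l \<times> 'n) multiset set \<Rightarrow> 'k. bilinear_on_cp g \<Longrightarrow> msum g S = msum g T"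
  shows "cp_class S = cp_class T"
  unfolding dcls_def
  by (subst ct.cls_eq_iff, simp add: assms, rule ct.teq_if_functionals_agree)
    (simp_all add: assms bilinear_on_cp_def)

lemma coaction_class:
  "coaction cp U = cp_class (sweedler U (\<lambda>X n. \<Delta> X (\<lambda>X1 X2. {#(X1, pure X2 n)#})))"
proof -
  have la: "(\<lambda>b p. bcls H bar {#(sr b, 1)#} \<otimes>\<^bsub>crossed_ring H bar \<sigma> act\<^esub> p) = (\<lambda>b p. unit_map cp b \<otimes>\<^bsub>cp\<^esub> p)"
    by (simp add: crossed_product_def Let_def ring.defs monoid.defs)
  have "coaction cp U = dcls H (crossed_ring H bar \<sigma> act) (\<lambda>b p. bcls H bar {#(sr b, 1)#} \<otimes>\<^bsub>crossed_ring H bar \<sigma> act\<^esub> p)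
      (sweedler U (\<lambda>X n. \<Delta> X (\<lambda>X1 X2. {#(X1, pure X2 n)#})))"
    by (simp add: crossed_product_def Let_def ring.defs monoid.defs)
  also have "\<dots> = cp_class (sweedler U (\<lambda>X n. \<Delta> X (\<lambda>X1 X2. {#(X1, pure X2 n)#})))"
    unfolding la dcls_def
    by (rule fun_cong[OF tensor_class_cong])
      (simp_all add: crossed_product_def Let_def ring.defs monoid.defs)
  finally show ?thesis .
qed

lemma coaction_set: "set_mset (sweedler U (\<lambda>X n. \<Delta> X (\<lambda>X1 X2. {#(X1, pure X2 n)#}))) \<subseteq> UNIV \<times> carrier cp"
  by (auto simp: sweedler_def)

lemma rep_coaction_set: "set_mset (rep (coaction cp U)) \<subseteq> UNIV \<times> carrier cp"
  using ct.teq_carrier[OF ct.rep_cls] coaction_set[of U] unfolding coaction_class dcls_def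
  by simp

lemma coaction_rep: "cp_class (rep (coaction cp U)) = coaction cp U"
proof -
  have "coaction cp U \<in> carrier (tensor type_ring (\<lambda>X b. tg b * X) cp (\<lambda>b p. unit_map cp b \<otimes>\<^bsub>cp\<^esub> p))"
    unfolding coaction_class dcls_def using coaction_set by (simp add: tensor_def)
  from ct.cls_rep(2)[OF this] show ?thesis by (simp add: dcls_def)
qed

lemma sweedler_coaction:
  "bilinear_on_cp g \<Longrightarrow> sweedler (coaction cp U) g = sweedler U (\<lambda>X n. \<Delta> X (\<lambda>x z. g x (pure z n)))"
  unfolding coaction_class by (simp add: sweedler_cp_class coaction_set msum_sweedler)

lemma bilinear_on_cp_pure:
  assumes "bilinear_on_cp g"
  shows "balanced_diamond (\<lambda>x z. g x (pure z n))" "balanced_bar bar (\<lambda>z n. g x (pure z n))"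
  using assms unfolding bilinear_on_cp_def balanced_map_def
  by (auto intro!: diamondI barI simp: pure_add pure_tg crossed_product_simps(5) sr_mult_pure)

text \<open>
  Morphisms are arbitrary functions on classes; composed with an additive map to a group they are
  determined by their values on pure tensors.
\<close>

lemma functional_bcls:
  fixes F :: "('l \<times> 'n) multiset set \<Rightarrow> 'a::ab_group_add"
  assumes "\<And>p q. p \<in> carrier cp \<Longrightarrow> q \<in> carrier cp \<Longrightarrow> F (p \<oplus>\<^bsub>cp\<^esub> q) = F p + F q"
  shows "F (bcls H bar S) = msum (\<lambda>X n. F (pure X n)) S"
proof (induction S)
  case empty
  have "bcls H bar {#} = bcls H bar {#} \<oplus>\<^bsub>cp\<^esub> bcls H bar {#}"
    by (simp add: crossed_product_simps bcls_plus)
  then have "F (bcls H bar {#}) = F (bcls H bar {#}) + F (bcls H bar {#})"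
    using assms[of "bcls H bar {#}" "bcls H bar {#}"] by (simp add: crossed_product_simps bcls_carrier)
  then show ?case by simp
next
  case (add p S)
  have "bcls H bar (add_mset p S) = pure (fst p) (snd p) \<oplus>\<^bsub>cp\<^esub> bcls H bar S"
    by (simp add: crossed_product_simps bcls_plus)
  then show ?case
    using add assms[of "pure (fst p) (snd p)" "bcls H bar S"]
    by (simp only: msum_add_mset pure_carrier) (simp add: crossed_product_simps bcls_carrier)
qed

lemma functional_sweedler:
  fixes F :: "('l \<times> 'n) multiset set \<Rightarrow> 'a::ab_group_add"
  assumes "\<And>p q. p \<in> carrier cp \<Longrightarrow> q \<in> carrier cp \<Longrightarrow> F (p \<oplus>\<^bsub>cp\<^esub> q) = F p + F q" "U \<in> carrier cp"
  shows "F U = sweedler U (\<lambda>X n. F (pure X n))"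
  using functional_bcls[of F "rep U", OF assms(1)] bcls_rep[of U bar] assms(2)
  by (simp add: sweedler_msum crossed_product_simps)

end

section \<open>Morphisms of crossed products\<close>

locale two_systems = bar_hopf_algebroid H sN bar + A: twisted_system H sN bar \<sigma> \<tau> act + B: twisted_system H sN bar \<sigma>' \<tau>' act'
  for H :: "('k::field, 'b::{ring,monoid_mult}, 'l::{ring,monoid_mult}, 'z) bialgebroid_scheme"
    and sN :: "'k \<Rightarrow> 'n::{ring,monoid_mult} \<Rightarrow> 'n" and bar :: "'b \<Rightarrow> 'n"
    and \<sigma> \<tau> act \<sigma>' \<tau>' act'
begin

lemma homD:
  assumes "\<phi> \<in> comodule_algebra_hom H A.cp B.cp"
  shows "p \<in> carrier A.cp \<Longrightarrow> \<phi> p \<in> carrier B.cp"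
    "p \<in> carrier A.cp \<Longrightarrow> q \<in> carrier A.cp \<Longrightarrow> \<phi> (p \<oplus>\<^bsub>A.cp\<^esub> q) = \<phi> p \<oplus>\<^bsub>B.cp\<^esub> \<phi> q"
    "p \<in> carrier A.cp \<Longrightarrow> q \<in> carrier A.cp \<Longrightarrow> \<phi> (p \<otimes>\<^bsub>A.cp\<^esub> q) = \<phi> p \<otimes>\<^bsub>B.cp\<^esub> \<phi> q"
    "\<phi> \<one>\<^bsub>A.cp\<^esub> = \<one>\<^bsub>B.cp\<^esub>" "\<phi> (unit_map A.cp b) = unit_map B.cp b"
    "p \<in> carrier A.cp \<Longrightarrow> coaction B.cp (\<phi> p) = B.cp_class (sweedler (coaction A.cp p) (\<lambda>X p0. {#(X, \<phi> p0)#}))"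
  using assms unfolding comodule_algebra_hom_def ring_hom_def by auto

lemma hom_coaction_set:
  assumes "\<phi> \<in> comodule_algebra_hom H A.cp B.cp"
  shows "set_mset (sweedler (coaction A.cp p) (\<lambda>X p0. {#(X, \<phi> p0)#})) \<subseteq> UNIV \<times> carrier B.cp"
  using A.rep_coaction_set[of p] homD(1)[OF assms] by (auto simp: sweedler_def)

lemma sweedler_coaction_hom:
  assumes \<phi>: "\<phi> \<in> comodule_algebra_hom H A.cp B.cp" and p: "p \<in> carrier A.cp" and g: "B.bilinear_on_cp g"
  shows "sweedler (coaction B.cp (\<phi> p)) g = sweedler (coaction A.cp p) (\<lambda>X p0. g X (\<phi> p0))"
  by (simp add: homD(6)[OF \<phi> p] B.sweedler_cp_class hom_coaction_set[OF \<phi>] g msum_sweedler)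

lemma hom_bilinear:
  assumes \<phi>: "\<phi> \<in> comodule_algebra_hom H A.cp B.cp" and g: "B.bilinear_on_cp g"
  shows "A.bilinear_on_cp (\<lambda>X p. g X (\<phi> p))"
proof -
  have "unit_map A.cp b \<in> carrier A.cp" for b by (simp add: A.crossed_product_simps(5))
  then show ?thesis
    using g B.mult_carrier unfolding A.bilinear_on_cp_def B.bilinear_on_cp_def balanced_map_def
    by (simp add: homD[OF \<phi>])
qed

text \<open>
  Colinearity of \<phi> in the form in which it is used.
\<close>

lemma sweedler_hom:
  assumes \<phi>: "\<phi> \<in> comodule_algebra_hom H A.cp B.cp" and p: "p \<in> carrier A.cp" and g: "B.bilinear_on_cp g"
  shows "sweedler (\<phi> p) (\<lambda>X n. \<Delta> X (\<lambda>x z. g x (B.pure z n))) =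
    sweedler p (\<lambda>X n. \<Delta> X (\<lambda>x z. g x (\<phi> (A.pure z n))))"
  using sweedler_coaction_hom[OF assms] B.sweedler_coaction[OF g] A.sweedler_coaction[OF hom_bilinear[OF \<phi> g]]
  by simp

lemma inverse_hom:
  assumes "\<phi> \<in> comodule_algebra_iso H A.cp B.cp"
  shows "inv_into (carrier A.cp) \<phi> \<in> comodule_algebra_hom H B.cp A.cp"
proof -
  have \<phi>: "\<phi> \<in> comodule_algebra_hom H A.cp B.cp" and bij: "bij_betw \<phi> (carrier A.cp) (carrier B.cp)"
    using assms by (auto simp: comodule_algebra_iso_def)
  let ?\<psi> = "inv_into (carrier A.cp) \<phi>"
  note hom = homD[OF \<phi>]
  have \<psi>: "?\<psi> q \<in> carrier A.cp" "\<phi> (?\<psi> q) = q" if "q \<in> carrier B.cp" for q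
    using bij that by (auto simp: bij_betw_def inv_into_into f_inv_into_f)
  have \<psi>\<phi>: "?\<psi> (\<phi> p) = p" if "p \<in> carrier A.cp" for p
    using bij that by (simp add: bij_betw_def inv_into_f_f)
  have add: "?\<psi> (p \<oplus>\<^bsub>B.cp\<^esub> q) = ?\<psi> p \<oplus>\<^bsub>A.cp\<^esub> ?\<psi> q"
    if "p \<in> carrier B.cp" "q \<in> carrier B.cp" for p q
    using \<psi>\<phi>[of "?\<psi> p \<oplus>\<^bsub>A.cp\<^esub> ?\<psi> q"] that by (simp add: hom \<psi> A.cp_add_carrier)
  have mult: "?\<psi> (p \<otimes>\<^bsub>B.cp\<^esub> q) = ?\<psi> p \<otimes>\<^bsub>A.cp\<^esub> ?\<psi> q"
    if "p \<in> carrier B.cp" "q \<in> carrier B.cp" for p q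
    using \<psi>\<phi>[of "?\<psi> p \<otimes>\<^bsub>A.cp\<^esub> ?\<psi> q"] that by (simp add: hom \<psi>)
  have u: "unit_map A.cp b \<in> carrier A.cp" "unit_map B.cp b \<in> carrier B.cp" "\<one>\<^bsub>A.cp\<^esub> \<in> carrier A.cp" for b
    by (simp_all add: A.crossed_product_simps(4,5) B.crossed_product_simps(5))
  have unit: "?\<psi> (unit_map B.cp b) = unit_map A.cp b" "?\<psi> \<one>\<^bsub>B.cp\<^esub> = \<one>\<^bsub>A.cp\<^esub>" for b
    using \<psi>\<phi>[OF u(1)] \<psi>\<phi>[OF u(3)] by (simp_all add: hom)
  have "coaction A.cp (?\<psi> q) = A.cp_class (sweedler (coaction B.cp q) (\<lambda>X q0. {#(X, ?\<psi> q0)#}))"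
    if q: "q \<in> carrier B.cp" for q
  proof -
    let ?p = "?\<psi> q"
    have "A.cp_class (rep (coaction A.cp ?p)) = A.cp_class (sweedler (coaction B.cp q) (\<lambda>X q0. {#(X, ?\<psi> q0)#}))"
    proof (rule A.cp_class_eqI[OF A.rep_coaction_set])
      show "set_mset (sweedler (coaction B.cp q) (\<lambda>X q0. {#(X, ?\<psi> q0)#})) \<subseteq> UNIV \<times> carrier A.cp"
        using B.rep_coaction_set[of q] \<psi> by (auto simp: sweedler_def)
      fix g :: "'l \<Rightarrow> ('l \<times> 'n) multiset set \<Rightarrow> 'k" assume g: "A.bilinear_on_cp g"
      then have "B.bilinear_on_cp (\<lambda>X q. g X (?\<psi> q))"
        unfolding A.bilinear_on_cp_def B.bilinear_on_cp_def balanced_map_def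
        by (simp add: \<psi> add mult u unit)
      from sweedler_coaction_hom[OF \<phi> \<psi>(1)[OF q] this]
      have "sweedler (coaction B.cp q) (\<lambda>X q. g X (?\<psi> q)) = sweedler (coaction A.cp ?p) (\<lambda>X p0. g X (?\<psi> (\<phi> p0)))"
        by (simp add: \<psi> q)
      also have "\<dots> = msum g (rep (coaction A.cp ?p))"
        unfolding sweedler_msum using A.rep_coaction_set[of ?p] by (intro msum_cong) (auto simp: \<psi>\<phi>)
      finally show "msum g (rep (coaction A.cp ?p)) = msum g (sweedler (coaction B.cp q) (\<lambda>X q0. {#(X, ?\<psi> q0)#}))"
        by (simp add: msum_sweedler)
    qed
    then show ?thesis by (simp add: A.coaction_rep)
  qed
  then show ?thesis
    unfolding comodule_algebra_hom_def ring_hom_def by (simp add: \<psi> add mult unit)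
qed

end

section \<open>The second family of generators\<close>

context twisted_system
begin

text \<open>
  The value of G on the element \<^verbatim>\<open>e(X) = X(1)+ (x) tau(X(1)-, X(2))\<close>.
\<close>

definition esum :: "'l \<Rightarrow> ('l \<Rightarrow> 'n \<Rightarrow> 'a::ab_group_add) \<Rightarrow> 'a"
  where "esum X G = \<Delta> X (\<lambda>x y. \<Lambda> x (\<lambda>p q. G p (\<tau> q y)))"

lemma esum_bar: "balanced_bar bar G \<Longrightarrow> balanced_bar tg (\<lambda>p q. G p (\<tau> q y))"
  by (rule barI) (simp_all add: barD[of bar G] \<tau>)

lemma esum_bal:
  assumes G: "balanced_bar bar G"
  shows "balanced_diamond (\<lambda>x y. \<Lambda> x (\<lambda>p q. G p (\<tau> q y)))"
  by (rule diamondI) (simp_all add: translation_add translation_tg_left esum_bar[OF G] \<tau> barD[OF G] sweedler_plus)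

lemma esum_simps:
  assumes G: "balanced_bar bar G"
  shows "esum (X + Y) G = esum X G + esum Y G" "esum (sr b * X) G = esum X (\<lambda>p. G (sr b * p))"
    "esum (tg b * X) G = esum X (\<lambda>p. G (tg b * p))" "esum (X * sr b) G = esum X (\<lambda>p. G (p * sr b))"
  using translation_takeuchi[OF esum_bar[OF G]]
  by (simp_all add: esum_def coproduct_add coproduct_sr_left coproduct_tg_left coproduct_sr_right esum_bal[OF G]
      translation_sr_left translation_sr_right esum_bar[OF G] \<tau>(4)[symmetric])

text \<open>
  The elements e(X) are colinear: \<^verbatim>\<open>e(X)\<close> has coaction \<^verbatim>\<open>X(1) (x) e(X(2))\<close>.
\<close>

lemma esum_coproduct:
  fixes G :: "'l \<Rightarrow> 'l \<Rightarrow> 'n \<Rightarrow> 'a::ab_group_add"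
  assumes d: "\<And>l. balanced_diamond (\<lambda>a z. G a z l)" and b: "\<And>a. balanced_bar bar (G a)"
  shows "esum X (\<lambda>p l. \<Delta> p (\<lambda>a z. G a z l)) = \<Delta> X (\<lambda>a w. esum w (G a))"
proof -
  note G = diamondD[OF d] barD[OF b]
  note eb = esum_bar[OF b]
  have 1: "\<Lambda> x (\<lambda>p q. \<Delta> p (\<lambda>a z. G a z (\<tau> q y))) = \<Delta> x (\<lambda>a w. \<Lambda> w (\<lambda>z q. G a z (\<tau> q y)))" for x y
    by (rule coproduct_plus_part[OF d eb])
  have "balanced3 (\<lambda>a w y. \<Lambda> w (\<lambda>z q. G a z (\<tau> q y)))"
    by (rule balanced3I) (simp_all add: G \<tau> translation_add translation_sr_left translation_tg_left eb sweedler_plus)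
  from coassociativity[OF this] show ?thesis by (simp add: esum_def 1)
qed

lemma esum_\<theta>: "esum X \<theta> = bar (ep X)"
  by (simp add: esum_def \<theta>_unit)

lemma esum_mult_left: "esum X (\<lambda>p l. c * G p l) = c * (esum X G :: 'n)"
  and esum_mult_right: "esum X (\<lambda>p l. G p l * c) = esum X G * (c :: 'n)"
  by (simp_all add: esum_def sweedler_mult_left sweedler_mult_right)

lemma esum_sweedler: "esum X (\<lambda>p l. sweedler U (\<lambda>u v. G u v p l)) = sweedler U (\<lambda>u v. esum X (G u v))"
proof -
  have "\<Delta> X (\<lambda>x y. \<Lambda> x (\<lambda>p q. sweedler U (\<lambda>u v. G u v p (\<tau> q y)))) =
    \<Delta> X (\<lambda>x y. sweedler U (\<lambda>u v. \<Lambda> x (\<lambda>p q. G u v p (\<tau> q y))))"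
    by (intro arg_cong[where f = "\<Delta> X"] ext sweedler_swap)
  also have "\<dots> = sweedler U (\<lambda>u v. \<Delta> X (\<lambda>x y. \<Lambda> x (\<lambda>p q. G u v p (\<tau> q y))))"
    by (rule sweedler_swap)
  finally show ?thesis by (simp add: esum_def)
qed

lemma esum_additive:
  assumes "\<And>a b. h (a + b) = h a + (h b :: 'e::ab_group_add)"
  shows "h (esum X G) = esum X (\<lambda>p l. h (G p l))"
  using assms by (simp add: esum_def sweedler_additive[of h])

lemma \<theta>_mult_right: "\<theta> p (l * n) = \<Delta> p (\<lambda>a z. \<theta> z l * act a n)"
proof -
  have "\<theta> p (l * n) = \<Delta> p (\<lambda>a z. \<theta> z l * ((\<lambda>X Y. act X (\<theta> Y n)) \<star> \<tau>) a 1)"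
    using product_sum_\<theta>[of p l 1 n] product_sum_one_right[OF \<theta>_bar] by simp
  moreover have "((\<lambda>X Y. act X (\<theta> Y n)) \<star> \<tau>) a 1 = act a n" for a
    unfolding act_\<theta>_\<tau>
    by (subst translation_one) (auto intro!: barI simp: \<omega>_simps distrib_left mult.assoc[symmetric] \<omega>_right_one)
  ultimately show ?thesis by simp
qed

lemma product_sum_\<theta>_sr: "product_sum \<theta> (sr b) 1 = (\<lambda>Y m. \<theta> Y m * bar b)"
  by (simp add: fun_eq_iff product_sum_sr_left[OF \<theta>_bar] \<theta>_simps)

lemma product_sum_\<theta>_one: "product_sum \<theta> 1 n = (\<lambda>Y m. n * \<theta> Y m)"
proof (intro ext)
  fix Y m
  have "balanced_diamond (\<lambda>a z. \<theta> z n * \<Lambda> Y (\<lambda>r s. \<omega> (a * r) s m))"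
    by (rule diamondI) (simp_all add: \<theta>_simps \<omega>_simps distrib_left distrib_right sweedler_plus sweedler_mult_left mult.assoc)
  then show "product_sum \<theta> 1 n Y m = n * \<theta> Y m"
    unfolding product_sum_\<theta> act_\<theta>_\<tau> by (simp add: coproduct_one \<theta>_one \<theta>_def[of Y])
qed

lemma sweedler_pure_left:
  assumes f: "balanced_bar bar f"
  shows "sweedler (pure X n \<otimes>\<^bsub>cp\<^esub> V) f = sweedler V (product_sum f X n)"
  unfolding sweedler_cp_mult[OF f]
  by (subst sweedler_swap) (simp add: sweedler_pure[OF product_sum_balanced_left[OF f]])

lemma sweedler_pure_right:
  assumes f: "balanced_bar bar f"
  shows "sweedler (U \<otimes>\<^bsub>cp\<^esub> pure Y m) f = sweedler U (\<lambda>X n. product_sum f X n Y m)"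
  unfolding sweedler_cp_mult[OF f] by (simp add: sweedler_pure[OF product_sum_balanced_right[OF f]])

text \<open>
  The form in which the second factor enters the coordinates of a product.  It is balanced in a and y
  against left multiplication in N and right multiplication of m, as \<open>K_colinear\<close> requires.
\<close>

definition act_\<tau> :: "'l \<Rightarrow> 'l \<Rightarrow> 'n \<Rightarrow> 'n"
  where "act_\<tau> a y m = \<Delta> a (\<lambda>a1 a2. act a2 m * \<tau> a1 y)"

lemma act_\<tau>_simps:
  "act_\<tau> (a + a') y m = act_\<tau> a y m + act_\<tau> a' y m" "act_\<tau> a (y + y') m = act_\<tau> a y m + act_\<tau> a y' m"
  "act_\<tau> a y (m + m') = act_\<tau> a y m + act_\<tau> a y m'" "act_\<tau> (tg b * a) y m = bar b * act_\<tau> a y m"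
  "act_\<tau> a (tg b * y) m = act_\<tau> a y (m * bar b)"
proof -
  have d: "balanced_diamond (\<lambda>a1 a2. act a2 m * \<tau> a1 y)" for m y
    by (rule balanced_product[OF left_linear_act \<tau>_linear])
  show "act_\<tau> (a + a') y m = act_\<tau> a y m + act_\<tau> a' y m" "act_\<tau> a (y + y') m = act_\<tau> a y m + act_\<tau> a y' m"
    "act_\<tau> a y (m + m') = act_\<tau> a y m + act_\<tau> a y m'" "act_\<tau> (tg b * a) y m = bar b * act_\<tau> a y m"
    "act_\<tau> a (tg b * y) m = act_\<tau> a y (m * bar b)"
    using takeuchi[OF d[of m y], of a b]
    by (simp_all add: act_\<tau>_def coproduct_add coproduct_tg_left d \<tau> act_plus act_tg_left act_sr_right
        distrib_left distrib_right sweedler_plus sweedler_mult_left[symmetric] mult.assoc)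
qed

lemma conv_act_\<tau>: "((\<lambda>X Y. act X (g Y)) \<star> \<tau>) a Y = \<Delta> Y (\<lambda>y1 y2. act_\<tau> a y1 (g y2))"
  by (simp add: conv_swap act_\<tau>_def)

lemma esum_plus: "esum X (\<lambda>p l. F p l + G p l) = esum X F + esum X G"
  by (simp add: esum_def sweedler_plus)

lemma esum_esum:
  assumes G: "balanced_bar bar G" "\<And>b p l. G (sr b * p) l = G p l * bar b"
    and N: "\<And>a a' y m. N (a + a') y m = N a y m + N a' y m" "\<And>a y y' m. N a (y + y') m = N a y m + N a y' m"
      "\<And>a y m m'. N a y (m + m') = N a y m + N a y m'" "\<And>b a y m. N (tg b * a) y m = bar b * N a y m"
      "\<And>b a y m. N a (tg b * y) m = N a y (m * bar b)"
  shows "esum X (\<lambda>p l. esum Y (\<lambda>r k. \<Delta> p (\<lambda>a z. G z l * \<Delta> r (\<lambda>y1 y2. N a y1 (G y2 k))))) =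
    \<Delta> X (\<lambda>a w. esum w G * \<Delta> Y (\<lambda>y1 y2. N a y1 (esum y2 G)))"
proof -
  note Gb = barD[OF G(1)] G(2)
  have "esum Y (\<lambda>r k. \<Delta> r (\<lambda>y1 y2. N a y1 (G y2 k))) = \<Delta> Y (\<lambda>y1 y2. esum y2 (\<lambda>y2 k. N a y1 (G y2 k)))" for a
    by (rule esum_coproduct) (auto intro!: diamondI barI simp: Gb N)
  then have 1: "esum Y (\<lambda>r k. \<Delta> r (\<lambda>y1 y2. N a y1 (G y2 k))) = \<Delta> Y (\<lambda>y1 y2. N a y1 (esum y2 G))" for a
    by (simp add: esum_additive[of "N a _"] N)
  have "esum X (\<lambda>p l. \<Delta> p (\<lambda>a z. G z l * \<Delta> Y (\<lambda>y1 y2. N a y1 (esum y2 G)))) =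
    \<Delta> X (\<lambda>a w. esum w (\<lambda>z l. G z l * \<Delta> Y (\<lambda>y1 y2. N a y1 (esum y2 G))))"
    by (rule esum_coproduct)
      (auto intro!: diamondI barI simp: Gb N distrib_left distrib_right sweedler_plus sweedler_mult_left mult.assoc)
  then show ?thesis by (simp add: esum_sweedler esum_mult_left esum_mult_right 1)
qed

lemma product_sum_\<theta>_sr_left: "product_sum \<theta> (sr b * X) n Y m = product_sum \<theta> X n Y m * bar b"
  unfolding product_sum_def translation_sr_left[OF product_sum_plus_balanced[OF \<theta>_bar]]
  by (simp add: \<theta>_simps sweedler_mult_right[symmetric] mult.assoc)

lemma product_sum_sr_middle:
  assumes f: "balanced_bar bar f"
  shows "product_sum f (X * sr b) n Y m = product_sum f X n (sr b * Y) m"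
  unfolding product_sum_def translation_sr_right[OF product_sum_plus_balanced[OF f]]
    translation_sr_left[OF product_sum_minus_balanced[OF f]]
  by (simp add: mult.assoc)

text \<open>
  The coordinates of \<^verbatim>\<open>e(X) e(Y)\<close>.
\<close>

lemma esum_product_\<theta>: "esum X (\<lambda>p l. esum Y (\<lambda>r k. product_sum \<theta> p l r k)) = \<tau> X Y"
proof -
  have "esum X (\<lambda>p l. esum Y (\<lambda>r k. product_sum \<theta> p l r k)) =
    \<Delta> X (\<lambda>a w. esum w \<theta> * \<Delta> Y (\<lambda>y1 y2. act_\<tau> a y1 (esum y2 \<theta>)))"
    unfolding product_sum_\<theta> conv_act_\<tau>
    by (rule esum_esum) (simp_all add: \<theta>_bar \<theta>_simps act_\<tau>_simps)
  also have "\<dots> = \<Delta> X (\<lambda>a w. bar (ep w) * (conv_unit \<star> \<tau>) a Y)"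
  proof -
    have "(\<lambda>X Y. act X (bar (ep Y))) = conv_unit"
      by (simp add: fun_eq_iff conv_unit_def act_bar ep_mult_sr)
    then show ?thesis by (simp add: esum_\<theta> conv_act_\<tau>[symmetric])
  qed
  also have "\<dots> = \<tau> X Y"
    by (simp add: conv_unit_left \<tau>_balanced counit_conv_left \<tau>_linear)
  finally show ?thesis .
qed

end

section \<open>From morphisms to cochains\<close>

locale crossed_morphism = two_systems H sN bar \<sigma> \<tau> act \<sigma>' \<tau>' act'
  for H :: "('k::field, 'b::{ring,monoid_mult}, 'l::{ring,monoid_mult}, 'z) bialgebroid_scheme"
    and sN :: "'k \<Rightarrow> 'n::{ring,monoid_mult} \<Rightarrow> 'n" and bar :: "'b \<Rightarrow> 'n"
    and \<sigma> \<tau> act \<sigma>' \<tau>' act' +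
  fixes \<phi>
  assumes \<phi>: "\<phi> \<in> comodule_algebra_hom H A.cp B.cp"
    and \<phi>_base: "\<phi> (A.pure 1 n) = B.pure 1 n"
begin

lemmas hom = homD[OF \<phi>]

text \<open>
  The coordinate functional of the target, pulled back along \<phi>.
\<close>

definition K :: "'l \<Rightarrow> 'n \<Rightarrow> 'n"
  where "K X n = sweedler (\<phi> (A.pure X n)) B.\<theta>"

lemma K_sweedler:
  assumes "p \<in> carrier A.cp" shows "sweedler (\<phi> p) B.\<theta> = sweedler p K"
  unfolding K_def
  by (rule A.functional_sweedler[of "\<lambda>p. sweedler (\<phi> p) B.\<theta>", OF _ assms])
    (simp add: hom B.sweedler_cp_add[OF B.\<theta>_bar])

lemma K_bar: "balanced_bar bar K"
  by (rule barI) (simp_all add: K_def A.pure_add A.pure_tg hom B.sweedler_cp_add[OF B.\<theta>_bar])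

lemmas K_bal = barD[OF K_bar]

lemma K_product: "A.product_sum K X n Y m = sweedler (\<phi> (A.pure X n) \<otimes>\<^bsub>B.cp\<^esub> \<phi> (A.pure Y m)) B.\<theta>"
  using K_sweedler[of "A.pure X n \<otimes>\<^bsub>A.cp\<^esub> A.pure Y m"]
  by (simp add: hom A.sweedler_pure_mult K_bar)

lemma \<phi>_sr: "\<phi> (A.pure (sr b) 1) = B.pure (sr b) 1"
  using hom(5)[of b] by (simp add: A.crossed_product_simps(5) B.crossed_product_simps(5))

text \<open>
  \<phi> is the identity on N, hence left N-linear, and \<theta> is left N-linear as well.
\<close>

lemma K_left: "m * K p l = \<Lambda> p (\<lambda>p' q'. K p' (act q' m * l))"
  using K_product[of 1 m p l] unfolding \<phi>_base
  by (simp add: A.product_sum_one_left[OF K_bar] B.sweedler_pure_left[OF B.\<theta>_bar] B.product_sum_\<theta>_one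
      sweedler_mult_left) (simp add: K_def)

lemma K_sr: "K (sr b * X) n = K X n * bar b"
  using K_product[of "sr b" 1 X n] unfolding \<phi>_sr
  by (simp add: A.product_sum_sr_left[OF K_bar] B.sweedler_pure_left[OF B.\<theta>_bar]
      B.product_sum_\<theta>_sr sweedler_mult_right) (simp add: K_def)

lemma K_tg: "K (tg b * X) n = bar b * K X n"
proof -
  have "bar b * K X n = \<Lambda> X (\<lambda>p q. K (p * tg (ep (q * sr b))) n)"
    unfolding K_left[of "bar b"] by (simp add: A.act_bar K_bal)
  also have "\<dots> = \<Lambda> (tg b * X) (\<lambda>p q. K (p * tg (ep q)) n)"
  proof -
    have "balanced_bar tg (\<lambda>p q. K (p * tg (ep q)) n)"
      by (rule barI) (simp_all add: K_bal ep_add tg_add ep_tg_left tg_mult distrib_left distrib_right bar_add bar_mult mult.assoc)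
    from translation_tg_left[OF this] show ?thesis ..
  qed
  also have "\<dots> = K (tg b * X) n" by (rule translation_counit) (simp add: K_bal)
  finally show ?thesis ..
qed

lemma K_sr_right: "K (X * sr b) n = K X (n * bar b)"
  using K_product[of X n "sr b" 1] K_product[of X n 1 "bar b"] unfolding \<phi>_sr \<phi>_base
  by (simp add: A.product_sum_sr_right[OF K_bar] A.product_sum_one_right[OF K_bar]
      B.sweedler_pure_right[OF B.\<theta>_bar] B.product_sum_sr_right[OF B.\<theta>_bar]
      B.product_sum_one_right[OF B.\<theta>_bar] B.\<theta>_simps)

text \<open>
  The coordinates of \<phi> at p are those of the coaction of p; this replaces any explicit knowledge of a
  formal sum representing the image under \<phi>.
\<close>

lemma K_colinear:
  fixes h :: "'l \<Rightarrow> 'n \<Rightarrow> 'n"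
  assumes h: "\<And>a a' m. h (a + a') m = h a m + h a' m" "\<And>a m m'. h a (m + m') = h a m + h a m'"
    "\<And>b a m. h (tg b * a) m = h a (m * bar b)"
  shows "sweedler (\<phi> (A.pure X n)) (\<lambda>X n. \<Delta> X (\<lambda>x z. h x (B.\<theta> z n))) = \<Delta> X (\<lambda>x z. h x (K z n))"
proof -
  have "sweedler (B.pure (sr b) 1 \<otimes>\<^bsub>B.cp\<^esub> V) B.\<theta> = sweedler V B.\<theta> * bar b" for b V
    by (simp add: B.sweedler_pure_left[OF B.\<theta>_bar] B.product_sum_\<theta>_sr sweedler_mult_right)
  then have "B.bilinear_on_cp (\<lambda>x p. h x (sweedler p B.\<theta>))"
    unfolding B.bilinear_on_cp_def balanced_map_def
    by (simp add: h B.sweedler_cp_add[OF B.\<theta>_bar] B.crossed_product_simps(5))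
  from sweedler_hom[OF \<phi> A.pure_carrier this, of X n]
  have "sweedler (\<phi> (A.pure X n)) (\<lambda>X n. \<Delta> X (\<lambda>x z. h x (B.\<theta> z n))) =
    sweedler (A.pure X n) (\<lambda>X n. \<Delta> X (\<lambda>x z. h x (K z n)))"
    by (simp add: B.sweedler_pure[OF B.\<theta>_bar] K_def)
  also have "\<dots> = \<Delta> X (\<lambda>x z. h x (K z n))"
  proof (rule A.sweedler_pure)
    have "balanced_diamond (\<lambda>x z. h x (K z n))" for n
      by (rule diamondI) (simp_all add: h K_bal K_sr)
    then show "balanced_bar bar (\<lambda>X n. \<Delta> X (\<lambda>x z. h x (K z n)))"
      by (intro barI) (simp_all add: coproduct_add coproduct_tg_right K_bal h sweedler_plus)
  qed
  finally show ?thesis .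
qed

text \<open>
  The cochain of \<phi>: the coordinate of \<^verbatim>\<open>phi(e(X))\<close>.
\<close>

definition U :: "'l \<Rightarrow> 'n"
  where "U X = A.esum X K"

lemma K_U: "K X n = \<Delta> X (\<lambda>x z. A.\<theta> z n * U x)"
  using A.tensor_expansion[OF K_bar, of X n]
  by (simp add: K_left[symmetric] U_def A.esum_def sweedler_mult_left)

lemma U_linear: "left_linear U"
proof -
  have "(\<lambda>p. K (sr b * p)) = (\<lambda>p n. K p n * bar b)" "(\<lambda>p. K (tg b * p)) = (\<lambda>p n. bar b * K p n)" for b
    by (simp_all add: fun_eq_iff K_sr K_tg)
  then show ?thesis
    by (intro left_linearI) (simp_all add: U_def A.esum_simps K_bar A.esum_mult_left A.esum_mult_right)
qed

lemmas U_lin = left_linearD[OF U_linear]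

lemma K_mult_right: "K p (l * n) = \<Delta> p (\<lambda>a z. K z l * act' a n)"
proof -
  have "K p (l * n) = sweedler (\<phi> (A.pure p l)) (\<lambda>X m. B.\<theta> X (m * n))"
    using K_product[of p l 1 n] unfolding \<phi>_base
    by (simp add: A.product_sum_one_right[OF K_bar] B.sweedler_pure_right[OF B.\<theta>_bar]
      B.product_sum_one_right[OF B.\<theta>_bar])
  also have "\<dots> = \<Delta> p (\<lambda>a z. K z l * act' a n)"
    unfolding B.\<theta>_mult_right
    by (rule K_colinear[of "\<lambda>a m. m * act' a n"])
      (simp_all add: B.act_add B.act_tg_left ring_rules)
  finally show ?thesis .
qed

lemma esum_K_mult_right: "A.esum X (\<lambda>p l. K p (l * n)) = \<Delta> X (\<lambda>a w. U w * act' a n)"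
proof -
  have "A.esum X (\<lambda>p l. \<Delta> p (\<lambda>a z. K z l * act' a n)) = \<Delta> X (\<lambda>a w. A.esum w (\<lambda>z l. K z l * act' a n))"
    by (rule A.esum_coproduct)
      (auto intro!: diamondI barI simp: K_bal K_sr B.act_add B.act_tg_left ring_rules)
  then show ?thesis by (simp add: K_mult_right[symmetric] A.esum_mult_right U_def)
qed

text \<open>
  Both sides are the coordinate of \<^verbatim>\<open>phi(e(X) n)\<close>: the left-hand one computes it as
  \<^verbatim>\<open>phi(e(X)) n\<close>, the right-hand one expands \<^verbatim>\<open>e(X) n\<close> first.
\<close>

lemma U_act: "\<Delta> X (\<lambda>x y. U y * act' x n) = \<Delta> X (\<lambda>x y. act y n * U x)"
proof -
  have b: "A.esum w (\<lambda>z l. A.\<theta> z (l * n)) = act w n" for w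
  proof -
    have "A.esum w (\<lambda>p l. \<Delta> p (\<lambda>a z. A.\<theta> z l * act a n)) = \<Delta> w (\<lambda>a w. A.esum w (\<lambda>z l. A.\<theta> z l * act a n))"
      by (rule A.esum_coproduct)
        (auto intro!: diamondI barI simp: A.\<theta>_simps A.act_add A.act_tg_left ring_rules)
    then show ?thesis
      by (simp add: A.\<theta>_mult_right[symmetric] A.esum_mult_right A.esum_\<theta> counit_conv_left A.left_linear_act)
  qed
  have "A.esum X (\<lambda>p l. \<Delta> p (\<lambda>a z. A.\<theta> z (l * n) * U a)) = \<Delta> X (\<lambda>a w. A.esum w (\<lambda>z l. A.\<theta> z (l * n) * U a))"
    by (rule A.esum_coproduct)
      (auto intro!: diamondI barI simp: A.\<theta>_simps U_lin ring_rules)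
  then have "A.esum X (\<lambda>p l. K p (l * n)) = \<Delta> X (\<lambda>a w. act w n * U a)"
    by (simp add: K_U A.esum_mult_right b)
  then show ?thesis by (simp add: esum_K_mult_right)
qed

lemma U_sr_tg: "U (X * sr b) = U (X * tg b)"
proof -
  have "(\<lambda>p. K (p * sr b)) = (\<lambda>p n. K p (n * bar b))"
    by (simp add: fun_eq_iff K_sr_right)
  then have "U (X * sr b) = \<Delta> X (\<lambda>x y. U y * act' x (bar b))"
    using esum_K_mult_right[of X "bar b"] by (simp add: U_def A.esum_simps K_bar)
  also have "\<dots> = U (X * tg b)"
    unfolding U_act A.act_bar by (rule counit_conv_left_tg[OF U_linear])
  finally show ?thesis .
qed

text \<open>
  The coordinate of \<^verbatim>\<open>phi(p q)\<close>, computed as that of \<^verbatim>\<open>phi(p) phi(q)\<close>.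
\<close>

lemma product_sum_K:
  "A.product_sum K p l r k = \<Delta> p (\<lambda>a z. K z l * \<Delta> r (\<lambda>y1 y2. B.act_\<tau> a y1 (K y2 k)))"
proof -
  let ?M = "\<lambda>a. \<Delta> r (\<lambda>y1 y2. B.act_\<tau> a y1 (K y2 k))"
  let ?p = "\<phi> (A.pure p l)" and ?r = "\<phi> (A.pure r k)"
  have M: "sweedler ?r (\<lambda>Y m. \<Delta> Y (\<lambda>y1 y2. B.act_\<tau> a y1 (B.\<theta> y2 m))) = ?M a" for a
    by (rule K_colinear) (simp_all add: B.act_\<tau>_simps)
  have "A.product_sum K p l r k = sweedler ?p (\<lambda>X n. sweedler ?r (\<lambda>Y m. \<Delta> X (\<lambda>a z. B.\<theta> z n *
      \<Delta> Y (\<lambda>y1 y2. B.act_\<tau> a y1 (B.\<theta> y2 m)))))"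
    unfolding K_product B.sweedler_cp_mult[OF B.\<theta>_bar] B.product_sum_\<theta>[abs_def] B.conv_act_\<tau> ..
  also have "\<dots> = sweedler ?p (\<lambda>X n. \<Delta> X (\<lambda>a z. sweedler ?r (\<lambda>Y m. B.\<theta> z n *
      \<Delta> Y (\<lambda>y1 y2. B.act_\<tau> a y1 (B.\<theta> y2 m)))))"
    by (intro arg_cong[where f = "sweedler ?p"] ext sweedler_swap)
  also have "\<dots> = sweedler ?p (\<lambda>X n. \<Delta> X (\<lambda>a z. B.\<theta> z n * ?M a))"
    unfolding sweedler_mult_left M ..
  also have "\<dots> = \<Delta> p (\<lambda>a z. K z l * ?M a)"
    by (rule K_colinear[of "\<lambda>a m. m * ?M a"])
      (simp_all add: B.act_\<tau>_simps sweedler_plus sweedler_mult_left ring_rules)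
  finally show ?thesis .
qed

text \<open>
  The same coordinate, computed by expanding the product p q through U.  The coaction of the product is
  the product of the coactions, by \<open>coproduct_plus_part\<close> for each of the two factors.
\<close>

lemma product_sum_K_U:
  "A.product_sum K p l r k = \<Delta> r (\<lambda>a' r'. \<Delta> p (\<lambda>a p'. A.product_sum A.\<theta> p' l r' k * U (a * a')))"
proof -
  have d: "balanced_diamond (\<lambda>a z. A.\<theta> (z * z') c * U (a * a'))" for z' c a'
    by (rule diamondI) (simp_all add: A.\<theta>_simps U_lin ring_rules)
  have dU: "balanced_diamond (\<lambda>a z. A.\<theta> z c * U a)" for c
    by (rule diamondI) (simp_all add: A.\<theta>_simps U_lin ring_rules)
  define f where "f p xm a' z' ym =
    \<Delta> ym (\<lambda>y1 y2. \<Delta> p (\<lambda>a z. A.\<theta> (z * z') (\<sigma> y2 xm * act y1 l * k) * U (a * a')))" for p xm a' z' ym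
  have 1: "A.product_sum K p l r k = \<Lambda> p (\<lambda>xp xm. \<Lambda> r (\<lambda>yp ym. \<Delta> yp (\<lambda>a' z'. f xp xm a' z' ym)))"
    unfolding A.product_sum_def f_def K_U coproduct_mult'[OF dU]
    by (intro arg_cong[where f = "\<Lambda> p"] arg_cong[where f = "\<Lambda> r"] ext sweedler_swap)
  have \<theta>_tg: "A.\<theta> (z * (z' * tg b)) c = A.\<theta> (z * z') (bar b * c)" for z z' b c
    using A.\<theta>_simps(4)[of "z * z'"] by (simp add: mult.assoc)
  have 2: "\<Lambda> r (\<lambda>yp ym. \<Delta> yp (\<lambda>a' z'. f xp xm a' z' ym)) = \<Delta> r (\<lambda>a' r'. \<Lambda> r' (\<lambda>z' ym. f xp xm a' z' ym))" for xp xm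
  proof (rule coproduct_plus_part)
    show "balanced_diamond (\<lambda>a' z'. f xp xm a' z' ym)" for ym
    proof (rule diamondI)
      fix b a' z'
      show "f xp xm (tg b * a') z' ym = f xp xm a' (sr b * z') ym"
        using takeuchi[OF d[of z' _ a']] by (simp add: f_def mult.assoc)
    qed (simp_all add: f_def A.\<theta>_simps U_lin ring_rules sweedler_plus)
    fix a'
    have d': "balanced_diamond (\<lambda>y1 y2. \<Delta> xp (\<lambda>a z. A.\<theta> (z * z') (\<sigma> y2 xm * act y1 l * k) * U (a * a')))" for z'
      by (rule diamondI) (simp_all add: A.\<theta>_simps A.\<sigma> A.act_add A.act_sr_left A.act_tg_left ring_rules sweedler_plus)
    show "balanced_bar tg (f xp xm a')"
    proof (rule barI)
      fix b z' ym
      show "f xp xm a' (z' * tg b) ym = f xp xm a' z' (tg b * ym)"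
        unfolding f_def coproduct_tg_left[OF d'] by (simp add: \<theta>_tg A.\<sigma> mult.assoc)
      fix ym'
      show "f xp xm a' z' (ym + ym') = f xp xm a' z' ym + f xp xm a' z' ym'"
        unfolding f_def by (rule coproduct_add[OF d'])
    qed (simp add: f_def A.\<theta>_simps ring_rules sweedler_plus)
  qed
  define g where "g r' a' a z xm =
    \<Lambda> r' (\<lambda>z' ym. \<Delta> ym (\<lambda>y1 y2. A.\<theta> (z * z') (\<sigma> y2 xm * act y1 l * k))) * U (a * a')" for r' a' a z xm
  have 3: "\<Lambda> p (\<lambda>xp xm. \<Delta> xp (\<lambda>a z. g r' a' a z xm)) = \<Delta> p (\<lambda>a p'. \<Lambda> p' (\<lambda>z xm. g r' a' a z xm))" for a' r'
  proof (rule coproduct_plus_part)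
    show "balanced_diamond (\<lambda>a z. g r' a' a z xm)" for xm
      by (rule diamondI) (simp_all add: g_def A.\<theta>_simps U_lin ring_rules sweedler_plus sweedler_mult_right)
    show "balanced_bar tg (g r' a' a)" for a
      using barD[OF A.product_sum_plus_balanced[OF A.\<theta>_bar, of r' l k]]
      by (intro barI) (simp_all add: g_def distrib_right)
  qed
  have 4: "\<Lambda> r' (\<lambda>z' ym. f xp xm a' z' ym) = \<Delta> xp (\<lambda>a z. g r' a' a z xm)" for r' xp xm a'
  proof -
    have "\<Lambda> r' (\<lambda>z' ym. f xp xm a' z' ym) = \<Lambda> r' (\<lambda>z' ym. \<Delta> xp (\<lambda>a z. \<Delta> ym (\<lambda>y1 y2.
        A.\<theta> (z * z') (\<sigma> y2 xm * act y1 l * k) * U (a * a'))))"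
      unfolding f_def by (intro arg_cong[where f = "\<Lambda> r'"] ext sweedler_swap)
    also have "\<dots> = \<Delta> xp (\<lambda>a z. \<Lambda> r' (\<lambda>z' ym. \<Delta> ym (\<lambda>y1 y2.
        A.\<theta> (z * z') (\<sigma> y2 xm * act y1 l * k) * U (a * a'))))"
      by (rule sweedler_swap)
    finally show ?thesis by (simp add: g_def sweedler_mult_right)
  qed
  have "A.product_sum K p l r k = \<Lambda> p (\<lambda>xp xm. \<Delta> r (\<lambda>a' r'. \<Delta> xp (\<lambda>a z. g r' a' a z xm)))"
    unfolding 1 2 4 ..
  also have "\<dots> = \<Delta> r (\<lambda>a' r'. \<Lambda> p (\<lambda>xp xm. \<Delta> xp (\<lambda>a z. g r' a' a z xm)))"
    by (rule sweedler_swap)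
  also have "\<dots> = \<Delta> r (\<lambda>a' r'. \<Delta> p (\<lambda>a p'. A.product_sum A.\<theta> p' l r' k * U (a * a')))"
    unfolding 3 by (simp add: g_def[abs_def] A.product_sum_def sweedler_mult_right)
  finally show ?thesis .
qed

text \<open>
  The two computations of the coordinate of \<^verbatim>\<open>phi(e(X) e(Y))\<close>.
\<close>

lemma conv_U:
  "\<tau> \<star> (\<lambda>X Y. U (X * Y)) = (\<lambda>X Y. \<Delta> X (\<lambda>x1 x2. U x2 * act' x1 (U Y))) \<star> \<tau>'"
proof (intro ext)
  fix X Y
  have "A.esum X (\<lambda>p l. A.esum Y (\<lambda>r k. A.product_sum K p l r k)) =
    \<Delta> X (\<lambda>a w. A.esum w K * \<Delta> Y (\<lambda>y1 y2. B.act_\<tau> a y1 (A.esum y2 K)))"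
    unfolding product_sum_K
    by (rule A.esum_esum) (simp_all add: K_bar K_sr B.act_\<tau>_simps)
  also have "\<dots> = ((\<lambda>X Y. \<Delta> X (\<lambda>x1 x2. U x2 * act' x1 (U Y))) \<star> \<tau>') X Y"
    by (simp add: U_def[symmetric] B.conv_act_\<tau>[symmetric]
        conv_left_multiple[OF U_linear B.balanced_act[OF U_linear] B.\<tau>_balanced])
  finally have 1: "A.esum X (\<lambda>p l. A.esum Y (\<lambda>r k. A.product_sum K p l r k)) = \<dots>" .
  let ?ps = "A.product_sum A.\<theta>"
  have psr: "balanced_bar bar (?ps p l)" "balanced_bar bar (\<lambda>p l. ?ps p l r k)" for p l r k
    by (rule A.product_sum_balanced_right[OF A.\<theta>_bar] A.product_sum_balanced_left[OF A.\<theta>_bar])+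
  note ps = barD[OF psr(1)] barD[OF psr(2)] A.product_sum_\<theta>_sr_left
    A.product_sum_sr_middle[OF A.\<theta>_bar, symmetric]
  have 2: "A.esum Y (\<lambda>r k. A.product_sum K p l r k) =
     \<Delta> Y (\<lambda>a' w'. \<Delta> p (\<lambda>a p'. A.esum w' (?ps p' l) * U (a * a')))" for p l
  proof -
    have d: "balanced_diamond (\<lambda>a p'. ?ps p' l r k * U (a * c))" for r k c
      by (rule diamondI) (simp_all add: ps U_lin ring_rules)
    have "A.esum Y (\<lambda>r k. \<Delta> r (\<lambda>a' r'. \<Delta> p (\<lambda>a p'. ?ps p' l r' k * U (a * a')))) =
      \<Delta> Y (\<lambda>a' w'. A.esum w' (\<lambda>r' k. \<Delta> p (\<lambda>a p'. ?ps p' l r' k * U (a * a'))))"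
    proof (rule A.esum_coproduct)
      show "balanced_diamond (\<lambda>a' r'. \<Delta> p (\<lambda>a p'. ?ps p' l r' k * U (a * a')))" for k
      proof (rule diamondI)
        fix b a' r'
        show "\<Delta> p (\<lambda>a p'. ?ps p' l r' k * U (a * (tg b * a'))) = \<Delta> p (\<lambda>a p'. ?ps p' l (sr b * r') k * U (a * a'))"
          using takeuchi[OF d[of r' k a'], of p b] by (simp add: ps mult.assoc)
      qed (simp_all add: ps(1-6) U_lin ring_rules sweedler_plus)
      show "balanced_bar bar (\<lambda>r' k. \<Delta> p (\<lambda>a p'. ?ps p' l r' k * U (a * a')))" for a'
        by (rule barI) (simp_all add: ps(1-6) ring_rules sweedler_plus)
    qed
    then show ?thesis by (simp add: product_sum_K_U A.esum_sweedler A.esum_mult_right)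
  qed
  have 3: "A.esum X (\<lambda>p l. \<Delta> p (\<lambda>a p'. A.esum w' (?ps p' l) * U (a * a'))) =
    \<Delta> X (\<lambda>a w. A.esum w (\<lambda>p' l. A.esum w' (?ps p' l) * U (a * a')))" for w' a'
  proof (rule A.esum_coproduct)
    have e: "A.esum w' (?ps (p + p') l) = A.esum w' (?ps p l) + A.esum w' (?ps p' l)"
      "A.esum w' (?ps p (l + l')) = A.esum w' (?ps p l) + A.esum w' (?ps p l')"
      "A.esum w' (?ps (sr b * p) l) = A.esum w' (?ps p l) * bar b"
      "A.esum w' (?ps (p * tg b) l) = A.esum w' (?ps p (bar b * l))" for p p' l l' b
    proof -
      have "?ps (p + p') l = (\<lambda>r k. ?ps p l r k + ?ps p' l r k)" "?ps p (l + l') = (\<lambda>r k. ?ps p l r k + ?ps p l' r k)"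
        "?ps (sr b * p) l = (\<lambda>r k. ?ps p l r k * bar b)" "?ps (p * tg b) l = ?ps p (bar b * l)"
        by (simp_all add: fun_eq_iff ps)
      then show "A.esum w' (?ps (p + p') l) = A.esum w' (?ps p l) + A.esum w' (?ps p' l)"
        "A.esum w' (?ps p (l + l')) = A.esum w' (?ps p l) + A.esum w' (?ps p l')"
        "A.esum w' (?ps (sr b * p) l) = A.esum w' (?ps p l) * bar b"
        "A.esum w' (?ps (p * tg b) l) = A.esum w' (?ps p (bar b * l))"
        by (simp_all add: A.esum_plus A.esum_mult_right)
    qed
    show "balanced_diamond (\<lambda>a p'. A.esum w' (?ps p' l) * U (a * a'))" for l
      by (rule diamondI) (simp_all add: e U_lin ring_rules)
    show "balanced_bar bar (\<lambda>p' l. A.esum w' (?ps p' l) * U (a * a'))" for a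
      by (rule barI) (simp_all add: e ring_rules)
  qed
  have "A.esum X (\<lambda>p l. A.esum Y (\<lambda>r k. A.product_sum K p l r k)) = (\<tau> \<star> (\<lambda>X Y. U (X * Y))) X Y"
    unfolding 2 A.esum_sweedler 3 A.esum_mult_right
    by (simp add: A.esum_product_\<theta> conv_swap)
  with 1 show "(\<tau> \<star> (\<lambda>X Y. U (X * Y))) X Y = ((\<lambda>X Y. \<Delta> X (\<lambda>x1 x2. U x2 * act' x1 (U Y))) \<star> \<tau>') X Y"
    by simp
qed

end

section \<open>Cocycle equivalence in terms of convolution\<close>

context bar_hopf_algebroid
begin

lemma left_linear_scale:
  assumes u: "left_linear u" shows "Vector_Spaces.linear (lscale H) sN u"
proof -
  interpret N: k_algebra sN using bar_ring by (simp add: bar_ring_def)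
  interpret b: Vector_Spaces.linear "bscale H" sN bar
    using bar_ring by (simp add: bar_ring_def anti_algebra_map_def)
  interpret s: Vector_Spaces.linear "bscale H" "lscale H" sr
    using src_map by (simp add: algebra_map_def)
  have "u (lscale H c X) = sN c (u X)" for c X
  proof -
    have "lscale H c X = sr (bscale H c 1) * X"
      by (simp add: s.scale lscale_left[symmetric])
    then show ?thesis by (simp add: left_linearD[OF u] b.scale N.scale_mult_right[symmetric])
  qed
  then show ?thesis
    by (simp add: Vector_Spaces.linear_iff left_linearD[OF u] vector_space_lscale N.vector_space_axioms)
qed

lemma cochain1_iff:
  "cochain1 H sN bar u \<longleftrightarrow> left_linear u \<and> (\<forall>X b. u (X * sr b) = u (X * tg b))"
proof
  assume u: "cochain1 H sN bar u"
  then have "u (sr b * tg b' * X) = bar b' * u X * bar b" for b b' X by (simp add: cochain1_def)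
  from this[of _ 1] this[of 1] have "left_linear u"
    using u linear_add[of "lscale H" sN u] by (intro left_linearI) (simp_all add: cochain1_def)
  then show "left_linear u \<and> (\<forall>X b. u (X * sr b) = u (X * tg b))" using u by (simp add: cochain1_def)
next
  assume u: "left_linear u \<and> (\<forall>X b. u (X * sr b) = u (X * tg b))"
  then show "cochain1 H sN bar u"
    by (simp add: cochain1_def left_linear_scale left_linearD[of u] mult.assoc)
qed

end

context twisted_system
begin

text \<open>
  The factor \<^verbatim>\<open>(X(2) |> v(Y)) v(X(1))\<close> of the transformed cocycle.  With it both equations of an
  equivalence are equations in convolution algebras.
\<close>

definition gauge :: "('l \<Rightarrow> 'n) \<Rightarrow> 'l \<Rightarrow> 'l \<Rightarrow> 'n"
  where "gauge v X Y = \<Delta> X (\<lambda>a b. act b (v Y) * v a)"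

lemma gauge_balanced:
  assumes v: "left_linear v" "\<And>X b. v (X * sr b) = v (X * tg b)"
  shows "balanced_cochain (gauge v)"
proof (rule cochainI)
  have d: "balanced_diamond (\<lambda>a b. act b m * v a)" for m
    by (rule balanced_product[OF left_linear_act v(1)])
  note vl = left_linearD[OF v(1)]
  fix b X X' Y Y'
  show "gauge v (X * sr b) Y = gauge v X (sr b * Y)"
    using takeuchi[OF d] by (simp add: gauge_def coproduct_sr_right d v(2) vl act_sr_right)
  show "gauge v (X * tg b) Y = gauge v X (tg b * Y)"
    by (simp add: gauge_def coproduct_tg_right d vl act_tg_right)
  show "gauge v (X + X') Y = gauge v X Y + gauge v X' Y" "gauge v X (Y + Y') = gauge v X Y + gauge v X Y'"
    "gauge v (sr b * X) Y = gauge v X Y * bar b" "gauge v (tg b * X) Y = bar b * gauge v X Y"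
    by (simp_all add: gauge_def coproduct_add coproduct_sr_left coproduct_tg_left d vl act_plus act_tg_left
        distrib_right sweedler_plus mult_sweedler mult.assoc)
qed

lemma sweedler3_gauge:
  "sweedler3 H X (\<lambda>X1 X2 X3. u X3 * act X2 n * v X1) = ((u \<odot> (\<lambda>X. act X n)) \<odot> v) X"
  by (simp add: sweedler3_def conv1_def sweedler_mult_right)

lemma sweedler4_gauge:
  assumes u: "left_linear u" and v: "left_linear v"
  shows "sweedler4 H X (\<lambda>X1 X2 X3 X4. sweedler3 H Y (\<lambda>Y1 Y2 Y3.
    u (X4 * Y3) * \<sigma> X3 Y2 * act X2 (v Y1) * v X1)) = (((\<lambda>X Y. u (X * Y)) \<star> \<sigma>) \<star> gauge v) X Y"
proof -
  let ?f = "(\<lambda>X Y. u (X * Y)) \<star> \<sigma>"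
  have bc: "balanced_cochain ?f" "balanced_cochain (\<lambda>X Y. act X (v Y))"
    by (rule balanced_cochain_conv balanced_compose_mult balanced_act u v \<sigma>_balanced)+
  have "sweedler4 H X (\<lambda>X1 X2 X3 X4. sweedler3 H Y (\<lambda>Y1 Y2 Y3.
    u (X4 * Y3) * \<sigma> X3 Y2 * act X2 (v Y1) * v X1)) =
    \<Delta> X (\<lambda>X1 z. \<Delta> z (\<lambda>X2 z'. \<Delta> Y (\<lambda>Y1 w. \<Delta> z' (\<lambda>X3 X4. \<Delta> w (\<lambda>Y2 Y3.
      u (X4 * Y3) * \<sigma> X3 Y2 * act X2 (v Y1) * v X1)))))"
    unfolding sweedler4_def sweedler3_def
    by (intro arg_cong[where f = "\<Delta> X"] ext, intro arg_cong[where f = "sweedler _"] ext sweedler_swap)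
  also have "\<dots> = \<Delta> X (\<lambda>X1 z. (?f \<star> (\<lambda>X Y. act X (v Y))) z Y * v X1)"
    unfolding sweedler_mult_right conv2_def ..
  also have "\<dots> = (?f \<star> gauge v) X Y"
    unfolding gauge_def[abs_def] by (rule conv_right_multiple[OF v bc, symmetric])
  finally show ?thesis .
qed

end

section \<open>Isomorphic crossed products have equivalent cocycles\<close>

context two_systems
begin

text \<open>
  The functional \<theta> factors as \<^verbatim>\<open>theta psi phi\<close>.  Expanding it through the cochain of \<psi> and then using the
  colinearity of \<phi> yields the convolution of the two cochains, when evaluated at e(X); \<theta> itself gives
  the counit.
\<close>

lemma inverse_cochains:
  assumes "crossed_morphism H sN bar \<sigma> \<tau> act \<sigma>' \<tau>' act' \<phi>" "crossed_morphism H sN bar \<sigma>' \<tau>' act' \<sigma> \<tau> act \<psi>"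
    and \<psi>\<phi>: "\<And>p. p \<in> carrier A.cp \<Longrightarrow> \<psi> (\<phi> p) = p"
  shows "crossed_morphism.U H bar \<tau> \<sigma>' act' \<phi> \<odot> crossed_morphism.U H bar \<tau>' \<sigma> act \<psi> =
    (\<lambda>X. bar (ep X))"
proof -
  interpret F: crossed_morphism H sN bar \<sigma> \<tau> act \<sigma>' \<tau>' act' \<phi> by (rule assms)
  interpret G: crossed_morphism H sN bar \<sigma>' \<tau>' act' \<sigma> \<tau> act \<psi> by (rule assms)
  have 1: "A.\<theta> p l = \<Delta> p (\<lambda>a z. F.K z l * G.U a)" for p l
  proof -
    have "A.\<theta> p l = sweedler (\<psi> (\<phi> (A.pure p l))) A.\<theta>"
      by (simp add: \<psi>\<phi> A.sweedler_pure[OF A.\<theta>_bar])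
    also have "\<dots> = sweedler (\<phi> (A.pure p l)) (\<lambda>X n. \<Delta> X (\<lambda>x z. B.\<theta> z n * G.U x))"
      by (subst G.K_sweedler) (simp_all add: F.hom G.K_U[abs_def])
    also have "\<dots> = \<Delta> p (\<lambda>a z. F.K z l * G.U a)"
      by (rule F.K_colinear[of "\<lambda>x m. m * G.U x"]) (simp_all add: G.U_lin ring_rules)
    finally show ?thesis .
  qed
  have "A.esum X (\<lambda>p l. \<Delta> p (\<lambda>a z. F.K z l * G.U a)) = \<Delta> X (\<lambda>a w. A.esum w (\<lambda>z l. F.K z l * G.U a))" for X
    by (rule A.esum_coproduct)
      (auto intro!: diamondI barI simp: F.K_bal F.K_sr G.U_lin ring_rules)
  then have "(F.U \<odot> G.U) X = A.esum X A.\<theta>" for X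
    by (simp add: conv1_def 1[abs_def] F.U_def A.esum_mult_right)
  then show ?thesis by (simp add: fun_eq_iff A.esum_\<theta>)
qed

lemma equivalent_if_isomorphic:
  assumes "isomorphic_crossed_products H bar \<sigma> act \<sigma>' act'"
  shows "equivalent_cocycles H sN bar \<sigma> act \<sigma>' act'"
proof -
  obtain \<phi> where iso: "\<phi> \<in> comodule_algebra_iso H A.cp B.cp" and base: "\<And>n. \<phi> (A.pure 1 n) = B.pure 1 n"
    using assms unfolding isomorphic_crossed_products_def by blast
  let ?\<psi> = "inv_into (carrier A.cp) \<phi>"
  have \<phi>: "\<phi> \<in> comodule_algebra_hom H A.cp B.cp" and bij: "bij_betw \<phi> (carrier A.cp) (carrier B.cp)"
    using iso by (auto simp: comodule_algebra_iso_def)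
  have \<psi>\<phi>: "?\<psi> (\<phi> p) = p" if "p \<in> carrier A.cp" for p
    using bij that by (simp add: bij_betw_def inv_into_f_f)
  have \<phi>\<psi>: "\<phi> (?\<psi> q) = q" if "q \<in> carrier B.cp" for q
    using bij that by (simp add: bij_betw_def f_inv_into_f)
  interpret F: crossed_morphism H sN bar \<sigma> \<tau> act \<sigma>' \<tau>' act' \<phi>
    by unfold_locales (rule \<phi>, rule base)
  interpret R: two_systems H sN bar \<sigma>' \<tau>' act' \<sigma> \<tau> act
    by (intro two_systems.intro) unfold_locales
  interpret G: crossed_morphism H sN bar \<sigma>' \<tau>' act' \<sigma> \<tau> act ?\<psi>
    by unfold_locales (rule inverse_hom[OF iso], metis base \<psi>\<phi> A.pure_carrier)
  let ?v = F.U and ?u = G.U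
  have vu: "?v \<odot> ?u = (\<lambda>X. bar (ep X))"
    by (rule inverse_cochains[OF F.crossed_morphism_axioms G.crossed_morphism_axioms \<psi>\<phi>])
  have uv: "?u \<odot> ?v = (\<lambda>X. bar (ep X))"
    by (rule R.inverse_cochains[OF G.crossed_morphism_axioms F.crossed_morphism_axioms \<phi>\<psi>])
  note lin = F.U_linear G.U_linear A.left_linear_act B.left_linear_act left_linear_conv
  have act: "(?u \<odot> (\<lambda>X. act X n)) \<odot> ?v = (\<lambda>X. act' X n)" for n
  proof -
    have "(\<lambda>X. act X n) \<odot> ?v = ?v \<odot> (\<lambda>X. act' X n)"
      by (simp add: fun_eq_iff conv1_def F.U_act)
    then have "(?u \<odot> (\<lambda>X. act X n)) \<odot> ?v = (?u \<odot> ?v) \<odot> (\<lambda>X. act' X n)"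
      by (simp add: conv_one_assoc lin)
    then show ?thesis by (simp add: uv conv_one_unit_left lin)
  qed
  let ?um = "\<lambda>X Y. ?u (X * Y)" and ?vm = "\<lambda>X Y. ?v (X * Y)"
  have bc: "balanced_cochain ?um" "balanced_cochain ?vm" "balanced_cochain (A.gauge ?v)"
    by (rule balanced_compose_mult A.gauge_balanced lin F.U_sr_tg)+
  note bc = bc A.\<sigma>_balanced A.\<tau>_balanced B.\<sigma>_balanced B.\<tau>_balanced balanced_cochain_conv
  have um_vm: "?um \<star> ?vm = conv_unit"
  proof (intro ext)
    fix X Y
    have "(?um \<star> ?vm) X Y = (?u \<odot> ?v) (X * Y)"
      by (simp add: conv1_def conv2_def coproduct_mult balanced_product lin)
    then show "(?um \<star> ?vm) X Y = conv_unit X Y" by (simp add: uv conv_unit_def)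
  qed
  have \<sigma>: "(?um \<star> \<sigma>) \<star> A.gauge ?v = \<sigma>'"
  proof -
    have e: "\<tau> \<star> ?vm = A.gauge ?v \<star> \<tau>'"
      unfolding F.conv_U F.U_act A.gauge_def[abs_def] ..
    have "A.gauge ?v = (A.gauge ?v \<star> \<tau>') \<star> \<sigma>'"
      by (simp add: conv_assoc bc B.\<tau>\<sigma> conv_unit_right)
    then have "\<sigma> \<star> A.gauge ?v = (\<sigma> \<star> \<tau>) \<star> ?vm \<star> \<sigma>'"
      by (simp add: e[symmetric] conv_assoc bc)
    then have "(?um \<star> \<sigma>) \<star> A.gauge ?v = (?um \<star> ?vm) \<star> \<sigma>'"
      by (simp add: A.\<sigma>\<tau> conv_unit_left conv_assoc bc)
    then show ?thesis by (simp add: um_vm conv_unit_left bc)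
  qed
  have c: "cochain1 H sN bar ?u" "cochain1 H sN bar ?v"
    by (simp_all add: cochain1_iff lin F.U_sr_tg G.U_sr_tg)
  then have inv: "conv1_inverse H sN bar ?u ?v"
    unfolding conv1_inverse_def using uv vu by simp
  show ?thesis
    unfolding equivalent_cocycles_def
  proof (intro bexI exI conjI allI)
    show "?u \<in> C1 H sN bar" using c inv by (auto simp: C1_def)
    show "conv1_inverse H sN bar ?u ?v" by (rule inv)
    show "act' X n = sweedler3 H X (\<lambda>X1 X2 X3. ?u X3 * act X2 n * ?v X1)" for X n
      unfolding A.sweedler3_gauge act ..
    show "\<sigma>' X Y = sweedler4 H X (\<lambda>X1 X2 X3 X4. sweedler3 H Y (\<lambda>Y1 Y2 Y3.
      ?u (X4 * Y3) * \<sigma> X3 Y2 * act X2 (?v Y1) * ?v X1))" for X Y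
      unfolding A.sweedler4_gauge[OF G.U_linear F.U_linear] \<sigma> ..
  qed
qed

end

section \<open>Equivalent cocycles have isomorphic crossed products\<close>

context bar_hopf_algebroid
begin

definition twist :: "('l \<Rightarrow> 'n) \<Rightarrow> ('l \<Rightarrow> 'n \<Rightarrow> 'a::comm_monoid_add) \<Rightarrow> 'l \<Rightarrow> 'n \<Rightarrow> 'a"
  where "twist u f X n = \<Lambda> X (\<lambda>p q. f p (u q * n))"

text \<open>
  The map \<^verbatim>\<open>X (x) n |-> X+ (x) u(X-) n\<close>, on classes; \<open>twist u f\<close> is its composition with f.
\<close>

definition twist_map :: "('l \<Rightarrow> 'n) \<Rightarrow> ('l \<times> 'n) multiset set \<Rightarrow> ('l \<times> 'n) multiset set"
  where "twist_map u p = bcls H bar (sweedler p (twist u (\<lambda>x k. {#(x, k)#})))"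

lemma twist_bar:
  "left_linear u \<Longrightarrow> balanced_bar bar f \<Longrightarrow> balanced_bar tg (\<lambda>p q. f p (u q * n))"
  by (rule barI) (simp_all add: barD[of bar f] left_linearD[of u] distrib_right mult.assoc)

lemma twist_balanced:
  assumes u: "left_linear u" and f: "balanced_bar bar f" shows "balanced_bar bar (twist u f)"
  unfolding twist_def
  by (rule barI) (simp_all add: translation_add translation_tg_right twist_bar[OF u f] barD[OF f] left_linearD[OF u]
      distrib_left sweedler_plus mult.assoc)

lemma twist_twist:
  assumes u: "left_linear u" and v: "left_linear v" and vu: "v \<odot> u = (\<lambda>X. bar (ep X))"
    and f: "balanced_bar bar f"
  shows "twist u (twist v f) = f"
proof (intro ext)
  fix X n
  note f' = barD[OF f]
  have "\<Lambda> X (\<lambda>p q. \<Delta> q (\<lambda>q1 q2. f p (v q2 * (u q1 * n)))) =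
    \<Lambda> X (\<lambda>p q. \<Lambda> p (\<lambda>p' q'. f p' (v q' * (u q * n))))"
    by (rule coproduct_minus_part)
      (rule twist_bar[OF v f], rule diamondI, simp_all add: f' left_linearD[OF u] left_linearD[OF v] ring_rules)
  then have "twist u (twist v f) X n = \<Lambda> X (\<lambda>p q. f p ((v \<odot> u) q * n))"
    by (simp add: twist_def conv1_def sweedler_mult_right[symmetric] sweedler_additive[of "f _"] f' mult.assoc)
  also have "\<dots> = \<Lambda> X (\<lambda>p q. f (p * tg (ep q)) n)" by (simp add: vu f')
  also have "\<dots> = f X n" by (rule translation_counit) (simp add: f')
  finally show "twist u (twist v f) X n = f X n" .
qed

lemma sweedler_twist_map: "balanced_bar bar f \<Longrightarrow> sweedler (twist_map u p) f = sweedler p (twist u f)"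
  by (simp add: twist_map_def sweedler_bcls msum_sweedler twist_def[abs_def])

lemma twist_map_carrier: "twist_map u p \<in> carrier (tensor_bar H bar)"
  by (simp add: twist_map_def bcls_carrier)

end

locale cocycle_equivalence = two_systems H sN bar \<sigma> \<tau> act \<sigma>' \<tau>' act'
  for H :: "('k::field, 'b::{ring,monoid_mult}, 'l::{ring,monoid_mult}, 'z) bialgebroid_scheme"
    and sN :: "'k \<Rightarrow> 'n::{ring,monoid_mult} \<Rightarrow> 'n" and bar :: "'b \<Rightarrow> 'n"
    and \<sigma> \<tau> act \<sigma>' \<tau>' act' +
  fixes u v :: "'l \<Rightarrow> 'n"
  assumes u_cochain: "cochain1 H sN bar u" and inverse: "conv1_inverse H sN bar u v"
    and act'_eq: "\<And>X n. act' X n = sweedler3 H X (\<lambda>X1 X2 X3. u X3 * act X2 n * v X1)"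
    and \<sigma>'_eq: "\<And>X Y. \<sigma>' X Y = sweedler4 H X (\<lambda>X1 X2 X3 X4. sweedler3 H Y (\<lambda>Y1 Y2 Y3.
      u (X4 * Y3) * \<sigma> X3 Y2 * act X2 (v Y1) * v X1))"
begin

lemma u_linear: "left_linear u" and v_linear: "left_linear v"
  and u_sr: "u (X * sr b) = u (X * tg b)" and v_sr: "v (X * sr b) = v (X * tg b)"
  using u_cochain inverse by (auto simp: conv1_inverse_def cochain1_iff)

lemmas u = left_linearD[OF u_linear]

lemma uv: "u \<odot> v = (\<lambda>X. bar (ep X))" and vu: "v \<odot> u = (\<lambda>X. bar (ep X))"
  using inverse by (simp_all add: conv1_inverse_def fun_eq_iff)

lemma act'_conv: "(\<lambda>X. act' X n) \<odot> u = u \<odot> (\<lambda>X. act X n)"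
proof -
  have "(\<lambda>X. act' X n) = (u \<odot> (\<lambda>X. act X n)) \<odot> v"
    by (simp only: act'_eq A.sweedler3_gauge fun_eq_iff simp_thms)
  then show ?thesis
    by (simp add: conv_one_assoc vu conv_one_unit_right u_linear v_linear A.left_linear_act left_linear_conv)
qed

text \<open>
  The mirror image of \<open>gauge v\<close>, and its convolution inverse.
\<close>

definition conj_act :: "'l \<Rightarrow> 'l \<Rightarrow> 'n"
  where "conj_act X Y = (u \<odot> (\<lambda>X. act X (u Y))) X"

lemma conj_act_balanced: "balanced_cochain conj_act"
proof (rule cochainI)
  have d: "balanced_diamond (\<lambda>a b. u b * act a m)" for m
    by (rule balanced_product[OF u_linear A.left_linear_act])
  fix b X X' Y Y'
  show "conj_act (X * sr b) Y = conj_act X (sr b * Y)"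
    by (simp add: conj_act_def conv1_def coproduct_sr_right d u A.act_sr_right)
  show "conj_act (X * tg b) Y = conj_act X (tg b * Y)"
    using takeuchi[OF d] by (simp add: conj_act_def conv1_def coproduct_tg_right d u u_sr[symmetric] A.act_tg_right)
  show "conj_act (X + X') Y = conj_act X Y + conj_act X' Y" "conj_act X (Y + Y') = conj_act X Y + conj_act X Y'"
    "conj_act (sr b * X) Y = conj_act X Y * bar b" "conj_act (tg b * X) Y = bar b * conj_act X Y"
    by (simp_all add: conj_act_def conv1_def coproduct_add coproduct_sr_left coproduct_tg_left d u A.act_plus
        A.act_sr_left distrib_left sweedler_plus mult_sweedler mult.assoc)
qed

lemma \<sigma>'_conj_act: "\<sigma>' \<star> conj_act = (\<lambda>X Y. u (X * Y)) \<star> \<sigma>"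
proof -
  let ?um = "\<lambda>X Y. u (X * Y)"
  have bc: "balanced_cochain ?um" "balanced_cochain (A.gauge v)"
    by (rule balanced_compose_mult u_linear A.gauge_balanced v_linear v_sr)+
  note bc = bc A.\<sigma>_balanced conj_act_balanced balanced_cochain_conv
  have 1: "\<sigma>' = (?um \<star> \<sigma>) \<star> A.gauge v"
    by (simp only: fun_eq_iff \<sigma>'_eq A.sweedler4_gauge[OF u_linear v_linear] simp_thms)
  have 2: "A.gauge v \<star> conj_act = conv_unit"
  proof (intro ext)
    fix X Y
    note ll = A.left_linear_act u_linear v_linear left_linear_conv
    have a: "(((\<lambda>X. act X m) \<odot> v) \<odot> (u \<odot> (\<lambda>X. act X m'))) X = act X (m * m')" for m m'
    proof -
      have "((\<lambda>X. act X m) \<odot> v) \<odot> (u \<odot> (\<lambda>X. act X m')) = (\<lambda>X. act X m) \<odot> (v \<odot> u) \<odot> (\<lambda>X. act X m')"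
        by (simp add: conv_one_assoc ll)
      then show ?thesis by (simp add: vu conv_one_unit_left ll) (simp add: conv1_def A.act_mult)
    qed
    have "(A.gauge v \<star> conj_act) X Y = \<Delta> Y (\<lambda>y1 y2. (((\<lambda>X. act X (v y2)) \<odot> v) \<odot> (u \<odot> (\<lambda>X. act X (u y1)))) X)"
      by (simp add: conv_swap A.gauge_def conj_act_def conv1_def)
    also have "\<dots> = act X ((v \<odot> u) Y)"
      unfolding a conv1_def[of H v u] by (rule sweedler_additive[symmetric]) (rule A.act_plus)
    finally show "(A.gauge v \<star> conj_act) X Y = conv_unit X Y"
      by (simp add: vu A.act_bar conv_unit_def ep_mult_sr)
  qed
  show ?thesis
    unfolding 1 by (simp only: conv_assoc bc 2 conv_unit_right)
qed

text \<open>
  Normalisation is not part of an equivalence; it holds because both cocycles are normalised.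
\<close>

lemma u_one: "u 1 = 1"
proof -
  have "u 1 * v 1 = 1" and vu1: "v 1 * u 1 = 1"
    using fun_cong[OF uv, of 1] fun_cong[OF vu, of 1]
    by (simp_all add: conv1_def coproduct_one balanced_product u_linear v_linear counit_one)
  have "conj_act 1 1 = u 1 * u 1"
    by (simp add: conj_act_def conv1_def coproduct_one balanced_product u_linear A.left_linear_act)
  moreover note left = coproduct_one[OF conv_balanced_left[OF B.\<sigma>_balanced conj_act_balanced]]
  note right = coproduct_one[OF conv_balanced_right[OF B.\<sigma>_balanced conj_act_balanced, of 1, unfolded left]]
  have "(\<sigma>' \<star> conj_act) 1 1 = \<sigma>' 1 1 * conj_act 1 1"
    unfolding conv_swap left right ..
  ultimately have "(\<sigma>' \<star> conj_act) 1 1 = u 1 * u 1"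
    by (simp add: counit_one)
  moreover have "((\<lambda>X Y. u (X * Y)) \<star> \<sigma>) 1 1 = u 1"
    by (simp add: conv_swap coproduct_one conv_balanced_right conv_balanced_left A.\<sigma>_balanced
        balanced_compose_mult u_linear counit_one counit_conv_right)
  ultimately have "u 1 * u 1 = u 1" by (simp add: \<sigma>'_conj_act)
  then have "v 1 * (u 1 * u 1) = v 1 * u 1" by simp
  then show ?thesis by (simp add: vu1 mult.assoc[symmetric])
qed

text \<open>
  Multiplicativity of the twist, reduced to N: on the left u is applied before multiplying with \<sigma>', on
  the right after multiplying with \<sigma>.
\<close>

lemma cocycle_exchange:
  "\<Delta> q (\<lambda>q1 q2. \<Delta> s (\<lambda>t w. \<Delta> w (\<lambda>s1 s2. \<sigma>' s2 q2 * (act' s1 (u q1 * n) * u t)))) =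
   \<Delta> q (\<lambda>q1 q2. \<Delta> s (\<lambda>t w. \<Delta> t (\<lambda>s1 s2. u (w * q2) * (\<sigma> s2 q1 * act s1 n))))"
proof -
  note ll = A.left_linear_act u_linear left_linear_conv
  let ?\<kappa> = "\<lambda>X Y. (u \<odot> (\<lambda>X. act X (u Y * n))) X" and ?um = "\<lambda>X Y. u (X * Y)"
  have \<kappa>: "?\<kappa> = (\<lambda>X Y. \<Delta> X (\<lambda>a b. conj_act b Y * act a n))"
  proof (intro ext)
    fix X Y
    have "(\<lambda>X. act X (u Y * n)) = (\<lambda>X. act X (u Y)) \<odot> (\<lambda>X. act X n)"
      by (simp add: fun_eq_iff conv1_def A.act_mult)
    then have "?\<kappa> X Y = ((u \<odot> (\<lambda>X. act X (u Y))) \<odot> (\<lambda>X. act X n)) X"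
      by (simp add: conv_one_assoc ll)
    then show "?\<kappa> X Y = \<Delta> X (\<lambda>a b. conj_act b Y * act a n)"
      by (simp add: conj_act_def conv1_def[of H _ "\<lambda>X. act X n"])
  qed
  have b3: "balanced3 (\<lambda>t s1 s2. \<sigma>' s2 q2 * (act' s1 m * u t))" for q2 m
    by (rule balanced3I) (simp_all add: B.\<sigma> B.act_add B.act_sr_left B.act_tg_left u ring_rules)
  have b3': "balanced3 (\<lambda>s1 s2 w. u (w * q2) * (\<sigma> s2 q1 * act s1 n))" for q1 q2
    by (rule balanced3I) (simp_all add: A.\<sigma> A.act_add A.act_sr_left A.act_tg_left u ring_rules)
  have "\<Delta> q (\<lambda>q1 q2. \<Delta> s (\<lambda>t w. \<Delta> w (\<lambda>s1 s2. \<sigma>' s2 q2 * (act' s1 (u q1 * n) * u t)))) =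
    \<Delta> q (\<lambda>q1 q2. \<Delta> s (\<lambda>z s2. \<sigma>' s2 q2 * ((\<lambda>X. act' X (u q1 * n)) \<odot> u) z))"
    unfolding coassociativity[OF b3] conv1_def sweedler_mult_left ..
  also have "\<dots> = (\<sigma>' \<star> ?\<kappa>) s q" by (simp add: act'_conv conv_swap)
  also have "\<dots> = \<Delta> s (\<lambda>a b. (?um \<star> \<sigma>) b q * act a n)"
    unfolding \<kappa>
    by (subst conv_right_multiple[OF A.left_linear_act B.\<sigma>_balanced conj_act_balanced]) (simp only: \<sigma>'_conj_act)
  also have "\<dots> = \<Delta> q (\<lambda>q1 q2. \<Delta> s (\<lambda>s1 z. \<Delta> z (\<lambda>s2 w. u (w * q2) * (\<sigma> s2 q1 * act s1 n))))"
    unfolding conv_swap sweedler_mult_right[symmetric] mult.assoc by (rule sweedler_swap)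
  also have "\<dots> = \<Delta> q (\<lambda>q1 q2. \<Delta> s (\<lambda>t w. \<Delta> t (\<lambda>s1 s2. u (w * q2) * (\<sigma> s2 q1 * act s1 n))))"
    unfolding coassociativity[OF b3'] ..
  finally show ?thesis .
qed

text \<open>
  Both sides are brought to a sum over X+, Y+ and coproducts of X-, Y-, where they differ by
  \<open>cocycle_exchange\<close>.
\<close>

lemma twist_product:
  assumes f: "balanced_bar bar f"
  shows "\<Lambda> X (\<lambda>p q. \<Lambda> Y (\<lambda>r s. B.product_sum f p (u q * n) r (u s * m))) = A.product_sum (twist u f) X n Y m"
proof -
  note f' = barD[OF f]
  have f_tg: "f (p * (r * tg b)) k = f (p * r) (bar b * k)" for p r b k
    using f'(3)[of "p * r"] by (simp add: mult.assoc)
  define F where "F p' q' q r' s s' = \<Delta> s' (\<lambda>s1 s2. f (p' * r') (\<sigma>' s2 q' * act' s1 (u q * n) * (u s * m)))"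
    for p' q' q r' s s'
  have dF: "balanced_diamond (\<lambda>s1 s2. f W (\<sigma>' s2 q' * (act' s1 k * k')))" for W q' k k'
    by (rule diamondI) (simp_all add: f' B.act_simps B.\<sigma> ring_rules)
  have F: "F p' q' q (r' + r'') s s' = F p' q' q r' s s' + F p' q' q r'' s s'"
    "F (p' + p'') q' q r' s s' = F p' q' q r' s s' + F p'' q' q r' s s'"
    "F p' (q' + q'') q r' s s' = F p' q' q r' s s' + F p' q'' q r' s s'"
    "F p' q' (q + q0) r' s s' = F p' q' q r' s s' + F p' q' q0 r' s s'"
    "F p' q' q r' (s + s'') s' = F p' q' q r' s s' + F p' q' q r' s'' s'"
    "F p' q' q r' s (s' + s'') = F p' q' q r' s s' + F p' q' q r' s s''"
    "F p' q' q (r' * tg b) s s' = F p' q' q r' s (tg b * s')"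
    "F p' q' q r' (tg b * s) s' = F p' q' q r' s (sr b * s')"
    "F (p' * tg b) q' q r' s s' = F p' q' q (tg b * r') s s'"
    "F p' (tg b * q') q r' s s' = F p' q' q r' s (s' * tg b)"
    "F p' (sr b * q') q r' s s' = F p' q' (tg b * q) r' s s'"
    for p' p'' q' q'' q q0 r' r'' s s' s'' b
    using takeuchi[OF dF]
    by (simp_all add: F_def f' f_tg B.act_simps B.\<sigma> u ring_rules coproduct_add coproduct_tg_left coproduct_sr_left
        coproduct_tg_right dF sweedler_plus)
  let ?G = "\<lambda>p' q q'. \<Lambda> Y (\<lambda>r s. \<Delta> s (F p' q' q r))"
  have dFs: "balanced_diamond (F p' q' q r)" for p' q' q r
    by (rule diamondI) (simp_all add: F)
  have Ff: "F p' q' q (r + r') = (\<lambda>t w. F p' q' q r t w + F p' q' q r' t w)"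
    "F (p' + p'') q' q r = (\<lambda>t w. F p' q' q r t w + F p'' q' q r t w)"
    "F p' (q' + q'') q r = (\<lambda>t w. F p' q' q r t w + F p' q'' q r t w)"
    "F p' q' (q + q0) r = (\<lambda>t w. F p' q' q r t w + F p' q' q0 r t w)"
    "F p' q' q (r * tg b) = (\<lambda>t w. F p' q' q r t (tg b * w))"
    "F (p' * tg b) q' q r = F p' q' q (tg b * r)"
    "F p' (tg b * q') q r = (\<lambda>t w. F p' q' q r t (w * tg b))"
    "F p' (sr b * q') q r = F p' q' (tg b * q) r"
    for p' p'' q' q'' q q0 r r' b
    by (simp_all add: fun_eq_iff F)
  have bFs: "balanced_bar tg (\<lambda>r s. \<Delta> s (F p' q' q r))" for p' q' q
    by (rule barI) (simp_all add: Ff(1,5) coproduct_add coproduct_tg_left dFs sweedler_plus)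
  have 1: "\<Lambda> Y (\<lambda>r s. \<Lambda> r (\<lambda>r' s'. F p' q' q r' s s')) = ?G p' q q'" for p' q' q
    by (rule coproduct_minus_part[symmetric, OF _ dFs]) (rule barI, simp_all add: F)
  have 2: "\<Lambda> X (\<lambda>p q. \<Lambda> p (\<lambda>p' q'. ?G p' q q')) = \<Lambda> X (\<lambda>p q. \<Delta> q (?G p))"
  proof (rule coproduct_minus_part[symmetric])
    show "balanced_bar tg (\<lambda>p' q'. ?G p' z q')" for z
    proof (rule barI)
      fix b p' q'
      show "?G (p' * tg b) z q' = ?G p' z (tg b * q')"
        unfolding Ff(6,7) translation_takeuchi[OF bFs] coproduct_tg_right[OF dFs] ..
    qed (simp_all add: Ff(2,3) sweedler_plus)
    show "balanced_diamond (?G p')" for p'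
      by (rule diamondI) (simp_all add: Ff(3,4,8) sweedler_plus)
  qed
  have "\<Lambda> X (\<lambda>p q. \<Lambda> Y (\<lambda>r s. B.product_sum f p (u q * n) r (u s * m))) =
    \<Lambda> X (\<lambda>p q. \<Lambda> Y (\<lambda>r s. \<Lambda> p (\<lambda>p' q'. \<Lambda> r (\<lambda>r' s'. F p' q' q r' s s'))))"
    by (simp add: B.product_sum_def F_def)
  also have "\<dots> = \<Lambda> X (\<lambda>p q. \<Lambda> p (\<lambda>p' q'. \<Lambda> Y (\<lambda>r s. \<Lambda> r (\<lambda>r' s'. F p' q' q r' s s'))))"
    by (intro arg_cong[where f = "\<Lambda> X"] ext sweedler_swap)
  also have "\<dots> = \<Lambda> X (\<lambda>p q. \<Delta> q (?G p))" unfolding 1 2 ..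
  also have "\<dots> = \<Lambda> X (\<lambda>p q. \<Lambda> Y (\<lambda>r s. \<Delta> q (\<lambda>q1 q2. \<Delta> s (F p q2 q1 r))))"
    by (intro arg_cong[where f = "\<Lambda> X"] ext sweedler_swap)
  also have "\<dots> = \<Lambda> X (\<lambda>p q. \<Lambda> Y (\<lambda>r s. f (p * r) (\<Delta> q (\<lambda>q1 q2. \<Delta> s (\<lambda>t w. \<Delta> w (\<lambda>s1 s2.
      \<sigma>' s2 q2 * (act' s1 (u q1 * n) * u t)))) * m)))"
    by (simp add: F_def[abs_def] sweedler_mult_right[symmetric] sweedler_additive[of "f _"] f' mult.assoc)
  also have "\<dots> = \<Lambda> X (\<lambda>p q. \<Lambda> Y (\<lambda>r s. f (p * r) (\<Delta> q (\<lambda>q1 q2. \<Delta> s (\<lambda>t w. \<Delta> t (\<lambda>s1 s2.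
      u (w * q2) * (\<sigma> s2 q1 * act s1 n)))) * m)))"
    unfolding cocycle_exchange ..
  also have "\<dots> = A.product_sum (twist u f) X n Y m"
    using A.product_sum_split[of "\<lambda>W q k. f W (u q * k)" X n Y m]
    by (simp add: twist_def[abs_def] f' u sweedler_mult_right[symmetric] sweedler_additive[of "f _"] ring_rules)
  finally show ?thesis .
qed

lemma twist_map_cp: "twist_map u p \<in> carrier B.cp"
  by (simp add: B.crossed_product_simps twist_map_carrier)

lemma twist_map_add:
  assumes "p \<in> carrier A.cp" "q \<in> carrier A.cp"
  shows "twist_map u (p \<oplus>\<^bsub>A.cp\<^esub> q) = twist_map u p \<oplus>\<^bsub>B.cp\<^esub> twist_map u q"
  by (rule B.cp_eqI) (simp_all add: twist_map_cp B.cp_add_carrier sweedler_twist_map B.sweedler_cp_add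
      A.sweedler_cp_add assms twist_balanced u_linear)

lemma twist_map_mult: "twist_map u (p \<otimes>\<^bsub>A.cp\<^esub> q) = twist_map u p \<otimes>\<^bsub>B.cp\<^esub> twist_map u q"
proof (rule B.cp_eqI)
  fix f :: "'l \<Rightarrow> 'n \<Rightarrow> 'k" assume f: "balanced_bar bar f"
  note bl = B.product_sum_balanced_left[OF f] and br = B.product_sum_balanced_right[OF f]
  have tb: "balanced_bar bar (\<lambda>Y m. twist u (\<lambda>X n. B.product_sum f X n Y m) X n)" for X n
    using barD[OF br] by (intro barI) (simp_all add: twist_def sweedler_plus)
  have "sweedler (twist_map u p \<otimes>\<^bsub>B.cp\<^esub> twist_map u q) f =
    sweedler (twist_map u q) (\<lambda>Y m. sweedler (twist_map u p) (\<lambda>X n. B.product_sum f X n Y m))"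
    unfolding B.sweedler_cp_mult[OF f] by (rule sweedler_swap)
  also have "\<dots> = sweedler (twist_map u q) (\<lambda>Y m. sweedler p (\<lambda>X n. twist u (\<lambda>X n. B.product_sum f X n Y m) X n))"
    by (simp add: sweedler_twist_map bl)
  also have "\<dots> = sweedler p (\<lambda>X n. sweedler (twist_map u q) (\<lambda>Y m. twist u (\<lambda>X n. B.product_sum f X n Y m) X n))"
    by (rule sweedler_swap)
  also have "\<dots> = sweedler p (\<lambda>X n. sweedler q (\<lambda>Y m. A.product_sum (twist u f) X n Y m))"
  proof -
    have "twist u (\<lambda>Y m. twist u (\<lambda>X n. B.product_sum f X n Y m) X n) = A.product_sum (twist u f) X n" for X n
      unfolding twist_product[OF f, symmetric] fun_eq_iff twist_def
      by (intro allI sweedler_swap)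
    then show ?thesis by (simp add: sweedler_twist_map tb)
  qed
  finally show "sweedler (twist_map u (p \<otimes>\<^bsub>A.cp\<^esub> q)) f = sweedler (twist_map u p \<otimes>\<^bsub>B.cp\<^esub> twist_map u q) f"
    by (simp add: sweedler_twist_map f A.sweedler_cp_mult twist_balanced u_linear)
qed (simp_all add: twist_map_cp)

lemma twist_map_sr: "twist_map u (A.pure (sr b) n) = B.pure (sr b) n"
proof (rule B.cp_eqI)
  fix f :: "'l \<Rightarrow> 'n \<Rightarrow> 'k" assume f: "balanced_bar bar f"
  show "sweedler (twist_map u (A.pure (sr b) n)) f = sweedler (B.pure (sr b) n) f"
    by (simp add: sweedler_twist_map f A.sweedler_pure twist_balanced u_linear twist_def translation_sr
        twist_bar u_one)
qed (simp_all add: twist_map_cp)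

lemma twist_map_coaction:
  "coaction B.cp (twist_map u p) = B.cp_class (sweedler (coaction A.cp p) (\<lambda>X p0. {#(X, twist_map u p0)#}))"
proof -
  have "B.cp_class (rep (coaction B.cp (twist_map u p))) =
    B.cp_class (sweedler (coaction A.cp p) (\<lambda>X p0. {#(X, twist_map u p0)#}))"
  proof (rule B.cp_class_eqI[OF B.rep_coaction_set])
    show "set_mset (sweedler (coaction A.cp p) (\<lambda>X p0. {#(X, twist_map u p0)#})) \<subseteq> UNIV \<times> carrier B.cp"
      by (auto simp: sweedler_def twist_map_cp)
    fix g :: "'l \<Rightarrow> ('l \<times> 'n) multiset set \<Rightarrow> 'k" assume g: "B.bilinear_on_cp g"
    note gp = B.bilinear_on_cp_pure[OF g]
    note gb = diamondD[OF gp(1)] barD[OF gp(2)]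
    have "A.bilinear_on_cp (\<lambda>X p. g X (twist_map u p))"
      using g unfolding A.bilinear_on_cp_def B.bilinear_on_cp_def balanced_map_def
      by (simp add: twist_map_cp twist_map_add twist_map_mult A.crossed_product_simps(5)
          B.crossed_product_simps(5) twist_map_sr)
    from A.sweedler_coaction[OF this]
    have "sweedler (coaction A.cp p) (\<lambda>X p0. g X (twist_map u p0)) =
      sweedler p (\<lambda>X n. \<Delta> X (\<lambda>x z. g x (twist_map u (A.pure z n))))" .
    moreover have "g x (twist_map u (A.pure z n)) = \<Lambda> z (\<lambda>p q. g x (B.pure p (u q * n)))" for x z n
    proof -
      have "g x (twist_map u (A.pure z n)) = sweedler (twist_map u (A.pure z n)) (\<lambda>X n. g x (B.pure X n))"
        by (rule B.functional_sweedler[OF _ twist_map_cp])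
          (use g in \<open>simp add: B.bilinear_on_cp_def balanced_map_def\<close>)
      then show ?thesis
        by (simp add: sweedler_twist_map gp A.sweedler_pure twist_balanced u_linear twist_def)
    qed
    moreover have "\<Delta> X (\<lambda>x z. \<Lambda> z (\<lambda>p q. g x (B.pure p (u q * n)))) =
      twist u (\<lambda>X n. \<Delta> X (\<lambda>x z. g x (B.pure z n))) X n" for X n
      unfolding twist_def
      by (rule coproduct_plus_part[symmetric])
        (rule gp(1), rule twist_bar[OF u_linear gp(2)])
    moreover have "sweedler p (twist u (\<lambda>X n. \<Delta> X (\<lambda>x z. g x (B.pure z n)))) =
      sweedler (twist_map u p) (\<lambda>X n. \<Delta> X (\<lambda>x z. g x (B.pure z n)))"
    proof (rule sweedler_twist_map[symmetric])
      show "balanced_bar bar (\<lambda>X n. \<Delta> X (\<lambda>x z. g x (B.pure z n)))"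
        by (rule barI) (simp_all add: coproduct_add coproduct_tg_right gp(1) gb sweedler_plus)
    qed
    ultimately show "msum g (rep (coaction B.cp (twist_map u p))) =
        msum g (sweedler (coaction A.cp p) (\<lambda>X p0. {#(X, twist_map u p0)#}))"
      by (simp add: msum_sweedler B.sweedler_coaction[OF g] sweedler_msum[symmetric])
  qed
  then show ?thesis by (simp add: B.coaction_rep)
qed

lemma isomorphic_if_equivalent: "isomorphic_crossed_products H bar \<sigma> act \<sigma>' act'"
proof -
  have one: "twist_map u (A.pure 1 n) = B.pure 1 n" for n
    using twist_map_sr[of 1 n] by simp
  have "twist_map u \<in> comodule_algebra_hom H A.cp B.cp"
    unfolding comodule_algebra_hom_def ring_hom_def
    by (simp add: twist_map_cp twist_map_add twist_map_mult one A.crossed_product_simps(4,5)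
        B.crossed_product_simps(4,5) twist_map_sr twist_map_coaction)
  moreover have "bij_betw (twist_map u) (carrier A.cp) (carrier B.cp)"
  proof (rule bij_betw_byWitness[where f' = "twist_map v"])
    show "\<forall>p\<in>carrier A.cp. twist_map v (twist_map u p) = p"
    proof
      fix p assume p: "p \<in> carrier A.cp"
      show "twist_map v (twist_map u p) = p"
        by (rule A.cp_eqI[OF _ p])
          (simp_all add: A.crossed_product_simps(1) twist_map_carrier sweedler_twist_map twist_balanced
            u_linear v_linear twist_twist vu)
    qed
    show "\<forall>p\<in>carrier B.cp. twist_map u (twist_map v p) = p"
    proof
      fix p assume p: "p \<in> carrier B.cp"
      show "twist_map u (twist_map v p) = p"
        by (rule B.cp_eqI[OF _ p])
          (simp_all add: B.crossed_product_simps(1) twist_map_carrier sweedler_twist_map twist_balanced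
            u_linear v_linear twist_twist uv)
    qed
  qed (auto simp: A.crossed_product_simps(1) B.crossed_product_simps(1) twist_map_carrier)
  ultimately show ?thesis
    unfolding isomorphic_crossed_products_def comodule_algebra_iso_def using one by blast
qed

end

lemma obtain_twisted_system:
  assumes "left_hopf_algebroid H" "bar_ring H sN bar" "twisted_module_algebra H sN bar \<sigma> act"
  obtains \<tau> where "twisted_system H sN bar \<sigma> \<tau> act"
proof -
  have "conv2_invertible H sN bar \<sigma>"
    using assms(3) by (simp add: twisted_module_algebra_def two_cocycle_def)
  then obtain \<tau> where "cochain2 H sN bar \<tau>" "\<forall>X Y. conv2 H \<sigma> \<tau> X Y = bar (counit H (X * Y))"
    "\<forall>X Y. conv2 H \<tau> \<sigma> X Y = bar (counit H (X * Y))"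
    unfolding conv2_invertible_def by blast
  then have "twisted_system H sN bar \<sigma> \<tau> act"
    by (intro twisted_system.intro bar_hopf_algebroid.intro hopf_algebroid.intro
        bar_hopf_algebroid_axioms.intro twisted_system_axioms.intro assms) simp_all
  then show ?thesis by (rule that)
qed

theorem theorem6p19:
  fixes H :: "('k::field, 'b::{ring,monoid_mult}, 'l::{ring,monoid_mult}) bialgebroid"
    and sN :: "'k \<Rightarrow> 'n::{ring,monoid_mult} \<Rightarrow> 'n" and bar :: "'b \<Rightarrow> 'n"
    and \<sigma> \<sigma>' :: "'l \<Rightarrow> 'l \<Rightarrow> 'n" and act act' :: "'l \<Rightarrow> 'n \<Rightarrow> 'n"
  assumes "left_hopf_algebroid H"
    and "faithfully_flat_bialgebroid H"
    and "bar_ring H sN bar"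
    and "twisted_module_algebra H sN bar \<sigma> act"
    and "twisted_module_algebra H sN bar \<sigma>' act'"
  shows "equivalent_cocycles H sN bar \<sigma> act \<sigma>' act' \<longleftrightarrow>
    isomorphic_crossed_products H bar \<sigma> act \<sigma>' act'"
proof -
  obtain \<tau> where A: "twisted_system H sN bar \<sigma> \<tau> act"
    using obtain_twisted_system[OF assms(1,3,4)] .
  obtain \<tau>' where B: "twisted_system H sN bar \<sigma>' \<tau>' act'"
    using obtain_twisted_system[OF assms(1,3,5)] .
  interpret two_systems H sN bar \<sigma> \<tau> act \<sigma>' \<tau>' act'
    by (intro two_systems.intro A B twisted_system.axioms(1)[OF A])
  show ?thesis
  proof
    assume "equivalent_cocycles H sN bar \<sigma> act \<sigma>' act'"
    then obtain u v where "cochain1 H sN bar u" "conv1_inverse H sN bar u v"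
      "\<And>X n. act' X n = sweedler3 H X (\<lambda>X1 X2 X3. u X3 * act X2 n * v X1)"
      "\<And>X Y. \<sigma>' X Y = sweedler4 H X (\<lambda>X1 X2 X3 X4. sweedler3 H Y (\<lambda>Y1 Y2 Y3.
        u (X4 * Y3) * \<sigma> X3 Y2 * act X2 (v Y1) * v X1))"
      unfolding equivalent_cocycles_def C1_def by blast
    then interpret cocycle_equivalence H sN bar \<sigma> \<tau> act \<sigma>' \<tau>' act' u v
      by unfold_locales
    show "isomorphic_crossed_products H bar \<sigma> act \<sigma>' act'" by (rule isomorphic_if_equivalent)
  next
    assume "isomorphic_crossed_products H bar \<sigma> act \<sigma>' act'"
    then show "equivalent_cocycles H sN bar \<sigma> act \<sigma>' act'" by (rule equivalent_if_isomorphic)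
  qed
qed

end
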